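(* (i) Let $R>0$, let $h_R:\mathbb{R}^3\to\mathbb{R}^3$ be the radial map $h_R(p)=Rp$, let $M=\mathbb{S}^2$ be the unit $2$-sphere isometrically embedded in $\mathbb{R}^3$, and let $N=h_R(M)$, with the Riemannian metrics inherited from $\mathbb{R}^3$. Then $h\in \operatorname{HD}(M,N)$ is a global minimizer of the functional $\Phi$ restricted to $\operatorname{HD}(M,N)$ if and only if $h=f\circ h_R|_M$, where $f$ is an isometry of $N$. (ii) Let $M$ and $N$ be compact Riemann surfaces, equipped with Riemannian metrics $g_M$ and $g_N$. If $\operatorname{HD}(M,N)$ is not empty and the genus of $M$ is at least two, then there exists a minimizer of the functional $\Phi$ in $\operatorname{HD}(M,N)$.
   Context: For diffeomorphic compact oriented Riemannian manifolds $(M,g_M)$, $(N,g_N)$ and a diffeomorphism $h:M\to N$, the deformation energy is $$\Phi(h)=\int_M\|h^*g_N-g_M\|^2\,\omega_M,$$ where $\omega_M$ is the Riemannian volume form of $M$ and $\|\cdot\|$ is the fiber norm on $(0,2)$-tensors on $M$ induced by the fiber inner product $g_M^*\otimes g_M^*$ (so $\|b\|^2=\sum_{i,j}b(e_i,e_j)^2$ for a $g_M$-orthonormal basis $(e_i)$). For Riemann surfaces $M$, $N$, $\operatorname{HD}(M,N)$ denotes the set of all smooth diffeomorphisms $h:M\to N$ that are holomorphic maps. In (i), $M=\mathbb{S}^2$ and $N=R\,\mathbb{S}^2$ are regarded as Riemann surfaces via stereographic projection onto the extended complex plane $\hat{\mathbb{C}}=\mathbb{C}\cup\{\infty\}$: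 for $M$ the projection is $\pi(y_1,y_2,y_3)=\frac{y_1+iy_2}{1-y_3}$ and for $N$ it is $y\mapsto\pi(y/R)$. *)

theory Defs
  imports "HOL-Complex_Analysis.Complex_Analysis" "HOL-Homology.Homology"
begin

section \<open>Smooth functions on open sets\<close>

text \<open>Only used on open sets. All iterated directional derivatives exist and are differentiable
  (hence continuous), which is the class of infinitely often differentiable functions.\<close>

primrec higher_differentiable_on ::
    "'a::real_normed_vector set \<Rightarrow> ('a \<Rightarrow> 'b::real_normed_vector) \<Rightarrow> nat \<Rightarrow> bool" where
  "higher_differentiable_on S f 0 \<longleftrightarrow> continuous_on S f"
| "higher_differentiable_on S f (Suc n) \<longleftrightarrow>
     (\<forall>x\<in>S. f differentiable (at x)) \<and>
     (\<forall>v. higher_differentiable_on S (\<lambda>x. frechet_derivative f (at x) v) n)"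

definition smooth_on ::
    "'a::real_normed_vector set \<Rightarrow> ('a \<Rightarrow> 'b::real_normed_vector) \<Rightarrow> bool" where
  "smooth_on S f \<longleftrightarrow> (\<forall>n. higher_differentiable_on S f n)"


section \<open>Riemann surfaces\<close>

text \<open>A chart is a pair of a domain and a coordinate function; the values of the coordinate function
  outside the domain are irrelevant.\<close>

type_synonym 'a chart = "'a set \<times> ('a \<Rightarrow> complex)"

abbreviation chart_dom :: "'a chart \<Rightarrow> 'a set" where
  "chart_dom c \<equiv> fst c"

abbreviation coord :: "'a chart \<Rightarrow> 'a \<Rightarrow> complex" where
  "coord c \<equiv> snd c"

definition chart_im :: "'a chart \<Rightarrow> complex set" where
  "chart_im c = coord c ` chart_dom c"

definition chart_inv :: "'a chart \<Rightarrow> complex \<Rightarrow> 'a" where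
  "chart_inv c = inv_into (chart_dom c) (coord c)"

record 'a surface =
  surf_top :: "'a topology"
  surf_atlas :: "'a chart set"

abbreviation points :: "'a surface \<Rightarrow> 'a set" where
  "points S \<equiv> topspace (surf_top S)"

definition chart_at :: "'a surface \<Rightarrow> 'a \<Rightarrow> 'a chart" where
  "chart_at S p = (SOME c. c \<in> surf_atlas S \<and> p \<in> chart_dom c)"

definition riemann_surface :: "'a surface \<Rightarrow> bool" where
  "riemann_surface S \<longleftrightarrow>
     Hausdorff_space (surf_top S) \<and> second_countable (surf_top S) \<and>
     connected_space (surf_top S) \<and> points S \<noteq> {} \<and>
     (\<Union>c\<in>surf_atlas S. chart_dom c) = points S \<and>
     (\<forall>c\<in>surf_atlas S. openin (surf_top S) (chart_dom c) \<and> open (chart_im c) \<and>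
        homeomorphic_map (subtopology (surf_top S) (chart_dom c)) (top_of_set (chart_im c))
          (coord c)) \<and>
     (\<forall>c\<in>surf_atlas S. \<forall>d\<in>surf_atlas S.
        (coord d \<circ> chart_inv c) holomorphic_on (coord c ` (chart_dom c \<inter> chart_dom d)))"

definition compact_riemann_surface :: "'a surface \<Rightarrow> bool" where
  "compact_riemann_surface S \<longleftrightarrow> riemann_surface S \<and> compact_space (surf_top S)"

text \<open>The first integral homology group of a compact connected oriented surface of genus \<open>g\<close> is
  free abelian of rank \<open>2 * g\<close>.\<close>

definition genus :: "'a surface \<Rightarrow> nat" where
  "genus S = (THE g. homology_group 1 (surf_top S) \<cong> free_Abelian_group {..<2 * g})"


section \<open>Maps between surfaces\<close>

definition local_rep :: "'a chart \<Rightarrow> 'b chart \<Rightarrow> ('a \<Rightarrow> 'b) \<Rightarrow> complex \<Rightarrow> complex" where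
  "local_rep c d h = coord d \<circ> h \<circ> chart_inv c"

definition smooth_map :: "'a surface \<Rightarrow> 'b surface \<Rightarrow> ('a \<Rightarrow> 'b) \<Rightarrow> bool" where
  "smooth_map M N h \<longleftrightarrow> continuous_map (surf_top M) (surf_top N) h \<and>
     (\<forall>c\<in>surf_atlas M. \<forall>d\<in>surf_atlas N.
        smooth_on (coord c ` (chart_dom c \<inter> h -` chart_dom d)) (local_rep c d h))"

definition diffeomorphism :: "'a surface \<Rightarrow> 'b surface \<Rightarrow> ('a \<Rightarrow> 'b) \<Rightarrow> bool" where
  "diffeomorphism M N h \<longleftrightarrow> bij_betw h (points M) (points N) \<and>
     smooth_map M N h \<and> smooth_map N M (inv_into (points M) h)"

definition holomorphic_map :: "'a surface \<Rightarrow> 'b surface \<Rightarrow> ('a \<Rightarrow> 'b) \<Rightarrow> bool" where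
  "holomorphic_map M N h \<longleftrightarrow> continuous_map (surf_top M) (surf_top N) h \<and>
     (\<forall>c\<in>surf_atlas M. \<forall>d\<in>surf_atlas N.
        local_rep c d h holomorphic_on (coord c ` (chart_dom c \<inter> h -` chart_dom d)))"

text \<open>Maps are total functions on the point type; two functions that agree on \<open>points M\<close> represent
  the same map.\<close>

definition HD :: "'a surface \<Rightarrow> 'b surface \<Rightarrow> ('a \<Rightarrow> 'b) set" where
  "HD M N = {h. diffeomorphism M N h \<and> holomorphic_map M N h}"


section \<open>Riemannian metrics and the deformation energy\<close>

text \<open>A field of \<open>(0,2)\<close>-tensors is given by its representatives in the charts: \<open>b c z u v\<close> is the
  value at the point with coordinate \<open>z\<close> in the chart \<open>c\<close>, on the tangent vectors with coordinate
  expressions \<open>u\<close> and \<open>v\<close>, where the tangent plane is identified with \<open>complex\<close> as a real vector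
  space. A Riemannian metric need not be conformal.\<close>

type_synonym 'a tensor_field = "'a chart \<Rightarrow> complex \<Rightarrow> complex \<Rightarrow> complex \<Rightarrow> real"

definition riemannian_metric :: "'a surface \<Rightarrow> 'a tensor_field \<Rightarrow> bool" where
  "riemannian_metric S g \<longleftrightarrow>
     (\<forall>c\<in>surf_atlas S. \<forall>z\<in>chart_im c.
        bilinear (g c z) \<and> (\<forall>u v. g c z u v = g c z v u) \<and> (\<forall>u. u \<noteq> 0 \<longrightarrow> 0 < g c z u u)) \<and>
     (\<forall>c\<in>surf_atlas S. \<forall>u v. smooth_on (chart_im c) (\<lambda>z. g c z u v)) \<and>
     (\<forall>c\<in>surf_atlas S. \<forall>d\<in>surf_atlas S. \<forall>p\<in>chart_dom c \<inter> chart_dom d. \<forall>u v.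
        let D = frechet_derivative (coord d \<circ> chart_inv c) (at (coord c p))
        in g c (coord c p) u v = g d (coord d p) (D u) (D v))"

text \<open>By the transformation law of the tensor field \<open>b\<close>, the value does not depend on the chart
  of the target chosen at the image point.\<close>

definition pullback ::
    "'a surface \<Rightarrow> 'b surface \<Rightarrow> ('a \<Rightarrow> 'b) \<Rightarrow> 'b tensor_field \<Rightarrow> 'a tensor_field" where
  "pullback M N h b c z u v =
     (let d = chart_at N (h (chart_inv c z));
          D = frechet_derivative (local_rep c d h) (at z)
      in b d (local_rep c d h z) (D u) (D v))"

definition riemannian_isometry ::
    "'a surface \<Rightarrow> 'a tensor_field \<Rightarrow> 'b surface \<Rightarrow> 'b tensor_field \<Rightarrow> ('a \<Rightarrow> 'b) \<Rightarrow> bool" where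
  "riemannian_isometry M gM N gN f \<longleftrightarrow> diffeomorphism M N f \<and>
     (\<forall>c\<in>surf_atlas M. \<forall>z\<in>chart_im c. pullback M N f gN c z = gM c z)"

text \<open>The squared norm of a bilinear form \<open>b\<close> on the plane induced by the inner product \<open>g\<close>; it does
  not depend on the chosen \<open>g\<close>-orthonormal basis.\<close>

definition tensor_norm_sq ::
    "(complex \<Rightarrow> complex \<Rightarrow> real) \<Rightarrow> (complex \<Rightarrow> complex \<Rightarrow> real) \<Rightarrow> real" where
  "tensor_norm_sq g b =
     (let e = (SOME e :: nat \<Rightarrow> complex. \<forall>i<2. \<forall>j<2. g (e i) (e j) = (if i = j then 1 else 0))
      in \<Sum>i<2. \<Sum>j<2. (b (e i) (e j))\<^sup>2)"

definition gram_det :: "(complex \<Rightarrow> complex \<Rightarrow> real) \<Rightarrow> real" where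
  "gram_det g = g 1 1 * g \<i> \<i> - g 1 \<i> * g \<i> 1"

text \<open>Integration against the Riemannian volume form, with the orientation of the complex
  structure, is integration with respect to the unique Borel measure that has density
  \<open>sqrt (det g)\<close> in every chart.\<close>

definition volume_measure :: "'a surface \<Rightarrow> 'a tensor_field \<Rightarrow> 'a measure" where
  "volume_measure S g = (THE \<mu>.
     space \<mu> = points S \<and>
     sets \<mu> = sigma_sets (points S) {U. openin (surf_top S) U} \<and>
     (\<forall>c\<in>surf_atlas S. \<forall>B\<in>sets \<mu>. B \<subseteq> chart_dom c \<longrightarrow>
        emeasure \<mu> B =
          (\<integral>\<^sup>+ z. ennreal (sqrt (gram_det (g c z))) * indicator (coord c ` B) z \<partial>lborel)))"

definition deformation_energy ::
    "'a surface \<Rightarrow> 'a tensor_field \<Rightarrow> 'b surface \<Rightarrow> 'b tensor_field \<Rightarrow> ('a \<Rightarrow> 'b) \<Rightarrow> real" where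
  "deformation_energy M gM N gN h =
     (\<integral>p. (let c = chart_at M p; z = coord c p
            in tensor_norm_sq (gM c z) (\<lambda>u v. pullback M N h gN c z u v - gM c z u v))
       \<partial>volume_measure M gM)"

definition energy_minimizer ::
    "'a surface \<Rightarrow> 'a tensor_field \<Rightarrow> 'b surface \<Rightarrow> 'b tensor_field \<Rightarrow> ('a \<Rightarrow> 'b) \<Rightarrow> bool" where
  "energy_minimizer M gM N gN h \<longleftrightarrow> h \<in> HD M N \<and>
     (\<forall>k\<in>HD M N. deformation_energy M gM N gN h \<le> deformation_energy M gM N gN k)"


section \<open>Round spheres\<close>

definition radial :: "real \<Rightarrow> real^3 \<Rightarrow> real^3" where
  "radial R p = R *\<^sub>R p"

definition stereo :: "real^3 \<Rightarrow> complex" where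
  "stereo y = Complex (y $ 1) (y $ 2) / complex_of_real (1 - y $ 3)"

text \<open>The Riemann surface structure is transported from the extended complex plane with its
  coordinates \<open>w\<close> on the plane and \<open>1 / w\<close> near infinity. In the second chart the north pole
  corresponds to infinity and has coordinate \<open>0\<close>; the south pole is excluded.\<close>

definition round_sphere :: "real \<Rightarrow> (real^3) surface" where
  "round_sphere R = (let N = radial R ` sphere 0 1 in
     \<lparr> surf_top = top_of_set N,
       surf_atlas =
         { (N - {radial R (axis 3 1)}, \<lambda>y. stereo (y /\<^sub>R R)),
           (N - {radial R (- axis 3 1)},
             \<lambda>y. if y = radial R (axis 3 1) then 0 else 1 / stereo (y /\<^sub>R R)) } \<rparr>)"

text \<open>The metric inherited from the ambient Euclidean space, as the first fundamental form of the
  local parametrizations.\<close>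

definition induced_metric :: "'a::real_inner tensor_field" where
  "induced_metric c z u v =
     frechet_derivative (chart_inv c) (at z) u \<bullet> frechet_derivative (chart_inv c) (at z) v"

end

theory Submission
  imports Defs "HOL-Library.Diagonal_Subsequence"
begin

text \<open>
  (ii) A minimizing sequence of holomorphic diffeomorphisms has bounded energy, that is, in charts
  the integral of \<open>cmod f' ^ 4\<close> is bounded. For an injective holomorphic \<open>f\<close>, Bloch's theorem and the
  change of variables formula turn this into a bound of \<open>(cmod f')\<^sup>2\<close> by a multiple of the
  inverse distance to the boundary, hence into a Hoelder estimate with exponent 1/2 as in Morrey's
  inequality. So the sequence is equicontinuous, and a subsequence converges locally uniformly. The
  limit is holomorphic, surjective by compactness and injective by Hurwitz's theorem, and its energy
  is at most the infimum by Fatou's lemma.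

  (i) On spheres \<open>h\<close> pulls the metric of the target back to \<open>\<lambda>\<close> times the metric of the source and
  the energy is the integral of \<open>2 * (\<lambda> - 1)\<^sup>2\<close>. The integral of \<open>\<lambda>\<close> is the area of the target, so
  the mean of \<open>\<lambda>\<close> is \<open>R\<^sup>2\<close>, and the energy is minimal exactly if \<open>\<lambda>\<close> is constant.
\<close>

section \<open>Change of variables for injective holomorphic maps\<close>

text \<open>The fourth power enters because a holomorphic map scales lengths by a factor
  proportional to \<open>cmod f'\<close>: the pulled back metric is of order
  \<open>(cmod f')\<^sup>2\<close> and the energy density of order \<open>cmod f' ^ 4\<close>. As 4
  exceeds the real dimension 2, Morrey's exponent is 1 - 2/4 = 1/2. This control is available only
  where the map is expressed in a single chart of the target, and nothing bounds in advance the disc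
  on which this is possible; so equicontinuity and control of the range have to be obtained
  together. No distance is chosen on the surfaces, hence equicontinuity appears as even continuity
  and locally uniform convergence as continuous convergence, both phrased with open sets. Two
  definitions need care. \<open>volume_measure\<close> is a definite description, so existence and
  uniqueness are proved from the transformation law of the density.
  \<open>deformation_energy\<close> is a Bochner integral with value 0 for a density that is not
  integrable, so energy 0 is treated apart: it is minimal because energies are nonnegative, and a
  nonzero energy guarantees integrability.\<close>

lemma lborel_complex_eq_distr:
  "(lborel :: complex measure) = distr lborel borel (\<lambda>v::real^2. Complex (v$1) (v$2))"
proof (rule lborel_eqI)
  fix l u :: complex
  assume le: "\<And>b. b \<in> Basis \<Longrightarrow> l \<bullet> b \<le> u \<bullet> b"
  have [measurable]: "(\<lambda>v::real^2. Complex (v$1) (v$2)) \<in> borel \<rightarrow>\<^sub>M borel"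
    by (intro borel_measurable_continuous_onI) (auto intro!: continuous_intros simp: Complex_eq)
  let ?l = "vector [Re l, Im l] :: real^2" and ?u = "vector [Re u, Im u] :: real^2"
  have le': "Re l \<le> Re u" "Im l \<le> Im u"
    using le[of 1] le[of \<i>] by (auto simp: Basis_complex_def)
  have eq: "(\<lambda>v::real^2. Complex (v$1) (v$2)) -` box l u = box ?l ?u"
    by (auto simp: box_def Basis_complex_def Basis_vec_def inner_axis UNIV_2)
  have "?l \<bullet> b \<le> ?u \<bullet> b" if "b \<in> Basis" for b
    using that le' by (auto simp: Basis_vec_def inner_axis UNIV_2)
  then have "emeasure lborel (box ?l ?u) = (\<Prod>b\<in>Basis. (?u - ?l) \<bullet> b)"
    by (rule emeasure_lborel_box) 
  also have "(\<Prod>b\<in>Basis. (?u - ?l) \<bullet> b) = (Re u - Re l) * (Im u - Im l)"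
  proof -
    have B: "(Basis :: (real^2) set) = {axis 1 1, axis 2 1}"
      by (auto simp: Basis_vec_def UNIV_2)
    have "axis 1 1 \<noteq> (axis 2 1 :: real^2)" by (auto simp: axis_eq_axis)
    then show ?thesis unfolding B by (simp add: inner_axis)
  qed
  finally show "emeasure (distr lborel borel (\<lambda>v::real^2. Complex (v$1) (v$2))) (box l u)
      = (\<Prod>b\<in>Basis. (u - l) \<bullet> b)"
    by (simp add: emeasure_distr eq Basis_complex_def complex_eq_iff)
qed simp

lemma holomorphic_injective_inverse_continuous:
  assumes "open U" "T holomorphic_on U" "inj_on T U"
  shows "open (T ` U)" "(inv_into U T) holomorphic_on (T ` U)"
proof -
  show "open (T ` U)" using open_mapping_thm3 assms by blast
  obtain g where g: "g holomorphic_on (T ` U)" "\<And>z. z \<in> U \<Longrightarrow> g (T z) = z"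
    using holomorphic_has_inverse[OF assms(2,1,3)] by metis
  show "(inv_into U T) holomorphic_on (T ` U)"
    using g assms(3) by (auto intro: holomorphic_transform[OF g(1)])
qed

lemma borel_image_injective_holomorphic:
  assumes U: "open U" "T holomorphic_on U" "inj_on T U"
    and E: "E \<in> sets borel" "E \<subseteq> U"
  shows "T ` E \<in> sets borel"
proof -
  note i = holomorphic_injective_inverse_continuous[OF U]
  have "T ` E = (inv_into U T) -` E \<inter> T ` U"
    using E U(3) by (auto simp: inj_on_def inv_into_f_f intro: image_eqI)
  moreover have "(inv_into U T) -` E \<inter> T ` U \<in> sets borel"
    using measurable_sets[OF borel_measurable_continuous_on_restrict[OF
        holomorphic_on_imp_continuous_on[OF i(2)]] E(1)] i(1)
    by (simp add: sets_restrict_space_iff space_restrict_space)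
  ultimately show ?thesis by simp
qed

lemma emeasure_holomorphic_image:
  assumes U: "open U" "T holomorphic_on U" "inj_on T U"
    and E: "E \<in> sets borel" "E \<subseteq> U"
  shows "emeasure lborel (T ` E)
    = (\<integral>\<^sup>+z. ennreal ((cmod (deriv T z))\<^sup>2) * indicator E z \<partial>lborel)"
proof -
  \<comment> \<open>The real Jacobian formula is applied on \<open>real^2\<close>.
    \<open>\<phi>\<close> and \<open>\<psi>\<close> are the coordinate isomorphisms, and
    \<open>lborel\<close> on \<open>complex\<close> is the image of \<open>lborel\<close> on
    \<open>real^2\<close> under \<open>\<phi>\<close>.\<close>
  define \<phi> where "\<phi> = (\<lambda>v::real^2. Complex (v$1) (v$2))"
  define \<psi> where "\<psi> = (\<lambda>z. vector [Re z, Im z] :: real^2)"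
  have [simp]: "\<phi> (\<psi> z) = z" "\<psi> (\<phi> v) = v" for z v
    by (auto simp: \<phi>_def \<psi>_def vec_eq_iff forall_2)
  have lin: "bounded_linear \<phi>" "bounded_linear \<psi>"
    by (auto simp: \<phi>_def \<psi>_def linear_conv_bounded_linear[symmetric] complex_eq_iff vec_eq_iff forall_2
        intro!: linearI)
  have [measurable]: "\<phi> \<in> borel \<rightarrow>\<^sub>M borel"
    by (intro borel_measurable_continuous_onI linear_continuous_on lin)
  have lb: "(lborel :: complex measure) = distr lborel borel \<phi>"
    unfolding \<phi>_def by (rule lborel_complex_eq_distr)
  define S where "S = \<phi> -` E"
  have S[measurable]: "S \<in> sets borel" unfolding S_def using measurable_sets[of \<phi> borel borel E] E by auto
  define F where "F = \<psi> \<circ> T \<circ> \<phi>"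
  have FS: "F ` S = \<phi> -` (T ` E)"
  proof (intro equalityI subsetI)
    fix x assume "x \<in> \<phi> -` (T ` E)"
    then obtain z where "\<phi> x = T z" "z \<in> E" by auto
    then have "x = F (\<psi> z)" "\<psi> z \<in> S"
      by (auto simp: F_def S_def) (metis \<open>\<psi> (\<phi> x) = x\<close>)
    then show "x \<in> F ` S" by blast
  qed (auto simp: F_def S_def)
  have TE[measurable]: "T ` E \<in> sets borel" by (rule borel_image_injective_holomorphic[OF U E])
  have FSb[measurable]: "F ` S \<in> sets borel" unfolding FS using measurable_sets[of \<phi> borel borel "T ` E"] TE by auto
  define D where "D = (\<lambda>z. \<psi> \<circ> (\<lambda>u. deriv T z * u) \<circ> \<phi>)"
  \<comment> \<open>Multiplication by a complex number a has the real matrix with rows (Re a, - Im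
    a) and (Im a, Re a), whose determinant is |a|^2.\<close>
  have det: "\<bar>det (matrix (D z))\<bar> = (cmod (deriv T z))\<^sup>2" for z
    by (simp add: D_def matrix_def det_2 \<phi>_def \<psi>_def cmod_power2 axis_def)
       (simp add: power2_eq_square)
  have der: "(F has_derivative D (\<phi> x)) (at x within S)" if "x \<in> S" for x
  proof -
    have "\<phi> x \<in> U" using that E by (auto simp: S_def)
    then have "(T has_field_derivative deriv T (\<phi> x)) (at (\<phi> x))"
      using holomorphic_derivI[OF U(2,1)] by blast
    then have "(T has_derivative (\<lambda>u. deriv T (\<phi> x) * u)) (at (\<phi> x))"
      by (simp add: has_field_derivative_def)
    moreover have "(\<phi> has_derivative \<phi>) (at x)" "(\<psi> has_derivative \<psi>) (at (T (\<phi> x)))"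
      using lin by (auto intro: bounded_linear_imp_has_derivative)
    ultimately have "(F has_derivative D (\<phi> x)) (at x)"
      unfolding F_def D_def using diff_chain_at by (metis comp_apply)
    then show ?thesis by (rule has_derivative_at_withinI)
  qed
  have inj: "inj_on F S"
  proof (rule inj_onI)
    fix x y assume "x \<in> S" "y \<in> S" "F x = F y"
    then have "\<phi> x \<in> U" "\<phi> y \<in> U" "\<phi> (F x) = \<phi> (F y)" using E(2) by (auto simp: S_def)
    then have "\<phi> x = \<phi> y" using U(3) by (auto simp: F_def inj_on_def)
    then have "\<psi> (\<phi> x) = \<psi> (\<phi> y)" by simp
    then show "x = y" by simp
  qed
  have iff: "F ` S \<in> lmeasurable \<and> measure lebesgue (F ` S) = m
     \<longleftrightarrow> ((\<lambda>x. (cmod (deriv T (\<phi> x)))\<^sup>2) has_integral m) S" for m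
    using has_measure_differentiable_image[OF _ der inj, of m] det by simp
  define k where "k = (\<lambda>x. (cmod (deriv T x))\<^sup>2 * indicator E x)"
  have k[measurable]: "k \<in> borel_measurable borel"
  proof -
    have "(\<lambda>x. indicator U x *\<^sub>R (cmod (deriv T x))\<^sup>2) \<in> borel_measurable borel"
      using U by (intro borel_measurable_continuous_on_indicator continuous_intros
         holomorphic_on_imp_continuous_on holomorphic_deriv) auto
    then have "(\<lambda>x. (indicator U x *\<^sub>R (cmod (deriv T x))\<^sup>2) * indicator E x) \<in> borel_measurable borel"
      using E by measurable
    moreover have "(\<lambda>x. (indicator U x *\<^sub>R (cmod (deriv T x))\<^sup>2) * indicator E x) = k"
      using E by (auto simp: k_def indicator_def fun_eq_iff)
    ultimately show ?thesis by simp
  qed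
  have k\<phi>: "k (\<phi> x) = (if x \<in> S then (cmod (deriv T (\<phi> x)))\<^sup>2 else 0)" for x
    by (auto simp: k_def S_def)
  let ?I = "\<integral>\<^sup>+z. ennreal (k z) \<partial>lborel"
  have I: "?I = (\<integral>\<^sup>+x. ennreal (k (\<phi> x)) \<partial>lborel)"
    by (subst lb, subst nn_integral_distr) auto
  have k0: "0 \<le> k x" for x by (simp add: k_def)
  have iff': "F ` S \<in> lmeasurable \<and> measure lebesgue (F ` S) = m
     \<longleftrightarrow> ((\<lambda>x. k (\<phi> x)) has_integral m) UNIV" for m
    unfolding iff k\<phi> by (rule has_integral_restrict_UNIV[symmetric])
  have em: "emeasure lborel (T ` E) = emeasure lborel (F ` S)"
    by (subst lb, subst emeasure_distr) (auto simp: FS)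
  have "emeasure lborel (F ` S) = ?I"
  \<comment> \<open>\<open>iff'\<close> speaks of finite measures only. If the image has infinite
    measure, a finite integral would by \<open>iff'\<close> give it a finite measure, so both sides
    are infinite.\<close>
  proof (cases "emeasure lborel (F ` S) = \<infinity>")
    case False
    then have l: "F ` S \<in> lmeasurable" by (auto simp: fmeasurable_def less_top)
    then have "((\<lambda>x. k (\<phi> x)) has_integral measure lebesgue (F ` S)) UNIV"
      using iff' by blast
    then have "(\<integral>\<^sup>+x. ennreal (k (\<phi> x)) \<partial>lborel) = measure lebesgue (F ` S)"
      using k0 by (intro nn_integral_has_integral_lborel) auto
    then show ?thesis using l I emeasure_eq_measure2[of "F ` S" lebesgue]
      by (simp add: emeasure_eq_ennreal_measure fmeasurable_def less_top)
  next
    case True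
    have "?I = \<infinity>"
    proof (rule ccontr)
      assume "?I \<noteq> \<infinity>"
      then obtain r where r: "0 \<le> r" "?I = ennreal r" by (cases ?I) auto
      then have "((\<lambda>x. k (\<phi> x)) has_integral r) UNIV"
        using k0 I by (intro nn_integral_has_integral) auto
      then have "F ` S \<in> lmeasurable" using iff' by blast
      then show False using True by (auto simp: fmeasurable_def)
    qed
    with True show ?thesis by simp
  qed
  moreover have "ennreal (k z) = ennreal ((cmod (deriv T z))\<^sup>2) * indicator E z" for z
    by (auto simp: k_def indicator_def)
  ultimately show ?thesis unfolding em by simp
qed

lemma borel_measurable_deriv_power:
  assumes "open U" "T holomorphic_on U"
  shows "(\<lambda>z. ennreal (cmod (deriv T z) ^ k) * indicator U z) \<in> borel_measurable borel"
proof -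
  have "(\<lambda>z. indicator U z *\<^sub>R cmod (deriv T z) ^ k) \<in> borel_measurable borel"
    using assms by (intro borel_measurable_continuous_on_indicator continuous_intros
       holomorphic_on_imp_continuous_on holomorphic_deriv) auto
  then have "(\<lambda>z. ennreal (indicator U z *\<^sub>R cmod (deriv T z) ^ k)) \<in> borel_measurable borel"
    by measurable
  moreover have "(\<lambda>z. ennreal (indicator U z *\<^sub>R cmod (deriv T z) ^ k))
      = (\<lambda>z. ennreal (cmod (deriv T z) ^ k) * indicator U z)"
    by (auto simp: indicator_def)
  ultimately show ?thesis by metis
qed

text \<open>The formula for sets says that \<open>T\<close> carries the measure with density
  \<open>(cmod (deriv T z))\<^sup>2\<close> on \<open>U\<close> to Lebesgue measure on the image of
  \<open>U\<close>; integrating \<open>f\<close> against both measures gives the claim.\<close>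

lemma nn_integral_holomorphic_change_of_variables:
  assumes U: "open U" "T holomorphic_on U" "inj_on T U"
    and f: "f \<in> borel_measurable borel"
  shows "(\<integral>\<^sup>+w. f w * indicator (T ` U) w \<partial>lborel)
    = (\<integral>\<^sup>+z. f (T z) * ennreal ((cmod (deriv T z))\<^sup>2) * indicator U z \<partial>lborel)"
proof -
  \<comment> \<open>Extension by 0 makes \<open>T\<close> a Borel function on the whole plane; the
    density vanishes outside \<open>U\<close>, so the added values have no weight.\<close>
  define T' where "T' = (\<lambda>z. if z \<in> U then T z else 0)"
  have cT: "continuous_on U T" using U by (auto intro: holomorphic_on_imp_continuous_on)
  have [measurable]: "T' \<in> borel_measurable borel"
  proof -
    have "(\<lambda>x. indicator U x *\<^sub>R T x) \<in> borel_measurable borel"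
      using U cT by (intro borel_measurable_continuous_on_indicator) auto
    moreover have "(\<lambda>x. indicator U x *\<^sub>R T x) = T'" by (auto simp: T'_def)
    ultimately show ?thesis by simp
  qed
  have [measurable]: "U \<in> sets borel" "T ` U \<in> sets borel" using U borel_image_injective_holomorphic[OF U] by auto
  note [measurable] = borel_measurable_deriv_power[OF U(1,2), of 2]
  define \<mu> where "\<mu> = density lborel (\<lambda>z. ennreal ((cmod (deriv T z))\<^sup>2) * indicator U z)"
  have eq: "distr \<mu> borel T' = density lborel (indicator (T ` U))"
  proof (rule measure_eqI)
    fix B assume "B \<in> sets (distr \<mu> borel T')"
    then have B[measurable]: "B \<in> sets borel" by simp
    have E: "T' -` B \<inter> U \<in> sets borel"
      using measurable_sets[of T' borel borel B] by auto
    have "emeasure (distr \<mu> borel T') B = emeasure \<mu> (T' -` B)"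
      by (subst emeasure_distr) (auto simp: \<mu>_def)
    also have "\<dots> = (\<integral>\<^sup>+z. ennreal ((cmod (deriv T z))\<^sup>2) * indicator U z * indicator (T' -` B) z \<partial>lborel)"
      unfolding \<mu>_def using measurable_sets[of T' borel borel B] by (subst emeasure_density) auto
    also have "\<dots> = (\<integral>\<^sup>+z. ennreal ((cmod (deriv T z))\<^sup>2) * indicator (T' -` B \<inter> U) z \<partial>lborel)"
      by (intro nn_integral_cong) (auto simp: indicator_def)
    also have "\<dots> = emeasure lborel (T ` (T' -` B \<inter> U))"
      by (rule emeasure_holomorphic_image[symmetric, OF U E]) auto
    also have "T ` (T' -` B \<inter> U) = T ` U \<inter> B" by (auto simp: T'_def)
    also have "emeasure lborel (T ` U \<inter> B) = emeasure (density lborel (indicator (T ` U))) B"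
      by (subst emeasure_density) (auto simp: indicator_inter_arith[symmetric] simp del: indicator_inter_arith)
    finally show "emeasure (distr \<mu> borel T') B = emeasure (density lborel (indicator (T ` U))) B" .
  qed simp
  have "(\<integral>\<^sup>+w. f w * indicator (T ` U) w \<partial>lborel) = (\<integral>\<^sup>+w. f w \<partial>density lborel (indicator (T ` U)))"
    using f by (subst nn_integral_density) (auto simp: mult.commute)
  also have "\<dots> = (\<integral>\<^sup>+z. f (T' z) \<partial>\<mu>)"
    unfolding eq[symmetric] using f by (subst nn_integral_distr) (auto simp: \<mu>_def)
  also have "\<dots> = (\<integral>\<^sup>+z. ennreal ((cmod (deriv T z))\<^sup>2) * indicator U z * f (T' z) \<partial>lborel)"
    unfolding \<mu>_def using f by (subst nn_integral_density) auto
  also have "\<dots> = (\<integral>\<^sup>+z. f (T z) * ennreal ((cmod (deriv T z))\<^sup>2) * indicator U z \<partial>lborel)"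
    by (intro nn_integral_cong) (auto simp: indicator_def T'_def mult.commute)
  finally show ?thesis .
qed

section \<open>Charts and the volume measure\<close>

lemma frechet_derivative_eq_deriv_mult:
  assumes "f field_differentiable (at z)"
  shows "frechet_derivative f (at z) u = deriv f z * u"
proof -
  have "(f has_derivative (\<lambda>u. deriv f z * u)) (at z)"
    using assms field_differentiable_derivI has_field_derivative_imp_has_derivative by blast
  then show ?thesis using frechet_derivative_at by metis
qed

lemma bilinear_complex_expand:
  fixes b :: "complex \<Rightarrow> complex \<Rightarrow> real"
  assumes "bilinear b"
  shows "b u v = Re u * Re v * b 1 1 + Re u * Im v * b 1 \<i>
    + Im u * Re v * b \<i> 1 + Im u * Im v * b \<i> \<i>"
proof -
  have e: "w = Re w *\<^sub>R 1 + Im w *\<^sub>R \<i>" for w by (simp add: complex_eq_iff)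
  have "b u v = b (Re u *\<^sub>R 1 + Im u *\<^sub>R \<i>) (Re v *\<^sub>R 1 + Im v *\<^sub>R \<i>)"
    using e[of u] e[of v] by metis
  also have "\<dots> = Re u * Re v * b 1 1 + Re u * Im v * b 1 \<i>
    + Im u * Re v * b \<i> 1 + Im u * Im v * b \<i> \<i>"
    using assms by (simp add: bilinear_ladd bilinear_radd bilinear_lmul bilinear_rmul algebra_simps)
  finally show ?thesis .
qed

text \<open>Multiplication by \<open>a\<close> has real determinant |a|^2, and a Gram determinant
  scales with the square of the determinant.\<close>

lemma gram_det_complex_mult:
  assumes "bilinear b"
  shows "gram_det (\<lambda>u v. b (a * u) (a * v)) = (cmod a)^4 * gram_det b"
proof -
  have n: "(cmod a)^4 = ((Re a)\<^sup>2 + (Im a)\<^sup>2)\<^sup>2"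
    by (metis cmod_power2 mult_2 numeral_Bit0 power2_eq_square power_add)
  show ?thesis unfolding gram_det_def n
    by (subst (1 2 3 4) bilinear_complex_expand[OF assms]) (simp add: power2_eq_square algebra_simps)
qed

definition inner_product :: "(complex \<Rightarrow> complex \<Rightarrow> real) \<Rightarrow> bool" where
  "inner_product b \<longleftrightarrow> bilinear b \<and> (\<forall>u v. b u v = b v u) \<and> (\<forall>u. u \<noteq> 0 \<longrightarrow> 0 < b u u)"

lemma gram_det_pos:
  assumes "inner_product b"
  shows "0 < gram_det b"
proof -
  have bl: "bilinear b" and s: "b \<i> 1 = b 1 \<i>" and p: "0 < b 1 1"
    using assms by (auto simp: inner_product_def)
  \<comment> \<open>\<open>?u\<close> is a combination of 1 and \<open>\<i>\<close> that is
    \<open>b\<close>-orthogonal to 1; its square length is \<open>b 1 1\<close> times the Gram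
    determinant.\<close>
  let ?u = "Complex (- b 1 \<i>) (b 1 1)"
  have "?u \<noteq> 0" using p by (simp add: complex_eq_iff)
  then have "0 < b ?u ?u" using assms by (auto simp: inner_product_def)
  also have "b ?u ?u = b 1 1 * gram_det b"
    by (subst bilinear_complex_expand[OF bl]) (simp add: gram_det_def s algebra_simps)
  finally show ?thesis using p by (simp add: zero_less_mult_iff)
qed

text \<open>Of the smoothness of a Riemannian metric, the volume measure only uses continuity.\<close>

definition continuous_metric :: "'a surface \<Rightarrow> 'a tensor_field \<Rightarrow> bool" where
  "continuous_metric S g \<longleftrightarrow>
     (\<forall>c\<in>surf_atlas S. \<forall>z\<in>chart_im c. inner_product (g c z)) \<and>
     (\<forall>c\<in>surf_atlas S. \<forall>u v. continuous_on (chart_im c) (\<lambda>z. g c z u v)) \<and>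
     (\<forall>c\<in>surf_atlas S. \<forall>d\<in>surf_atlas S. \<forall>p\<in>chart_dom c \<inter> chart_dom d. \<forall>u v.
        g c (coord c p) u v =
          g d (coord d p) (deriv (coord d \<circ> chart_inv c) (coord c p) * u)
            (deriv (coord d \<circ> chart_inv c) (coord c p) * v))"

section \<open>Charts, their inverses and transition maps\<close>

locale surface_charts =
  fixes S :: "'a surface"
  assumes riemann_surface: "riemann_surface S"
begin

lemma openin_chart_dom: "c \<in> surf_atlas S \<Longrightarrow> openin (surf_top S) (chart_dom c)"
  and open_chart_im: "c \<in> surf_atlas S \<Longrightarrow> open (chart_im c)"
  and homeomorphic_coord: "c \<in> surf_atlas S \<Longrightarrow>
    homeomorphic_map (subtopology (surf_top S) (chart_dom c)) (top_of_set (chart_im c)) (coord c)"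
  and Union_chart_dom: "(\<Union>c\<in>surf_atlas S. chart_dom c) = points S"
  and holomorphic_transition: "c \<in> surf_atlas S \<Longrightarrow> d \<in> surf_atlas S \<Longrightarrow>
    (coord d \<circ> chart_inv c) holomorphic_on (coord c ` (chart_dom c \<inter> chart_dom d))"
  and Hausdorff: "Hausdorff_space (surf_top S)"
  and second_countable: "second_countable (surf_top S)"
  and connected: "connected_space (surf_top S)"
  and nonempty: "points S \<noteq> {}"
  using riemann_surface unfolding riemann_surface_def by blast+

lemma chart_dom_subset: "c \<in> surf_atlas S \<Longrightarrow> chart_dom c \<subseteq> points S"
  using openin_chart_dom openin_subset by blast

lemma inj_on_coord: "c \<in> surf_atlas S \<Longrightarrow> inj_on (coord c) (chart_dom c)"
  using homeomorphic_coord[of c] chart_dom_subset[of c] homeomorphic_imp_injective_map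
  by (metis topspace_subtopology_subset)

lemma coord_in_chart_im [simp]: "p \<in> chart_dom c \<Longrightarrow> coord c p \<in> chart_im c"
  by (simp add: chart_im_def)

lemma chart_inv_coord [simp]:
  "c \<in> surf_atlas S \<Longrightarrow> p \<in> chart_dom c \<Longrightarrow> chart_inv c (coord c p) = p"
  by (simp add: chart_inv_def inj_on_coord)

lemma chart_inv_in_dom [simp]: "z \<in> chart_im c \<Longrightarrow> chart_inv c z \<in> chart_dom c"
  by (simp add: chart_inv_def chart_im_def inv_into_into)

lemma coord_chart_inv [simp]: "z \<in> chart_im c \<Longrightarrow> coord c (chart_inv c z) = z"
  by (simp add: chart_inv_def chart_im_def f_inv_into_f)

lemma chart_inv_in_points: "c \<in> surf_atlas S \<Longrightarrow> z \<in> chart_im c \<Longrightarrow> chart_inv c z \<in> points S"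
  using chart_dom_subset chart_inv_in_dom by blast

lemma chart_at_atlas: "p \<in> points S \<Longrightarrow> chart_at S p \<in> surf_atlas S"
  and in_chart_dom_chart_at: "p \<in> points S \<Longrightarrow> p \<in> chart_dom (chart_at S p)"
proof -
  assume "p \<in> points S"
  then have "\<exists>c. c \<in> surf_atlas S \<and> p \<in> chart_dom c" using Union_chart_dom by blast
  then have "chart_at S p \<in> surf_atlas S \<and> p \<in> chart_dom (chart_at S p)"
    unfolding chart_at_def by (rule someI_ex)
  then show "chart_at S p \<in> surf_atlas S" "p \<in> chart_dom (chart_at S p)" by auto
qed

lemma open_coord_image:
  assumes c: "c \<in> surf_atlas S" and V: "openin (surf_top S) V"
  shows "open (coord c ` (chart_dom c \<inter> V))"
proof -
  have "openin (subtopology (surf_top S) (chart_dom c)) (chart_dom c \<inter> V)"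
    using V openin_subtopology by blast
  then have "openin (top_of_set (chart_im c)) (coord c ` (chart_dom c \<inter> V))"
    using homeomorphic_coord[OF c] homeomorphic_imp_open_map open_map_def by blast
  then show ?thesis using open_chart_im[OF c] openin_open_trans by blast
qed

lemma openin_coord_vimage:
  assumes c: "c \<in> surf_atlas S" and W: "open W"
  shows "openin (surf_top S) {p \<in> chart_dom c. coord c p \<in> W}"
proof -
  have "continuous_map (subtopology (surf_top S) (chart_dom c)) (top_of_set (chart_im c)) (coord c)"
    using homeomorphic_coord[OF c] homeomorphic_imp_continuous_map by blast
  moreover have "openin (top_of_set (chart_im c)) (chart_im c \<inter> W)"
    using W by (simp add: openin_open_Int)
  ultimately have "openin (subtopology (surf_top S) (chart_dom c))
      {p \<in> topspace (subtopology (surf_top S) (chart_dom c)). coord c p \<in> chart_im c \<inter> W}"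
    using openin_continuous_map_preimage by blast
  moreover have "{p \<in> topspace (subtopology (surf_top S) (chart_dom c)). coord c p \<in> chart_im c \<inter> W}
      = {p \<in> chart_dom c. coord c p \<in> W}"
    using chart_dom_subset[OF c] by auto
  ultimately show ?thesis using openin_chart_dom[OF c] openin_trans_full by metis
qed

lemma chart_inv_image_eq:
  assumes "c \<in> surf_atlas S" "W \<subseteq> chart_im c"
  shows "chart_inv c ` W = {p \<in> chart_dom c. coord c p \<in> W}"
proof (intro equalityI subsetI)
  fix p assume "p \<in> {p \<in> chart_dom c. coord c p \<in> W}"
  then show "p \<in> chart_inv c ` W" using assms by (auto simp: image_iff intro!: bexI[of _ "coord c p"])
qed (use assms in \<open>auto simp: subset_iff\<close>)

lemma coord_image_eq:
  assumes "c \<in> surf_atlas S" "B \<subseteq> chart_dom c"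
  shows "coord c ` B = {z \<in> chart_im c. chart_inv c z \<in> B}"
proof (intro equalityI subsetI)
  fix z assume "z \<in> {z \<in> chart_im c. chart_inv c z \<in> B}"
  then show "z \<in> coord c ` B" by (auto simp: image_iff intro!: bexI[of _ "chart_inv c z"])
qed (use assms in \<open>auto simp: subset_iff\<close>)

lemma openin_chart_inv_image:
  assumes "c \<in> surf_atlas S" "open W" "W \<subseteq> chart_im c"
  shows "openin (surf_top S) (chart_inv c ` W)"
  using openin_coord_vimage[OF assms(1,2)] chart_inv_image_eq[OF assms(1,3)] by simp

lemma continuous_map_chart_inv:
  assumes c: "c \<in> surf_atlas S"
  shows "continuous_map (top_of_set (chart_im c)) (surf_top S) (chart_inv c)"
  unfolding continuous_map_def
proof (intro conjI allI impI)
  show "chart_inv c \<in> topspace (top_of_set (chart_im c)) \<rightarrow> points S"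
    using chart_inv_in_points[OF c] by auto
  fix V assume "openin (surf_top S) V"
  then have "open (coord c ` (chart_dom c \<inter> V))" by (rule open_coord_image[OF c])
  moreover have "coord c ` (chart_dom c \<inter> V) = {z \<in> chart_im c. chart_inv c z \<in> V}"
    by (subst coord_image_eq[OF c]) auto
  ultimately show "openin (top_of_set (chart_im c)) {z \<in> topspace (top_of_set (chart_im c)). chart_inv c z \<in> V}"
    by (auto intro!: open_subset)
qed

lemma open_coord_overlap:
  assumes "c \<in> surf_atlas S" "d \<in> surf_atlas S"
  shows "open (coord c ` (chart_dom c \<inter> chart_dom d))"
  using assms open_coord_image openin_chart_dom by blast

lemma inj_on_transition:
  assumes "c \<in> surf_atlas S" "d \<in> surf_atlas S"
  shows "inj_on (coord d \<circ> chart_inv c) (coord c ` (chart_dom c \<inter> chart_dom d))"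
proof (rule inj_onI)
  let ?T = "coord d \<circ> chart_inv c"
  fix z w assume "z \<in> coord c ` (chart_dom c \<inter> chart_dom d)" "w \<in> coord c ` (chart_dom c \<inter> chart_dom d)"
    and eq: "?T z = ?T w"
  then obtain p q where "p \<in> chart_dom c \<inter> chart_dom d" "q \<in> chart_dom c \<inter> chart_dom d"
    "z = coord c p" "w = coord c q" by auto
  then show "z = w" using eq assms inj_onD[OF inj_on_coord[OF assms(2)], of p q] by simp
qed

lemma transition_image:
  assumes "c \<in> surf_atlas S" "B \<subseteq> chart_dom c"
  shows "(coord d \<circ> chart_inv c) ` coord c ` B = coord d ` B"
proof -
  have "(coord d \<circ> chart_inv c) (coord c p) = coord d p" if "p \<in> B" for p
    using assms that by auto
  then show ?thesis by (simp add: image_image cong: image_cong)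
qed

text \<open>Transition maps are holomorphic, so the Frechet derivative in the transformation law is
  multiplication by the complex derivative.\<close>

lemma riemannian_metric_imp_continuous:
  assumes "riemannian_metric S g"
  shows "continuous_metric S g"
  unfolding continuous_metric_def inner_product_def
proof (intro conjI ballI allI)
  fix c u v assume "c \<in> surf_atlas S"
  then have "smooth_on (chart_im c) (\<lambda>z. g c z u v)"
    using assms by (auto simp: riemannian_metric_def)
  then show "continuous_on (chart_im c) (\<lambda>z. g c z u v)"
    unfolding smooth_on_def by (metis higher_differentiable_on.simps(1))
next
  fix c d p u v assume cd: "c \<in> surf_atlas S" "d \<in> surf_atlas S" "p \<in> chart_dom c \<inter> chart_dom d"
  let ?T = "coord d \<circ> chart_inv c"
  have "?T field_differentiable (at (coord c p))"
    using holomorphic_on_imp_differentiable_at[OF holomorphic_transition[OF cd(1,2)]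
        open_coord_overlap[OF cd(1,2)]] cd(3) by blast
  then have "frechet_derivative ?T (at (coord c p)) = (*) (deriv ?T (coord c p))"
    by (intro ext) (rule frechet_derivative_eq_deriv_mult)
  moreover have "let D = frechet_derivative ?T (at (coord c p))
        in g c (coord c p) u v = g d (coord d p) (D u) (D v)"
    using assms cd unfolding riemannian_metric_def by blast
  ultimately show "g c (coord c p) u v = g d (coord d p) (deriv ?T (coord c p) * u) (deriv ?T (coord c p) * v)"
    by (simp add: Let_def)
qed (use assms in \<open>auto simp: riemannian_metric_def\<close>)

end


section \<open>Borel sets of a surface, existence and uniqueness of the volume measure\<close>

definition surface_borel :: "'a surface \<Rightarrow> 'a measure" where
  "surface_borel S = sigma (points S) {U. openin (surf_top S) U}"

lemma space_surface_borel [simp]: "space (surface_borel S) = points S"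
  unfolding surface_borel_def by (rule space_measure_of) (auto dest: openin_subset)

lemma sets_surface_borel: "sets (surface_borel S) = sigma_sets (points S) {U. openin (surf_top S) U}"
  unfolding surface_borel_def by (rule sets_measure_of) (auto dest: openin_subset)

text \<open>The predicate inside the definite description \<open>volume_measure\<close>, named so
  that existence and uniqueness can be stated.\<close>

definition is_volume :: "'a surface \<Rightarrow> 'a tensor_field \<Rightarrow> 'a measure \<Rightarrow> bool" where
  "is_volume S g \<mu> \<longleftrightarrow>
     space \<mu> = points S \<and>
     sets \<mu> = sigma_sets (points S) {U. openin (surf_top S) U} \<and>
     (\<forall>c\<in>surf_atlas S. \<forall>B\<in>sets \<mu>. B \<subseteq> chart_dom c \<longrightarrow>
        emeasure \<mu> B =
          (\<integral>\<^sup>+ z. ennreal (sqrt (gram_det (g c z))) * indicator (coord c ` B) z \<partial>lborel))"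

text \<open>Cut off outside the chart image, where the representative of a metric is unconstrained;
  for a continuous metric this gives a Borel function on the plane.\<close>

definition chart_density :: "'a tensor_field \<Rightarrow> 'a chart \<Rightarrow> complex \<Rightarrow> ennreal" where
  "chart_density g c z = ennreal (sqrt (gram_det (g c z))) * indicator (chart_im c) z"

context surface_charts
begin

lemma sets_surface_borelI: "openin (surf_top S) U \<Longrightarrow> U \<in> sets (surface_borel S)"
  by (auto simp: sets_surface_borel)

text \<open>The arbitrary point used outside the chart image makes this a measurable map on the
  whole plane, so that measures can be pushed forward along it. \<open>chart_density\<close>
  vanishes where that point is taken.\<close>

definition total_chart_inv :: "'a chart \<Rightarrow> complex \<Rightarrow> 'a" where
  "total_chart_inv c z = (if z \<in> chart_im c then chart_inv c z else (SOME p. p \<in> points S))"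

lemma total_chart_inv_measurable:
  assumes c: "c \<in> surf_atlas S"
  shows "total_chart_inv c \<in> borel \<rightarrow>\<^sub>M surface_borel S"
proof (rule measurable_sigma_sets[OF sets_surface_borel])
  have q: "(SOME p. p \<in> points S) \<in> points S" using nonempty some_in_eq by blast
  show "total_chart_inv c \<in> space borel \<rightarrow> points S"
    using q chart_inv_in_points[OF c] by (auto simp: total_chart_inv_def)
  fix U assume "U \<in> {U. openin (surf_top S) U}"
  then have "open (coord c ` (chart_dom c \<inter> U))" using open_coord_image[OF c] by simp
  moreover have "total_chart_inv c -` U \<inter> space borel = coord c ` (chart_dom c \<inter> U) \<union>
      (if (SOME p. p \<in> points S) \<in> U then - chart_im c else {})"
    by (subst coord_image_eq[OF c]) (auto simp: total_chart_inv_def split: if_splits)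
  ultimately show "total_chart_inv c -` U \<inter> space borel \<in> sets borel"
    using open_chart_im[OF c] by auto
qed (auto dest: openin_subset)

lemma coord_image_borel:
  assumes c: "c \<in> surf_atlas S" and B: "B \<in> sets (surface_borel S)" "B \<subseteq> chart_dom c"
  shows "coord c ` B \<in> sets borel"
proof -
  have "coord c ` B = (total_chart_inv c -` B \<inter> space borel) \<inter> chart_im c"
    using B by (subst coord_image_eq[OF c]) (auto simp: total_chart_inv_def)
  then show ?thesis
    using measurable_sets[OF total_chart_inv_measurable[OF c] B(1)] open_chart_im[OF c] by auto
qed

lemma chart_density_measurable:
  assumes g: "continuous_metric S g" and c: "c \<in> surf_atlas S"
  shows "chart_density g c \<in> borel_measurable borel"
proof -
  have "continuous_on (chart_im c) (\<lambda>z. g c z u v)" for u v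
    using g c by (auto simp: continuous_metric_def)
  then have "continuous_on (chart_im c) (\<lambda>z. sqrt (gram_det (g c z)))"
    unfolding gram_det_def by (intro continuous_intros)
  then have "(\<lambda>z. indicator (chart_im c) z *\<^sub>R sqrt (gram_det (g c z))) \<in> borel_measurable borel"
    using open_chart_im[OF c] by (intro borel_measurable_continuous_on_indicator) auto
  then have "(\<lambda>z. ennreal (indicator (chart_im c) z *\<^sub>R sqrt (gram_det (g c z)))) \<in> borel_measurable borel"
    by measurable
  moreover have "(\<lambda>z. ennreal (indicator (chart_im c) z *\<^sub>R sqrt (gram_det (g c z)))) = chart_density g c"
    by (auto simp: chart_density_def indicator_def)
  ultimately show ?thesis by metis
qed

lemma chart_density_indicator:
  assumes "B \<subseteq> chart_dom c"
  shows "ennreal (sqrt (gram_det (g c z))) * indicator (coord c ` B) z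
    = chart_density g c z * indicator (coord c ` B) z"
  using assms by (auto simp: chart_density_def chart_im_def indicator_def)

lemma sqrt_gram_det_transition:
  assumes g: "continuous_metric S g" and cd: "c \<in> surf_atlas S" "d \<in> surf_atlas S"
    and p: "p \<in> chart_dom c \<inter> chart_dom d"
  shows "sqrt (gram_det (g c (coord c p))) =
    (cmod (deriv (coord d \<circ> chart_inv c) (coord c p)))\<^sup>2 * sqrt (gram_det (g d (coord d p)))"
proof -
  let ?a = "deriv (coord d \<circ> chart_inv c) (coord c p)"
  have "g c (coord c p) = (\<lambda>u v. g d (coord d p) (?a * u) (?a * v))"
    using g cd p unfolding continuous_metric_def by blast
  moreover have "bilinear (g d (coord d p))"
    using g cd(2) p unfolding continuous_metric_def inner_product_def by auto
  ultimately have "gram_det (g c (coord c p)) = (cmod ?a)^4 * gram_det (g d (coord d p))"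
    by (metis gram_det_complex_mult)
  also have "(cmod ?a)^4 = ((cmod ?a)\<^sup>2)\<^sup>2" by simp
  finally show ?thesis by (simp only: real_sqrt_mult real_sqrt_abs) simp
qed

text \<open>By \<open>sqrt_gram_det_transition\<close> the two densities differ by the squared
  modulus of the derivative of the transition map, which is exactly the factor in the holomorphic
  change of variables.\<close>

lemma chart_volume_independent:
  assumes g: "continuous_metric S g" and cd: "c \<in> surf_atlas S" "d \<in> surf_atlas S"
    and B: "B \<in> sets (surface_borel S)" "B \<subseteq> chart_dom c \<inter> chart_dom d"
  shows "(\<integral>\<^sup>+ z. chart_density g c z * indicator (coord c ` B) z \<partial>lborel)
    = (\<integral>\<^sup>+ z. chart_density g d z * indicator (coord d ` B) z \<partial>lborel)"
proof -
  let ?T = "coord d \<circ> chart_inv c" and ?U = "coord c ` (chart_dom c \<inter> chart_dom d)"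
  let ?f = "\<lambda>w. chart_density g d w * indicator (coord d ` B) w"
  have f: "?f \<in> borel_measurable borel"
    using chart_density_measurable[OF g cd(2)] coord_image_borel[OF cd(2) B(1)] B(2) by auto
  have TU: "?T ` ?U = coord d ` (chart_dom c \<inter> chart_dom d)"
    by (rule transition_image[OF cd(1)]) auto
  have "(\<integral>\<^sup>+ w. ?f w \<partial>lborel) = (\<integral>\<^sup>+ w. ?f w * indicator (?T ` ?U) w \<partial>lborel)"
    unfolding TU using B(2) by (intro nn_integral_cong) (auto simp: indicator_def)
  also have "\<dots> = (\<integral>\<^sup>+z. ?f (?T z) * ennreal ((cmod (deriv ?T z))\<^sup>2) * indicator ?U z \<partial>lborel)"
    by (rule nn_integral_holomorphic_change_of_variables[OF open_coord_overlap[OF cd]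
          holomorphic_transition[OF cd] inj_on_transition[OF cd] f])
  also have "\<dots> = (\<integral>\<^sup>+ z. chart_density g c z * indicator (coord c ` B) z \<partial>lborel)"
  proof (intro nn_integral_cong)
    fix z
    show "?f (?T z) * ennreal ((cmod (deriv ?T z))\<^sup>2) * indicator ?U z
      = chart_density g c z * indicator (coord c ` B) z"
    proof (cases "z \<in> ?U")
      case True
      then obtain p where p: "p \<in> chart_dom c \<inter> chart_dom d" and z: "z = coord c p" by auto
      have mem: "coord d p \<in> coord d ` B \<longleftrightarrow> p \<in> B" "coord c p \<in> coord c ` B \<longleftrightarrow> p \<in> B"
        using inj_on_image_mem_iff[OF inj_on_coord[OF cd(1)], of p B]
          inj_on_image_mem_iff[OF inj_on_coord[OF cd(2)], of p B] p B(2) by auto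
      have Tz: "?T z = coord d p" using p cd by (simp add: z)
      have "chart_density g c z = chart_density g d (coord d p) * ennreal ((cmod (deriv ?T z))\<^sup>2)"
      proof -
        have "chart_density g c z = ennreal (sqrt (gram_det (g c (coord c p))))"
          using p by (simp add: chart_density_def z)
        also have "\<dots> = ennreal ((cmod (deriv ?T z))\<^sup>2) * ennreal (sqrt (gram_det (g d (coord d p))))"
          unfolding sqrt_gram_det_transition[OF g cd p] z by (rule ennreal_mult') simp
        also have "ennreal (sqrt (gram_det (g d (coord d p)))) = chart_density g d (coord d p)"
          using p by (simp add: chart_density_def)
        finally show ?thesis by (simp only: mult.commute)
      qed
      moreover have "indicator (coord d ` B) (?T z) = (indicator (coord c ` B) z :: ennreal)"
        using mem unfolding Tz by (simp add: z indicator_def)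
      ultimately show ?thesis using True by (simp add: Tz ac_simps del: comp_apply)
    next
      case False
      then have "z \<notin> coord c ` B" using B(2) by auto
      then show ?thesis using False by simp
    qed
  qed
  finally show ?thesis ..
qed

lemma is_volume_emeasure:
  assumes "is_volume S g \<mu>" "c \<in> surf_atlas S" "B \<in> sets (surface_borel S)" "B \<subseteq> chart_dom c"
  shows "emeasure \<mu> B = (\<integral>\<^sup>+ z. chart_density g c z * indicator (coord c ` B) z \<partial>lborel)"
  using assms chart_density_indicator[OF assms(4), of g] unfolding is_volume_def sets_surface_borel by simp

lemma is_volume_sets: "is_volume S g \<mu> \<Longrightarrow> sets \<mu> = sets (surface_borel S)"
  by (simp add: is_volume_def sets_surface_borel)

lemma finite_chart_cover:
  assumes "compact_space (surf_top S)"
  obtains cs :: "nat \<Rightarrow> 'a chart" and m where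
    "\<And>i. i < m \<Longrightarrow> cs i \<in> surf_atlas S" "(\<Union>i<m. chart_dom (cs i)) = points S"
proof -
  have "compactin (surf_top S) (points S)" using assms by (simp add: compact_space_def)
  moreover have "\<forall>U\<in>chart_dom ` surf_atlas S. openin (surf_top S) U" using openin_chart_dom by auto
  ultimately obtain \<F> where F: "finite \<F>" "\<F> \<subseteq> chart_dom ` surf_atlas S" "points S \<subseteq> \<Union>\<F>"
    using Union_chart_dom unfolding compactin_def by (metis order_refl)
  then obtain C where C: "finite C" "C \<subseteq> surf_atlas S" "\<F> = chart_dom ` C"
    by (meson finite_subset_image)
  then obtain cs :: "nat \<Rightarrow> 'a chart" and m where cs: "C = cs ` {i. i < m}"
    using finite_imp_nat_seg_image_inj_on by metis
  show ?thesis
  proof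
    show "\<And>i. i < m \<Longrightarrow> cs i \<in> surf_atlas S" using C cs by auto
    show "(\<Union>i<m. chart_dom (cs i)) = points S"
    proof (intro equalityI)
      show "(\<Union>i<m. chart_dom (cs i)) \<subseteq> points S"
        using C(2) cs chart_dom_subset by blast
      show "points S \<subseteq> (\<Union>i<m. chart_dom (cs i))" using F(3) C(3) cs by auto
    qed
  qed
qed

lemma disjointed_chart_dom_borel:
  assumes "\<And>i. i < m \<Longrightarrow> cs i \<in> surf_atlas S"
  shows "disjointed (\<lambda>i. if i < m then chart_dom (cs i) else {}) i \<in> sets (surface_borel S)"
proof -
  have "(if i < m then chart_dom (cs i) else {}) \<in> sets (surface_borel S)" for i
    using assms openin_chart_dom sets_surface_borelI by auto
  then show ?thesis by (intro subsetD[OF sets.range_disjointed_sets rangeI] image_subsetI)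
qed

text \<open>The disjoint pieces of a finite chart cover split a Borel set into sets lying in single
  charts, and these are the sets whose measure \<open>is_volume\<close> prescribes.\<close>

lemma emeasure_disjoint_chart_cover:
  assumes cover: "\<And>i. i < m \<Longrightarrow> cs i \<in> surf_atlas S" "(\<Union>i<m. chart_dom (cs i)) = points S"
    and \<mu>: "sets \<mu> = sets (surface_borel S)" and B: "B \<in> sets (surface_borel S)"
  shows "emeasure \<mu> B
    = (\<Sum>i<m. emeasure \<mu> (B \<inter> disjointed (\<lambda>i. if i < m then chart_dom (cs i) else {}) i))"
proof -
  let ?D = "\<lambda>i. if i < m then chart_dom (cs i) else {}"
  note dD = disjointed_chart_dom_borel[OF cover(1)]
  have B': "B \<subseteq> points S" using sets.sets_into_space[OF B] by simp
  have "(\<Union>i<m. disjointed ?D i) = points S"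
  proof -
    have "(\<Union>i<m. disjointed ?D i) = (\<Union>i<m. ?D i)"
      using finite_UN_disjointed_eq[of ?D m] by (simp only: atLeast0LessThan)
    also have "\<dots> = points S" using cover(2) by auto
    finally show ?thesis .
  qed
  then have "B = (\<Union>i<m. B \<inter> disjointed ?D i)" using B' by blast
  then have "emeasure \<mu> B = emeasure \<mu> (\<Union>i<m. B \<inter> disjointed ?D i)" by simp
  also have "\<dots> = (\<Sum>i<m. emeasure \<mu> (B \<inter> disjointed ?D i))"
  proof (rule sum_emeasure[symmetric])
    show "disjoint_family_on (\<lambda>i. B \<inter> disjointed ?D i) {..<m}"
      using disjoint_family_disjointed[of ?D] unfolding disjoint_family_on_def by blast
    show "(\<lambda>i. B \<inter> disjointed ?D i) ` {..<m} \<subseteq> sets \<mu>"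
      unfolding \<mu> by (intro image_subsetI sets.Int B dD)
  qed simp
  finally show ?thesis .
qed

lemma is_volume_unique:
  assumes K: "compact_space (surf_top S)" and v: "is_volume S g \<mu>" "is_volume S g \<nu>"
  shows "\<mu> = \<nu>"
proof (rule measure_eqI)
  show "sets \<mu> = sets \<nu>" using v by (simp add: is_volume_sets)
  fix B assume "B \<in> sets \<mu>"
  then have B: "B \<in> sets (surface_borel S)" using v is_volume_sets by blast
  obtain cs :: "nat \<Rightarrow> 'a chart" and m where
    cover: "\<And>i. i < m \<Longrightarrow> cs i \<in> surf_atlas S" "(\<Union>i<m. chart_dom (cs i)) = points S"
    using finite_chart_cover[OF K] by metis
  let ?D = "\<lambda>i. if i < m then chart_dom (cs i) else {}"
  note dD = disjointed_chart_dom_borel[OF cover(1)]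
  have "emeasure \<mu> (B \<inter> disjointed ?D i) = emeasure \<nu> (B \<inter> disjointed ?D i)" if "i < m" for i
  proof -
    have "B \<inter> disjointed ?D i \<in> sets (surface_borel S)" using B dD by auto
    moreover have "B \<inter> disjointed ?D i \<subseteq> chart_dom (cs i)"
      using disjointed_subset[of ?D i] that by auto
    ultimately show ?thesis
      using is_volume_emeasure[OF v(1) cover(1)[OF that]] is_volume_emeasure[OF v(2) cover(1)[OF that]]
      by simp
  qed
  then show "emeasure \<mu> B = emeasure \<nu> B"
    using emeasure_disjoint_chart_cover[OF cover is_volume_sets[OF v(1)] B]
      emeasure_disjoint_chart_cover[OF cover is_volume_sets[OF v(2)] B] by simp
qed

text \<open>The measure is a sum of chart densities carried to the surface, each restricted to its
  own piece of a disjoint chart cover. Chart independence makes the result correct in every chart of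
  the atlas and not only in those of the cover.\<close>

lemma is_volume_exists:
  assumes K: "compact_space (surf_top S)" and g: "continuous_metric S g"
  shows "\<exists>\<mu>. is_volume S g \<mu>"
proof -
  obtain cs :: "nat \<Rightarrow> 'a chart" and m where
    cover: "\<And>i. i < m \<Longrightarrow> cs i \<in> surf_atlas S" "(\<Union>i<m. chart_dom (cs i)) = points S"
    using finite_chart_cover[OF K] by metis
  let ?D = "\<lambda>i. if i < m then chart_dom (cs i) else {}"
  define A where "A = disjointed ?D"
  have A: "A i \<in> sets (surface_borel S)" for i
    unfolding A_def by (rule disjointed_chart_dom_borel[OF cover(1)])
  have AD: "A i \<subseteq> chart_dom (cs i)" if "i < m" for i
    using disjointed_subset[of ?D i] that by (auto simp: A_def)
  define \<nu> where "\<nu> i = distr (density lborel (\<lambda>z. chart_density g (cs i) z * indicator (coord (cs i) ` A i) z))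
      (surface_borel S) (total_chart_inv (cs i))" for i
  have \<nu>: "emeasure (\<nu> i) B
      = (\<integral>\<^sup>+ z. chart_density g (cs i) z * indicator (coord (cs i) ` (B \<inter> A i)) z \<partial>lborel)"
    if i: "i < m" and B: "B \<in> sets (surface_borel S)" for i B
  proof -
    note c = cover(1)[OF i]
    note [measurable] = total_chart_inv_measurable[OF c] chart_density_measurable[OF g c]
      coord_image_borel[OF c A AD[OF i]]
    have *: "total_chart_inv (cs i) -` B \<in> sets borel"
      using measurable_sets[OF total_chart_inv_measurable[OF c] B] by simp
    have "emeasure (\<nu> i) B = (\<integral>\<^sup>+ z. (chart_density g (cs i) z * indicator (coord (cs i) ` A i) z)
        * indicator (total_chart_inv (cs i) -` B) z \<partial>lborel)"
      unfolding \<nu>_def using B * by (subst emeasure_distr) (auto simp: emeasure_density)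
    also have "\<dots> = (\<integral>\<^sup>+ z. chart_density g (cs i) z * indicator (coord (cs i) ` (B \<inter> A i)) z \<partial>lborel)"
    proof (rule nn_integral_cong)
      fix z
      have s: "B \<inter> A i \<subseteq> chart_dom (cs i)" using AD[OF i] by auto
      have "z \<in> coord (cs i) ` (B \<inter> A i) \<longleftrightarrow> z \<in> coord (cs i) ` A i \<and> z \<in> total_chart_inv (cs i) -` B"
        unfolding coord_image_eq[OF c AD[OF i]] coord_image_eq[OF c s]
        by (auto simp: total_chart_inv_def)
      then show "(chart_density g (cs i) z * indicator (coord (cs i) ` A i) z)
        * indicator (total_chart_inv (cs i) -` B) z
        = chart_density g (cs i) z * indicator (coord (cs i) ` (B \<inter> A i)) z"
        by (auto simp: indicator_def)
    qed
    finally show ?thesis .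
  qed
  define \<mu> where "\<mu> = measure_of (points S) {U. openin (surf_top S) U} (\<lambda>B. \<Sum>i<m. emeasure (\<nu> i) B)"
  have sub: "{U. openin (surf_top S) U} \<subseteq> Pow (points S)" by (auto dest: openin_subset)
  have sets: "sets \<mu> = sets (surface_borel S)"
    unfolding \<mu>_def sets_surface_borel by (rule sets_measure_of[OF sub])
  have em: "emeasure \<mu> B = (\<Sum>i<m. emeasure (\<nu> i) B)" if "B \<in> sets (surface_borel S)" for B
  proof (rule emeasure_measure_of[OF \<mu>_def sub])
    show "B \<in> sets \<mu>" using that sets by simp
    show "positive (sets \<mu>) (\<lambda>B. \<Sum>i<m. emeasure (\<nu> i) B)" by (simp add: positive_def)
    show "countably_additive (sets \<mu>) (\<lambda>B. \<Sum>i<m. emeasure (\<nu> i) B)"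
    proof (rule countably_additiveI)
      fix F :: "nat \<Rightarrow> 'a set" assume F: "range F \<subseteq> sets \<mu>" "disjoint_family F"
      have "suminf (\<lambda>n. \<Sum>i<m. emeasure (\<nu> i) (F n)) = (\<Sum>i<m. suminf (\<lambda>n. emeasure (\<nu> i) (F n)))"
        by (rule suminf_sum) auto
      also have "\<dots> = (\<Sum>i<m. emeasure (\<nu> i) (\<Union>(range F)))"
      proof (rule sum.cong[OF refl])
        fix i
        have "sets (\<nu> i) = sets \<mu>" by (simp add: \<nu>_def sets)
        then show "suminf (\<lambda>n. emeasure (\<nu> i) (F n)) = emeasure (\<nu> i) (\<Union>(range F))"
          using F by (intro suminf_emeasure) auto
      qed
      finally show "suminf (\<lambda>n. \<Sum>i<m. emeasure (\<nu> i) (F n)) = (\<Sum>i<m. emeasure (\<nu> i) (\<Union>(range F)))" .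
    qed
  qed
  have "is_volume S g \<mu>" unfolding is_volume_def
  proof (intro conjI ballI impI)
    show "space \<mu> = points S" unfolding \<mu>_def by (rule space_measure_of[OF sub])
    show "sets \<mu> = sigma_sets (points S) {U. openin (surf_top S) U}"
      using sets sets_surface_borel by metis
    fix c B assume c: "c \<in> surf_atlas S" and "B \<in> sets \<mu>" and Bc: "B \<subseteq> chart_dom c"
    then have B: "B \<in> sets (surface_borel S)" using sets by simp
    \<comment> \<open>\<open>\<kappa>\<close> is the full density of the given chart
      \<open>c\<close> carried to the surface. By \<open>chart_volume_independent\<close> it
      measures the part of \<open>B\<close> in each piece of the cover as \<open>\<nu> i\<close>
      does; summing over the pieces recovers \<open>\<kappa>\<close> on \<open>B\<close>.\<close>
    define \<kappa> where "\<kappa> = distr (density lborel (chart_density g c)) (surface_borel S) (total_chart_inv c)"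
    have \<kappa>: "emeasure \<kappa> X = (\<integral>\<^sup>+ z. chart_density g c z * indicator (coord c ` X) z \<partial>lborel)"
      if X: "X \<in> sets (surface_borel S)" "X \<subseteq> chart_dom c" for X
    proof -
      note [measurable] = total_chart_inv_measurable[OF c] chart_density_measurable[OF g c]
      have *: "total_chart_inv c -` X \<in> sets borel"
        using measurable_sets[OF total_chart_inv_measurable[OF c] X(1)] by simp
      have "emeasure \<kappa> X = (\<integral>\<^sup>+ z. chart_density g c z * indicator (total_chart_inv c -` X) z \<partial>lborel)"
        unfolding \<kappa>_def using X * by (subst emeasure_distr) (auto simp: emeasure_density)
      also have "\<dots> = (\<integral>\<^sup>+ z. chart_density g c z * indicator (coord c ` X) z \<partial>lborel)"
        unfolding coord_image_eq[OF c X(2)]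
        by (rule nn_integral_cong) (auto simp: indicator_def total_chart_inv_def chart_density_def)
      finally show ?thesis .
    qed
    have "emeasure \<mu> B = (\<Sum>i<m. emeasure \<kappa> (B \<inter> A i))"
      unfolding em[OF B]
    proof (rule sum.cong[OF refl])
      fix i assume "i \<in> {..<m}" then have i: "i < m" by simp
      have BA: "B \<inter> A i \<in> sets (surface_borel S)" using A B by auto
      show "emeasure (\<nu> i) B = emeasure \<kappa> (B \<inter> A i)"
      proof -
        have "B \<inter> A i \<subseteq> chart_dom c" "B \<inter> A i \<subseteq> chart_dom c \<inter> chart_dom (cs i)"
          using AD[OF i] Bc by blast+
        then show ?thesis
          using \<nu>[OF i B] \<kappa>[OF BA] chart_volume_independent[OF g c cover(1)[OF i] BA] by simp
      qed
    qed
    also have "\<dots> = emeasure \<kappa> B"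
      unfolding A_def using emeasure_disjoint_chart_cover[OF cover _ B, of \<kappa>] by (simp add: \<kappa>_def)
    finally show "emeasure \<mu> B = (\<integral>\<^sup>+ z. ennreal (sqrt (gram_det (g c z))) * indicator (coord c ` B) z \<partial>lborel)"
      unfolding chart_density_indicator[OF Bc] using \<kappa>[OF B Bc] by simp
  qed
  then show ?thesis ..
qed

lemma is_volume_volume_measure:
  assumes "compact_space (surf_top S)" "continuous_metric S g"
  shows "is_volume S g (volume_measure S g)"
proof -
  have "\<exists>!\<mu>. is_volume S g \<mu>"
    using is_volume_exists[OF assms] is_volume_unique[OF assms(1)] by blast
  then have "is_volume S g (THE \<mu>. is_volume S g \<mu>)" by (rule theI')
  then show ?thesis unfolding volume_measure_def is_volume_def .
qed

text \<open>The volume restricted to a chart domain is the push-forward of the chart density. This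
  is the passage between integrals on the surface and integrals in the plane.\<close>

lemma is_volume_nn_integral_chart:
  assumes v: "is_volume S g \<mu>" and g: "continuous_metric S g" and c: "c \<in> surf_atlas S"
    and f: "f \<in> borel_measurable (surface_borel S)"
  shows "(\<integral>\<^sup>+p. f p * indicator (chart_dom c) p \<partial>\<mu>)
    = (\<integral>\<^sup>+z. f (chart_inv c z) * chart_density g c z \<partial>lborel)"
proof -
  note [measurable] = total_chart_inv_measurable[OF c] chart_density_measurable[OF g c]
  have sets[measurable_cong]: "sets \<mu> = sets (surface_borel S)" by (rule is_volume_sets[OF v])
  have [measurable]: "chart_dom c \<in> sets (surface_borel S)"
    using openin_chart_dom[OF c] by (rule sets_surface_borelI)
  have eq: "density \<mu> (indicator (chart_dom c))
      = distr (density lborel (chart_density g c)) (surface_borel S) (total_chart_inv c)" (is "?L = ?R")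
  proof (rule measure_eqI)
    show "sets ?L = sets ?R" using sets by simp
    fix X assume "X \<in> sets ?L"
    then have X: "X \<in> sets (surface_borel S)" using sets by simp
    have *: "total_chart_inv c -` X \<in> sets borel"
      using measurable_sets[OF total_chart_inv_measurable[OF c] X(1)] by simp
    have "emeasure ?L X = emeasure \<mu> (chart_dom c \<inter> X)"
      using X sets by (subst emeasure_density)
        (auto simp: indicator_inter_arith[symmetric] simp del: indicator_inter_arith)
    also have "\<dots> = (\<integral>\<^sup>+ z. chart_density g c z * indicator (coord c ` (chart_dom c \<inter> X)) z \<partial>lborel)"
      using X by (intro is_volume_emeasure[OF v c]) auto
    also have "\<dots> = (\<integral>\<^sup>+ z. chart_density g c z * indicator (total_chart_inv c -` X) z \<partial>lborel)"
      by (subst coord_image_eq[OF c])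
        (auto intro!: nn_integral_cong simp: indicator_def total_chart_inv_def chart_density_def)
    also have "\<dots> = emeasure ?R X"
      using X * by (subst emeasure_distr) (auto simp: emeasure_density)
    finally show "emeasure ?L X = emeasure ?R X" .
  qed
  have "(\<integral>\<^sup>+p. f p * indicator (chart_dom c) p \<partial>\<mu>) = (\<integral>\<^sup>+p. f p \<partial>?L)"
    using f sets by (subst nn_integral_density) (auto simp: mult.commute cong: measurable_cong_sets)
  also have "\<dots> = (\<integral>\<^sup>+z. f (total_chart_inv c z) \<partial>density lborel (chart_density g c))"
    unfolding eq using f by (subst nn_integral_distr) auto
  also have "\<dots> = (\<integral>\<^sup>+z. chart_density g c z * f (total_chart_inv c z) \<partial>lborel)"
    using f by (subst nn_integral_density) auto
  also have "\<dots> = (\<integral>\<^sup>+z. f (chart_inv c z) * chart_density g c z \<partial>lborel)"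
    by (intro nn_integral_cong) (auto simp: total_chart_inv_def chart_density_def indicator_def mult.commute)
  finally show ?thesis .
qed

end

section \<open>Tensor norms and holomorphic maps in charts\<close>

text \<open>The directional derivative along \<open>v\<close> is \<open>deriv f x * v\<close>, again
  holomorphic, so the induction runs over all holomorphic \<open>f\<close> at once.\<close>

lemma holomorphic_imp_smooth_on:
  assumes "open S" "f holomorphic_on S"
  shows "smooth_on S f"
proof -
  have "higher_differentiable_on S f n" if "f holomorphic_on S" for f n
    using that
  proof (induction n arbitrary: f)
    case 0
    then show ?case by (simp add: holomorphic_on_imp_continuous_on)
  next
    case (Suc n)
    have fd: "f field_differentiable (at x)" if "x \<in> S" for x
      using Suc.prems assms(1) that by (rule holomorphic_on_imp_differentiable_at)
    have "(\<lambda>x. frechet_derivative f (at x) v) holomorphic_on S" for v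
    proof (rule holomorphic_transform)
      show "(\<lambda>x. deriv f x * v) holomorphic_on S"
        using Suc.prems assms(1) by (intro holomorphic_intros holomorphic_deriv)
    qed (simp add: frechet_derivative_eq_deriv_mult[OF fd])
    then show ?case
      using Suc.IH fd by (auto intro: field_differentiable_imp_differentiable)
  qed
  then show ?thesis using assms(2) by (simp add: smooth_on_def)
qed

section \<open>Norms of bilinear forms on the plane\<close>

definition orthonormal_pair :: "(complex \<Rightarrow> complex \<Rightarrow> real) \<Rightarrow> (nat \<Rightarrow> complex) \<Rightarrow> bool" where
  "orthonormal_pair g e \<longleftrightarrow> (\<forall>i<2. \<forall>j<2. g (e i) (e j) = (if i = j then 1 else 0))"

lemma sum_lessThan_2: "(\<Sum>i<2. f i) = f 0 + (f (Suc 0) :: 'a :: comm_monoid_add)"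
  by (simp add: numeral_2_eq_2)

lemma orthonormal_pair_exists:
  assumes g: "inner_product g"
  shows "\<exists>e. orthonormal_pair g e"
proof -
  define a b c D where "a = g 1 1" and "b = g 1 \<i>" and "c = g \<i> \<i>" and "D = gram_det g"
  have bl: "bilinear g" and sym: "g \<i> 1 = b" and a: "0 < a"
    using g by (auto simp: inner_product_def a_def b_def)
  have D: "0 < D" "D = a * c - b * b"
    using gram_det_pos[OF g] sym by (auto simp: D_def gram_det_def a_def b_def c_def)
  \<comment> \<open>Gram-Schmidt applied to 1 and \<open>\<i>\<close>: the combination with
    coordinates - b and a is orthogonal to 1 and has square length \<open>a * D\<close>.\<close>
  define e :: "nat \<Rightarrow> complex" where
    "e i = (if i = 0 then Complex (1 / sqrt a) 0 else Complex (- b / sqrt (a * D)) (a / sqrt (a * D)))" for i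
  have ex: "g u v = Re u * Re v * a + Re u * Im v * b + Im u * Re v * b + Im u * Im v * c" for u v
    using bilinear_complex_expand[OF bl, of u v] sym by (simp add: a_def b_def c_def)
  have sq: "sqrt a * sqrt a = a" "sqrt (a * D) * sqrt (a * D) = a * D"
    using a D by auto
  have "g (e 0) (e 0) = 1" using a sq by (simp add: ex e_def field_simps)
  moreover have "g (e 0) (e (Suc 0)) = 0" "g (e (Suc 0)) (e 0) = 0" using a D by (simp_all add: ex e_def field_simps)
  moreover have "g (e (Suc 0)) (e (Suc 0)) = 1"
  proof -
    have "g (e (Suc 0)) (e (Suc 0)) = (b * b * a - b * a * b - a * b * b + a * a * c) / (sqrt (a * D) * sqrt (a * D))"
      by (simp add: ex e_def add_divide_distrib diff_divide_distrib)
    also have "\<dots> = a * D / (a * D)" unfolding sq by (simp add: D algebra_simps)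
    finally show ?thesis using a D by simp
  qed
  ultimately have "orthonormal_pair g e" by (auto simp: orthonormal_pair_def less_2_cases_iff)
  then show ?thesis by (rule exI[where x = e])
qed

text \<open>The pair chosen by \<open>tensor_norm_sq\<close> depends on \<open>g\<close> only, so a
  single orthonormal pair evaluates the norm of all \<open>b\<close> simultaneously.\<close>

lemma tensor_norm_sq_orthonormal:
  assumes g: "inner_product g"
  obtains e where "orthonormal_pair g e" "\<And>b. tensor_norm_sq g b = (\<Sum>i<2. \<Sum>j<2. (b (e i) (e j))\<^sup>2)"
proof -
  let ?e = "SOME e. orthonormal_pair g e"
  have "orthonormal_pair g ?e" using orthonormal_pair_exists[OF g] by (rule someI_ex)
  moreover have "tensor_norm_sq g b = (\<Sum>i<2. \<Sum>j<2. (b (?e i) (?e j))\<^sup>2)" for b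
    unfolding tensor_norm_sq_def orthonormal_pair_def Let_def ..
  ultimately show ?thesis using that by blast
qed

lemma tensor_norm_sq_nonneg: "0 \<le> tensor_norm_sq g b"
  by (simp add: tensor_norm_sq_def Let_def sum_nonneg)

lemma tensor_norm_sq_scaled:
  assumes "inner_product g"
  shows "tensor_norm_sq g (\<lambda>u v. t * g u v) = 2 * t\<^sup>2"
proof -
  obtain e where "orthonormal_pair g e" "\<And>b. tensor_norm_sq g b = (\<Sum>i<2. \<Sum>j<2. (b (e i) (e j))\<^sup>2)"
    using tensor_norm_sq_orthonormal[OF assms] by blast
  then show ?thesis by (simp add: sum_lessThan_2 orthonormal_pair_def)
qed

text \<open>Componentwise x^2 \<le> 2 (x - y)^2 + 2 y^2; a metric has square norm 2 with respect to
  itself, whence the 4.\<close>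

lemma tensor_norm_sq_le:
  assumes "inner_product g"
  shows "tensor_norm_sq g b \<le> 2 * tensor_norm_sq g (\<lambda>u v. b u v - g u v) + 4"
proof -
  obtain e where e: "orthonormal_pair g e" "\<And>b. tensor_norm_sq g b = (\<Sum>i<2. \<Sum>j<2. (b (e i) (e j))\<^sup>2)"
    using tensor_norm_sq_orthonormal[OF assms] by blast
  have "(x :: real)\<^sup>2 \<le> 2 * (x - y)\<^sup>2 + 2 * y\<^sup>2" for x y
  proof -
    have "2 * (x - y)\<^sup>2 + 2 * y\<^sup>2 - x\<^sup>2 = (x - 2 * y)\<^sup>2" by (simp add: power2_eq_square algebra_simps)
    then show ?thesis by (smt (verit) zero_le_power2)
  qed
  then have "(\<Sum>i<2. \<Sum>j<2. (b (e i) (e j))\<^sup>2)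
      \<le> (\<Sum>i<2. \<Sum>j<2. 2 * (b (e i) (e j) - g (e i) (e j))\<^sup>2 + 2 * (g (e i) (e j))\<^sup>2)"
    by (intro sum_mono)
  also have "\<dots> = 2 * (\<Sum>i<2. \<Sum>j<2. (b (e i) (e j) - g (e i) (e j))\<^sup>2)
      + 2 * (\<Sum>i<2. \<Sum>j<2. (g (e i) (e j))\<^sup>2)"
    by (simp add: sum.distrib sum_distrib_left)
  also have "(\<Sum>i<2. \<Sum>j<2. (g (e i) (e j))\<^sup>2) = 2"
    using e(1) by (simp add: orthonormal_pair_def sum_lessThan_2)
  finally show ?thesis by (simp add: e(2))
qed

text \<open>Cramer's rule. The squared determinant of the pair times the Gram determinant of
  \<open>g\<close> is the Gram determinant of the pair, which is 1, so the determinant does not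
  vanish.\<close>

lemma orthonormal_pair_spans:
  assumes g: "inner_product g" and e: "orthonormal_pair g e"
  obtains \<alpha> \<beta> where "u = \<alpha> *\<^sub>R e 0 + \<beta> *\<^sub>R e (Suc 0)"
proof -
  have bl: "bilinear g" and sym: "g \<i> 1 = g 1 \<i>"
    using g by (auto simp: inner_product_def)
  have on: "g (e 0) (e 0) = 1" "g (e (Suc 0)) (e (Suc 0)) = 1" "g (e 0) (e (Suc 0)) = 0"
    using e by (auto simp: orthonormal_pair_def)
  define \<delta> where "\<delta> = Re (e 0) * Im (e (Suc 0)) - Im (e 0) * Re (e (Suc 0))"
  have "\<delta>\<^sup>2 * gram_det g = g (e 0) (e 0) * g (e (Suc 0)) (e (Suc 0)) - (g (e 0) (e (Suc 0)))\<^sup>2"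
    by (subst (1 2 3) bilinear_complex_expand[OF bl])
      (simp add: \<delta>_def gram_det_def sym power2_eq_square algebra_simps)
  then have \<delta>: "\<delta> \<noteq> 0" using on by auto
  show ?thesis
  proof (rule that)
    show "u = ((Re u * Im (e (Suc 0)) - Im u * Re (e (Suc 0))) / \<delta>) *\<^sub>R e 0
      + ((Re (e 0) * Im u - Im (e 0) * Re u) / \<delta>) *\<^sub>R e (Suc 0)"
      using \<delta> by (simp add: complex_eq_iff field_simps) (simp add: \<delta>_def algebra_simps)
  qed
qed

text \<open>Cauchy-Schwarz for the pairing of \<open>b\<close> with the tensor square of
  \<open>u\<close>, whose norm is \<open>g u u\<close>.\<close>

lemma bilinear_sq_le_tensor_norm_sq:
  assumes g: "inner_product g" and b: "bilinear b"
  shows "(b u u)\<^sup>2 \<le> tensor_norm_sq g b * (g u u)\<^sup>2"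
proof -
  obtain e where e: "orthonormal_pair g e" "\<And>b. tensor_norm_sq g b = (\<Sum>i<2. \<Sum>j<2. (b (e i) (e j))\<^sup>2)"
    using tensor_norm_sq_orthonormal[OF g] by blast
  obtain \<alpha> \<beta> where u: "u = \<alpha> *\<^sub>R e 0 + \<beta> *\<^sub>R e (Suc 0)"
    using orthonormal_pair_spans[OF g e(1)] by blast
  define x where "x i = (if i = 0 then \<alpha> else \<beta>)" for i :: nat
  have expand: "f u u = (\<Sum>i<2. \<Sum>j<2. x i * x j * f (e i) (e j))" if "bilinear f" for f
    using that by (simp add: u sum_lessThan_2 x_def bilinear_ladd bilinear_radd bilinear_lmul bilinear_rmul algebra_simps)
  have gu: "g u u = (\<Sum>i<2. (x i)\<^sup>2)"
    using expand[of g] g e(1) by (simp add: inner_product_def orthonormal_pair_def sum_lessThan_2 power2_eq_square)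
  have "(b u u)\<^sup>2 = (\<Sum>(i,j)\<in>{..<2}\<times>{..<2}. b (e i) (e j) * (x i * x j))\<^sup>2"
    by (simp add: expand[OF b] sum.cartesian_product mult.commute)
  also have "\<dots> \<le> (\<Sum>p\<in>{..<2}\<times>{..<2}. (b (e (fst p)) (e (snd p)))\<^sup>2) * (\<Sum>p\<in>{..<2}\<times>{..<2}. (x (fst p) * x (snd p))\<^sup>2)"
    using Cauchy_Schwarz_ineq_sum[of "\<lambda>p. b (e (fst p)) (e (snd p))" "\<lambda>p. x (fst p) * x (snd p)"]
    by (simp add: case_prod_beta)
  also have "(\<Sum>p\<in>{..<2}\<times>{..<2}. (b (e (fst p)) (e (snd p)))\<^sup>2) = tensor_norm_sq g b"
    by (simp add: e(2) sum.cartesian_product case_prod_beta)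
  also have "(\<Sum>p\<in>{..<2}\<times>{..<2}. (x (fst p) * x (snd p))\<^sup>2) = (\<Sum>i<2. \<Sum>j<2. (x i)\<^sup>2 * (x j)\<^sup>2)"
    by (simp add: sum.cartesian_product case_prod_beta power_mult_distrib)
  also have "\<dots> = (g u u)\<^sup>2"
    by (simp add: gu power2_eq_square[of "sum _ _"] sum_product)
  finally show ?thesis .
qed

lemma tendsto_tensor_norm_sq:
  assumes "\<And>u v. ((\<lambda>n. b n u v) \<longlongrightarrow> l u v) F"
  shows "((\<lambda>n. tensor_norm_sq g (b n)) \<longlongrightarrow> tensor_norm_sq g l) F"
  unfolding tensor_norm_sq_def Let_def by (intro tendsto_intros assms)

lemma continuous_metric_transition:
  assumes "continuous_metric S g" "c \<in> surf_atlas S" "d \<in> surf_atlas S" "p \<in> chart_dom c \<inter> chart_dom d"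
  shows "g c (coord c p) u v =
    g d (coord d p) (deriv (coord d \<circ> chart_inv c) (coord c p) * u)
      (deriv (coord d \<circ> chart_inv c) (coord c p) * v)"
  using assms unfolding continuous_metric_def by blast

lemma continuous_metric_inner_product:
  "continuous_metric S g \<Longrightarrow> c \<in> surf_atlas S \<Longrightarrow> z \<in> chart_im c \<Longrightarrow> inner_product (g c z)"
  unfolding continuous_metric_def by blast

section \<open>Maps between surfaces: local representatives, pullbacks, energy density\<close>

locale surface_pair = M: surface_charts M + N: surface_charts N
  for M :: "'a surface" and N :: "'b surface"
begin

text \<open>The set on which \<open>smooth_map\<close> and \<open>holomorphic_map\<close> test
  \<open>local_rep c d h\<close>.\<close>

definition rep_dom :: "('a \<Rightarrow> 'b) \<Rightarrow> 'a chart \<Rightarrow> 'b chart \<Rightarrow> complex set" where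
  "rep_dom h c d = coord c ` (chart_dom c \<inter> h -` chart_dom d)"

lemma openin_vimage_chart_dom:
  assumes h: "continuous_map (surf_top M) (surf_top N) h"
    and c: "c \<in> surf_atlas M" and V: "openin (surf_top N) V"
  shows "openin (surf_top M) (chart_dom c \<inter> h -` V)"
proof -
  have "openin (surf_top M) {p \<in> points M. h p \<in> V}"
    using h V by (rule openin_continuous_map_preimage)
  then have "openin (surf_top M) (chart_dom c \<inter> {p \<in> points M. h p \<in> V})"
    using M.openin_chart_dom[OF c] by blast
  moreover have "chart_dom c \<inter> {p \<in> points M. h p \<in> V} = chart_dom c \<inter> h -` V"
    using M.chart_dom_subset[OF c] by auto
  ultimately show ?thesis by simp
qed

lemma open_rep_dom:
  assumes "continuous_map (surf_top M) (surf_top N) h" "c \<in> surf_atlas M" "d \<in> surf_atlas N"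
  shows "open (rep_dom h c d)"
  using M.open_coord_image[OF assms(2) openin_vimage_chart_dom[OF assms(1,2) N.openin_chart_dom[OF assms(3)]]]
  by (simp add: rep_dom_def inf_assoc[symmetric])

lemma local_rep_coord [simp]:
  "c \<in> surf_atlas M \<Longrightarrow> p \<in> chart_dom c \<Longrightarrow> local_rep c d h (coord c p) = coord d (h p)"
  by (simp add: local_rep_def)

lemma coord_in_rep_dom: "p \<in> chart_dom c \<Longrightarrow> h p \<in> chart_dom d \<Longrightarrow> coord c p \<in> rep_dom h c d"
  by (auto simp: rep_dom_def)

lemma rep_domE:
  assumes "z \<in> rep_dom h c d"
  obtains p where "p \<in> chart_dom c" "h p \<in> chart_dom d" "z = coord c p"
  using assms by (auto simp: rep_dom_def)

lemma holomorphic_local_rep: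
  "holomorphic_map M N h \<Longrightarrow> c \<in> surf_atlas M \<Longrightarrow> d \<in> surf_atlas N \<Longrightarrow>
    local_rep c d h holomorphic_on rep_dom h c d"
  by (simp add: holomorphic_map_def rep_dom_def)

lemma holomorphic_imp_smooth_map:
  assumes h: "holomorphic_map M N h"
  shows "smooth_map M N h"
proof -
  have "continuous_map (surf_top M) (surf_top N) h" using h by (simp add: holomorphic_map_def)
  then show ?thesis
    using holomorphic_imp_smooth_on[OF open_rep_dom holomorphic_local_rep[OF h]]
    by (auto simp: smooth_map_def rep_dom_def)
qed

lemma inj_on_local_rep:
  assumes h: "inj_on h (points M)" and cd: "c \<in> surf_atlas M" "d \<in> surf_atlas N"
  shows "inj_on (local_rep c d h) (rep_dom h c d)"
proof (rule inj_onI)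
  fix z w assume "z \<in> rep_dom h c d" "w \<in> rep_dom h c d" and eq: "local_rep c d h z = local_rep c d h w"
  then obtain p q where pq: "p \<in> chart_dom c" "h p \<in> chart_dom d" "z = coord c p"
    "q \<in> chart_dom c" "h q \<in> chart_dom d" "w = coord c q"
    by (metis rep_domE)
  then have "h p = h q" using eq cd inj_onD[OF N.inj_on_coord[OF cd(2)], of "h p" "h q"] by simp
  then have "p = q" using inj_onD[OF h, of p q] pq M.chart_dom_subset[OF cd(1)] by blast
  then show "z = w" using pq by simp
qed

text \<open>A continuous bijection from a compact space onto a Hausdorff space is a homeomorphism,
  and inverses of injective holomorphic functions are holomorphic. Membership in \<open>HD\<close>
  is thereby reduced to bijectivity and holomorphy.\<close>

lemma compact_holomorphic_bij_imp_HD: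
  assumes K: "compact_space (surf_top M)" and bij: "bij_betw h (points M) (points N)"
    and hol: "holomorphic_map M N h"
  shows "h \<in> HD M N"
proof -
  interpret NM: surface_pair N M by unfold_locales
  have cont: "continuous_map (surf_top M) (surf_top N) h" using hol by (simp add: holomorphic_map_def)
  have inj: "inj_on h (points M)" and surj: "h ` points M = points N"
    using bij by (auto simp: bij_betw_def)
  let ?k = "inv_into (points M) h"
  have "homeomorphic_map (surf_top M) (surf_top N) h"
    using continuous_imp_homeomorphic_map[OF cont K N.Hausdorff surj inj] .
  then obtain k where k: "homeomorphic_maps (surf_top M) (surf_top N) h k"
    using homeomorphic_map_maps by blast
  have kc: "continuous_map (surf_top N) (surf_top M) ?k"
  proof (rule continuous_map_eq)
    show "continuous_map (surf_top N) (surf_top M) k" using k by (simp add: homeomorphic_maps_def)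
    fix y assume y: "y \<in> points N"
    then have "k y \<in> points M" "h (k y) = y"
      using k by (auto simp: homeomorphic_maps_def continuous_map_def)
    then show "k y = ?k y" using inj by (metis inv_into_f_f)
  qed
  have kh: "?k (h p) = p" if "p \<in> points M" for p using inj that by simp
  have hk: "h (?k y) = y" "?k y \<in> points M" if "y \<in> points N" for y
    using that surj by (auto simp: f_inv_into_f inv_into_into)
  have "holomorphic_map N M ?k" unfolding holomorphic_map_def
  proof (intro conjI ballI kc)
    fix d c assume dc: "d \<in> surf_atlas N" "c \<in> surf_atlas M"
    let ?f = "local_rep c d h" and ?X = "rep_dom h c d"
    note inv = holomorphic_injective_inverse_continuous(2)[OF open_rep_dom[OF cont dc(2,1)]
        holomorphic_local_rep[OF hol dc(2,1)] inj_on_local_rep[OF inj dc(2,1)]]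
    have im: "?f ` ?X = NM.rep_dom ?k d c"
    proof (intro equalityI subsetI)
      fix w assume "w \<in> ?f ` ?X"
      then obtain p where p: "p \<in> chart_dom c" "h p \<in> chart_dom d" "w = coord d (h p)"
        using dc by (auto elim!: rep_domE)
      then have "?k (h p) = p" using kh M.chart_dom_subset[OF dc(2)] by blast
      then show "w \<in> NM.rep_dom ?k d c" using p NM.coord_in_rep_dom[of "h p" d ?k c] by simp
    next
      fix w assume "w \<in> NM.rep_dom ?k d c"
      then obtain y where y: "y \<in> chart_dom d" "?k y \<in> chart_dom c" "w = coord d y"
        by (rule NM.rep_domE)
      then have "h (?k y) = y" using hk N.chart_dom_subset[OF dc(1)] by blast
      then have "w = ?f (coord c (?k y))" "coord c (?k y) \<in> ?X"
        using y dc coord_in_rep_dom[of "?k y" c h d] by auto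
      then show "w \<in> ?f ` ?X" by blast
    qed
    have "local_rep d c ?k holomorphic_on ?f ` ?X"
    proof (rule holomorphic_transform[OF inv])
      fix w assume "w \<in> ?f ` ?X"
      then obtain p where p: "p \<in> chart_dom c" "h p \<in> chart_dom d" "w = ?f (coord c p)"
        using dc by (auto elim!: rep_domE)
      have "?k (h p) = p" using p kh M.chart_dom_subset[OF dc(2)] by blast
      then have "local_rep d c ?k w = coord c p"
        using p dc by simp
      moreover have "inv_into ?X ?f w = coord c p"
        unfolding p(3) using coord_in_rep_dom[of p c h d, OF p(1,2)] inj_on_local_rep[OF inj dc(2,1)]
        by (rule inv_into_f_f[rotated])
      ultimately show "inv_into ?X ?f w = local_rep d c ?k w" by simp
    qed
    then show "local_rep d c ?k holomorphic_on coord d ` (chart_dom d \<inter> ?k -` chart_dom c)"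
      unfolding im NM.rep_dom_def .
  qed
  then show ?thesis
    using bij hol holomorphic_imp_smooth_map[OF hol] NM.holomorphic_imp_smooth_map
    by (simp add: HD_def diffeomorphism_def)
qed

lemma HD_D:
  assumes "h \<in> HD M N"
  shows "holomorphic_map M N h" "continuous_map (surf_top M) (surf_top N) h"
    "inj_on h (points M)" "h ` points M = points N"
  using assms by (auto simp: HD_def holomorphic_map_def diffeomorphism_def bij_betw_def)

text \<open>\<open>pullback\<close> computes in the chart picked by \<open>chart_at\<close>; the
  chain rule for the transition map together with the transformation law of \<open>b\<close> allows
  any chart of the target around the image point.\<close>

lemma pullback_eq:
  assumes hol: "holomorphic_map M N h" and b: "continuous_metric N b"
    and cd: "c \<in> surf_atlas M" "d \<in> surf_atlas N" and p: "p \<in> chart_dom c" "h p \<in> chart_dom d"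
  shows "pullback M N h b c (coord c p) u v = b d (coord d (h p))
     (deriv (local_rep c d h) (coord c p) * u) (deriv (local_rep c d h) (coord c p) * v)"
proof -
  define d' where "d' = chart_at N (h p)"
  let ?z = "coord c p" and ?T = "coord d' \<circ> chart_inv d"
  have cont: "continuous_map (surf_top M) (surf_top N) h" using hol by (simp add: holomorphic_map_def)
  have hp: "h p \<in> points N" using p N.chart_dom_subset[OF cd(2)] by blast
  have d': "d' \<in> surf_atlas N" "h p \<in> chart_dom d'"
    using N.chart_at_atlas[OF hp] N.in_chart_dom_chart_at[OF hp] by (auto simp: d'_def)
  have fd: "local_rep c e h field_differentiable (at ?z)" if "e \<in> surf_atlas N" "h p \<in> chart_dom e" for e
    using holomorphic_on_imp_differentiable_at[OF holomorphic_local_rep[OF hol cd(1) that(1)]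
      open_rep_dom[OF cont cd(1) that(1)]] coord_in_rep_dom[of p c h e, OF p(1) that(2)] by blast
  have Td: "?T field_differentiable (at (local_rep c d h ?z))"
    using holomorphic_on_imp_differentiable_at[OF N.holomorphic_transition[OF cd(2) d'(1)]
        N.open_coord_overlap[OF cd(2) d'(1)]] p d' cd by auto
  have ev: "eventually (\<lambda>z. local_rep c d' h z = (?T \<circ> local_rep c d h) z) (nhds ?z)"
    using eventually_nhds_in_open[OF open_rep_dom[OF cont cd] coord_in_rep_dom[of p c h d, OF p]]
  proof eventually_elim
    case (elim z)
    then obtain q where "q \<in> chart_dom c" "h q \<in> chart_dom d" "z = coord c q" by (rule rep_domE)
    then show ?case using cd by simp
  qed
  have "deriv (local_rep c d' h) ?z = deriv (?T \<circ> local_rep c d h) ?z"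
    by (rule deriv_cong_ev[OF ev refl])
  also have "\<dots> = deriv ?T (coord d (h p)) * deriv (local_rep c d h) ?z"
    unfolding deriv_chain[OF fd[OF cd(2) p(2)] Td] local_rep_coord[OF cd(1) p(1)] ..
  finally have der: "deriv (local_rep c d' h) ?z = deriv ?T (coord d (h p)) * deriv (local_rep c d h) ?z" .
  have "pullback M N h b c ?z u v = b d' (coord d' (h p)) (deriv (local_rep c d' h) ?z * u) (deriv (local_rep c d' h) ?z * v)"
    using cd p by (simp add: pullback_def Let_def d'_def[symmetric] frechet_derivative_eq_deriv_mult[OF fd[OF d']])
  also have "\<dots> = b d (coord d (h p)) (deriv (local_rep c d h) ?z * u) (deriv (local_rep c d h) ?z * v)"
    unfolding der mult.assoc
    by (rule continuous_metric_transition[symmetric, OF b cd(2) d'(1)]) (use p(2) d'(2) in blast)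
  finally show ?thesis .
qed

text \<open>The counterpart for the source: the chain rule moves the derivative of the transition
  map onto the tangent vectors.\<close>

lemma pullback_change_chart:
  assumes hol: "holomorphic_map M N h" and b: "continuous_metric N b"
    and c: "c \<in> surf_atlas M" "c' \<in> surf_atlas M" and p: "p \<in> chart_dom c \<inter> chart_dom c'"
  defines "a \<equiv> deriv (coord c' \<circ> chart_inv c) (coord c p)"
  shows "pullback M N h b c (coord c p) u v = pullback M N h b c' (coord c' p) (a * u) (a * v)"
proof -
  define d where "d = chart_at N (h p)"
  let ?z = "coord c p" and ?S = "coord c' \<circ> chart_inv c"
  have cont: "continuous_map (surf_top M) (surf_top N) h" using hol by (simp add: holomorphic_map_def)
  have pM: "p \<in> points M" using p M.chart_dom_subset[OF c(1)] by blast
  then have hp: "h p \<in> points N" using cont by (auto simp: continuous_map_def)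
  have d: "d \<in> surf_atlas N" "h p \<in> chart_dom d"
    using N.chart_at_atlas[OF hp] N.in_chart_dom_chart_at[OF hp] by (auto simp: d_def)
  have fd: "local_rep e d h field_differentiable (at (coord e p))" if "e \<in> surf_atlas M" "p \<in> chart_dom e" for e
    using holomorphic_on_imp_differentiable_at[OF holomorphic_local_rep[OF hol that(1) d(1)]
      open_rep_dom[OF cont that(1) d(1)]] coord_in_rep_dom[of p e h d, OF that(2) d(2)] by blast
  have Sd: "?S field_differentiable (at ?z)"
    using holomorphic_on_imp_differentiable_at[OF M.holomorphic_transition[OF c]
        M.open_coord_overlap[OF c]] p by auto
  have ev: "eventually (\<lambda>z. local_rep c d h z = (local_rep c' d h \<circ> ?S) z) (nhds ?z)"
    using eventually_nhds_in_open[OF M.open_coord_overlap[OF c] imageI[OF p]]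
    by eventually_elim (use c in auto)
  have Sz: "?S ?z = coord c' p" using c p by simp
  have fS: "local_rep c' d h field_differentiable (at (?S ?z))"
    unfolding Sz using fd[OF c(2)] p by blast
  have "deriv (local_rep c d h) ?z = deriv (local_rep c' d h \<circ> ?S) ?z"
    by (rule deriv_cong_ev[OF ev refl])
  also have "\<dots> = deriv (local_rep c' d h) (coord c' p) * a"
    unfolding a_def deriv_chain[OF Sd fS] Sz ..
  finally have "deriv (local_rep c d h) ?z = deriv (local_rep c' d h) (coord c' p) * a" .
  then show ?thesis
    using pullback_eq[OF hol b c(1) d(1) _ d(2)] pullback_eq[OF hol b c(2) d(1) _ d(2)] p
    by (simp add: mult.assoc)
qed

lemma bilinear_pullback:
  assumes hol: "holomorphic_map M N h" and b: "continuous_metric N b"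
    and c: "c \<in> surf_atlas M" and p: "p \<in> chart_dom c"
  shows "bilinear (pullback M N h b c (coord c p))"
proof -
  define d where "d = chart_at N (h p)"
  have cont: "continuous_map (surf_top M) (surf_top N) h" using hol by (simp add: holomorphic_map_def)
  have pM: "p \<in> points M" using p M.chart_dom_subset[OF c] by blast
  then have hp: "h p \<in> points N" using cont by (auto simp: continuous_map_def)
  have d: "d \<in> surf_atlas N" "h p \<in> chart_dom d"
    using N.chart_at_atlas[OF hp] N.in_chart_dom_chart_at[OF hp] by (auto simp: d_def)
  let ?a = "deriv (local_rep c d h) (coord c p)"
  have "pullback M N h b c (coord c p) = (\<lambda>u v. b d (coord d (h p)) (?a * u) (?a * v))"
    using pullback_eq[OF hol b c d(1) p d(2)] by blast
  moreover have "bilinear (b d (coord d (h p)))"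
    using continuous_metric_inner_product[OF b d(1)] d(2) by (auto simp: inner_product_def chart_im_def)
  moreover have "linear (\<lambda>u. ?a * u)" by (simp add: bounded_linear.linear bounded_linear_mult_right)
  ultimately show ?thesis
    using linear_compose[of "(*) ?a" "b d (coord d (h p)) (?a * x)" for x]
      linear_compose[of "(*) ?a" "\<lambda>x. b d (coord d (h p)) x (?a * y)" for y]
    by (simp add: bilinear_def comp_def)
qed

definition energy_density :: "'a tensor_field \<Rightarrow> 'b tensor_field \<Rightarrow> ('a \<Rightarrow> 'b) \<Rightarrow> 'a \<Rightarrow> real" where
  "energy_density gM gN h p = (let c = chart_at M p; z = coord c p
      in tensor_norm_sq (gM c z) (\<lambda>u v. pullback M N h gN c z u v - gM c z u v))"

lemma deformation_energy_eq:
  "deformation_energy M gM N gN h = (\<integral>p. energy_density gM gN h p \<partial>volume_measure M gM)"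
  by (simp add: deformation_energy_def energy_density_def)

lemma energy_density_nonneg: "0 \<le> energy_density gM gN h p"
  by (simp add: energy_density_def Let_def tensor_norm_sq_nonneg)

lemma deformation_energy_nonneg: "0 \<le> deformation_energy M gM N gN h"
  by (simp add: deformation_energy_eq energy_density_nonneg)

text \<open>Both sides are invariant under a change of chart, so the estimate is made in the chart
  that \<open>energy_density\<close> uses. There it is \<open>bilinear_sq_le_tensor_norm_sq\<close>
  followed by \<open>tensor_norm_sq_le\<close>.\<close>

lemma pullback_sq_le_energy_density:
  assumes hol: "holomorphic_map M N h" and gM: "continuous_metric M gM" and gN: "continuous_metric N gN"
    and c: "c \<in> surf_atlas M" and p: "p \<in> chart_dom c"
  shows "(pullback M N h gN c (coord c p) u u)\<^sup>2
    \<le> (2 * energy_density gM gN h p + 4) * (gM c (coord c p) u u)\<^sup>2"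
proof -
  define c' where "c' = chart_at M p"
  have pM: "p \<in> points M" using p M.chart_dom_subset[OF c] by blast
  then have c': "c' \<in> surf_atlas M" "p \<in> chart_dom c'"
    using M.chart_at_atlas[OF pM] M.in_chart_dom_chart_at[OF pM] by (auto simp: c'_def)
  define a where "a = deriv (coord c' \<circ> chart_inv c) (coord c p)"
  let ?b = "pullback M N h gN c' (coord c' p)" and ?g = "gM c' (coord c' p)"
  have "inner_product ?g" using continuous_metric_inner_product[OF gM c'(1)] c'(2) by (auto simp: chart_im_def)
  have "(pullback M N h gN c (coord c p) u u)\<^sup>2 = (?b (a * u) (a * u))\<^sup>2"
    using pullback_change_chart[OF hol gN c c'(1)] p c' by (simp add: a_def)
  also have "\<dots> \<le> tensor_norm_sq ?g ?b * (?g (a * u) (a * u))\<^sup>2"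
    by (rule bilinear_sq_le_tensor_norm_sq[OF \<open>inner_product ?g\<close> bilinear_pullback[OF hol gN c']])
  also have "?g (a * u) (a * u) = gM c (coord c p) u u"
    unfolding a_def
    by (rule continuous_metric_transition[symmetric, OF gM c c'(1)]) (use p c'(2) in blast)
  also have "tensor_norm_sq ?g ?b \<le> 2 * energy_density gM gN h p + 4"
    using tensor_norm_sq_le[OF \<open>inner_product ?g\<close>, of ?b]
    by (simp add: energy_density_def Let_def c'_def)
  finally show ?thesis by (simp add: mult_right_mono)
qed

end

section \<open>Compactness of families of bounded energy\<close>

text \<open>Bloch's theorem turns the area bound for the image of a disc into a pointwise bound of the
  derivative.\<close>

lemma injective_holomorphic_deriv_bound:
  assumes hol: "f holomorphic_on ball z t" and inj: "inj_on f (ball z t)" and t: "0 < t"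
    and C: "0 \<le> C" "(\<integral>\<^sup>+w. ennreal (cmod (deriv f w) ^ 4) * indicator (ball z t) w \<partial>lborel) \<le> ennreal C"
  shows "(cmod (deriv f z))\<^sup>2 \<le> 72 * (C + pi) / (pi * t)"
proof -
  \<comment> \<open>1/12 is the constant in Bloch's theorem: the image contains a disc of radius
    \<open>\<rho>\<close>, which bounds its area from below.\<close>
  define \<rho> where "\<rho> = t * cmod (deriv f z) / 12"
  have \<rho>: "0 \<le> \<rho>" using t by (simp add: \<rho>_def)
  obtain b where b: "ball b \<rho> \<subseteq> f ` ball z t"
    using Bloch[OF hol t, of \<rho>] by (auto simp: \<rho>_def)
  have area: "emeasure lborel (ball w r) = ennreal (pi * r\<^sup>2)" if "0 \<le> r" for w :: complex and r
    using that by (simp add: emeasure_ball unit_ball_vol_2)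
  note [measurable] = borel_measurable_deriv_power[OF open_ball hol, of 4]
  have "ennreal (pi * \<rho>\<^sup>2) \<le> emeasure lborel (f ` ball z t)"
    unfolding area[OF \<rho>, of b, symmetric]
    using b borel_image_injective_holomorphic[OF open_ball hol inj] by (intro emeasure_mono) auto
  also have "\<dots> = (\<integral>\<^sup>+w. ennreal ((cmod (deriv f w))\<^sup>2) * indicator (ball z t) w \<partial>lborel)"
    by (rule emeasure_holomorphic_image[OF open_ball hol inj]) auto
  \<comment> \<open>The weight t in 2 x^2 \<le> t x^4 + 1/t makes both terms of order t after
    integration over a disc of area pi t^2. The total t (C + pi) / 2 is compared with pi t^2 |f'|^2
    / 144, and 144 / 2 is the constant 72.\<close>
  also have "\<dots> \<le> (\<integral>\<^sup>+w. ennreal (t / 2) * (ennreal (cmod (deriv f w) ^ 4) * indicator (ball z t) w)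
      + ennreal (1 / (2 * t)) * indicator (ball z t) w \<partial>lborel)"
  proof (rule nn_integral_mono)
    fix w
    define x where "x = cmod (deriv f w)"
    have "0 \<le> (t * x\<^sup>2 - 1)\<^sup>2" by simp
    also have "\<dots> = t\<^sup>2 * x ^ 4 + 1 - 2 * t * x\<^sup>2"
      by (simp add: power2_eq_square eval_nat_numeral algebra_simps)
    finally have "x\<^sup>2 \<le> t / 2 * x ^ 4 + 1 / (2 * t)"
      using t by (simp add: field_simps power2_eq_square)
    then have "ennreal (x\<^sup>2) \<le> ennreal (t / 2) * ennreal (x ^ 4) + ennreal (1 / (2 * t))"
      using t by (simp add: ennreal_mult[symmetric] ennreal_plus[symmetric] x_def del: ennreal_plus)
    then show "ennreal ((cmod (deriv f w))\<^sup>2) * indicator (ball z t) w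
      \<le> ennreal (t / 2) * (ennreal (cmod (deriv f w) ^ 4) * indicator (ball z t) w)
      + ennreal (1 / (2 * t)) * indicator (ball z t) w"
      by (auto simp: x_def indicator_def)
  qed
  also have "\<dots> = ennreal (t / 2) * (\<integral>\<^sup>+w. ennreal (cmod (deriv f w) ^ 4) * indicator (ball z t) w \<partial>lborel)
      + ennreal (1 / (2 * t)) * emeasure lborel (ball z t)"
  proof (subst nn_integral_add)
    show "(\<lambda>w. ennreal (1 / (2 * t)) * indicator (ball z t) w) \<in> borel_measurable lborel"
    proof -
      have [measurable]: "ball z t \<in> sets lborel" by simp
      show ?thesis by measurable
    qed
  qed (auto simp: nn_integral_cmult nn_integral_cmult_indicator)
  also have "\<dots> \<le> ennreal (t / 2) * ennreal C + ennreal (1 / (2 * t)) * ennreal (pi * t\<^sup>2)"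
    using C t area[of t z] by (intro add_mono mult_left_mono) auto
  also have "\<dots> = ennreal (t / 2 * C + 1 / (2 * t) * (pi * t\<^sup>2))"
    using C t by (simp add: ennreal_mult[symmetric] ennreal_plus[symmetric] del: ennreal_plus)
  also have "t / 2 * C + 1 / (2 * t) * (pi * t\<^sup>2) = t * (C + pi) / 2"
    using t by (simp add: power2_eq_square field_simps)
  finally have "pi * \<rho>\<^sup>2 \<le> t * (C + pi) / 2"
    using C t by (subst (asm) ennreal_le_iff) auto
  then have "pi * t * t * (cmod (deriv f z))\<^sup>2 \<le> 72 * (t * (C + pi))"
    by (simp add: \<rho>_def power2_eq_square field_simps)
  then have "pi * t * (cmod (deriv f z))\<^sup>2 \<le> 72 * (C + pi)"
    using t by (metis (no_types, opaque_lifting) mult.assoc mult.left_commute mult_le_cancel_left_pos)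
  then show ?thesis using t by (simp add: field_simps)
qed

text \<open>The derivative bound, used at \<open>w\<close> on the disc of radius
  \<open>s - dist a w\<close>, grows like the inverse square root of the distance to the boundary.
  This is integrable along a radius, and the integral is of order \<open>sqrt s\<close>, uniformly
  over all \<open>f\<close> with the same \<open>C\<close>.\<close>

lemma injective_holomorphic_oscillation:
  assumes hol: "f holomorphic_on ball a s" and inj: "inj_on f (ball a s)"
    and C: "0 \<le> C" "(\<integral>\<^sup>+w. ennreal (cmod (deriv f w) ^ 4) * indicator (ball a s) w \<partial>lborel) \<le> ennreal C"
    and z: "z \<in> ball a s"
  shows "cmod (f z - f a) \<le> 2 * sqrt (72 * (C + pi) / pi) * sqrt s"
proof -
  define K where "K = sqrt (72 * (C + pi) / pi)"
  have K0: "0 \<le> K" using C by (simp add: K_def)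
  have K2: "72 * (C + pi) / (pi * t) = (K / sqrt t)\<^sup>2" if "0 < t" for t
    using C that by (simp add: K_def power_divide)
  have s: "0 < s" using z by (metis ball_eq_empty empty_iff not_le)
  have der: "cmod (deriv f w) \<le> K / sqrt (s - dist a w)" if w: "w \<in> ball a s" for w
  proof -
    let ?t = "s - dist a w"
    have t: "0 < ?t" using w by simp
    have sub: "ball w ?t \<subseteq> ball a s" using dist_triangle[of a _ w] by (auto simp: subset_iff) (smt (verit) dist_commute dist_triangle)
    have "(\<integral>\<^sup>+x. ennreal (cmod (deriv f x) ^ 4) * indicator (ball w ?t) x \<partial>lborel)
      \<le> (\<integral>\<^sup>+x. ennreal (cmod (deriv f x) ^ 4) * indicator (ball a s) x \<partial>lborel)"
      using sub by (intro nn_integral_mono mult_left_mono) (auto simp: indicator_def)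
    then have "(cmod (deriv f w))\<^sup>2 \<le> (K / sqrt ?t)\<^sup>2"
      using injective_holomorphic_deriv_bound[OF holomorphic_on_subset[OF hol sub] inj_on_subset[OF inj sub] t C(1)]
        C(2) unfolding K2[OF t] by force
    then show ?thesis using K0 t by (simp add: power2_le_iff_abs_le)
  qed
  define l where "l = dist a z"
  have l: "0 \<le> l" "l < s" using z by (auto simp: l_def)
  define \<gamma> where "\<gamma> \<tau> = a + of_real \<tau> * (z - a)" for \<tau>
  have \<gamma>: "dist a (\<gamma> \<tau>) = \<tau> * l" if "0 \<le> \<tau>" for \<tau>
    using that by (simp add: \<gamma>_def l_def dist_norm norm_mult norm_minus_commute)
  have \<gamma>s: "\<tau> * l < s" if "0 \<le> \<tau>" "\<tau> \<le> 1" for \<tau>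
    using l that mult_right_mono[of \<tau> 1 l] by linarith
  have d\<gamma>: "(\<gamma> has_vector_derivative (z - a)) (at \<tau>)" for \<tau>
    unfolding \<gamma>_def by (auto intro!: derivative_eq_intros)
  have df: "((\<lambda>\<tau>. f (\<gamma> \<tau>)) has_vector_derivative ((z - a) * deriv f (\<gamma> \<tau>))) (at \<tau>)"
    if "0 \<le> \<tau>" "\<tau> \<le> 1" for \<tau>
  proof -
    have "\<gamma> \<tau> \<in> ball a s" using \<gamma> \<gamma>s that by simp
    then have "(f has_field_derivative deriv f (\<gamma> \<tau>)) (at (\<gamma> \<tau>))"
      using holomorphic_derivI[OF hol open_ball] by blast
    then show ?thesis using field_vector_diff_chain_at[OF d\<gamma>] by (simp add: o_def)
  qed
  \<comment> \<open>\<open>?\<phi>\<close> is a primitive of the bound for the speed of the image of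
    the segment, so the mean value inequality takes the place of an integral.\<close>
  let ?\<phi> = "\<lambda>\<tau>. - 2 * K * sqrt (s - \<tau> * l)" and ?\<phi>' = "\<lambda>\<tau>. K * l / sqrt (s - \<tau> * l)"
  have d\<phi>: "(?\<phi> has_vector_derivative ?\<phi>' \<tau>) (at \<tau>)" if "0 \<le> \<tau>" "\<tau> \<le> 1" for \<tau>
    unfolding has_real_derivative_iff_has_vector_derivative[symmetric]
    using \<gamma>s[OF that] by (auto intro!: derivative_eq_intros simp: field_simps)
  have "norm (f (\<gamma> 1) - f (\<gamma> 0)) \<le> ?\<phi> 1 - ?\<phi> 0"
  proof (rule differentiable_bound_general)
    show "continuous_on {0..1} (\<lambda>\<tau>. f (\<gamma> \<tau>))"
      using df by (auto intro!: continuous_at_imp_continuous_on has_vector_derivative_continuous)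
    show "continuous_on {0..1} ?\<phi>" by (intro continuous_intros)
    fix \<tau> :: real assume \<tau>: "0 < \<tau>" "\<tau> < 1"
    show "((\<lambda>\<tau>. f (\<gamma> \<tau>)) has_vector_derivative ((z - a) * deriv f (\<gamma> \<tau>))) (at \<tau>)"
      using df \<tau> by simp
    show "(?\<phi> has_vector_derivative ?\<phi>' \<tau>) (at \<tau>)" using d\<phi> \<tau> by simp
    have "cmod (deriv f (\<gamma> \<tau>)) \<le> K / sqrt (s - \<tau> * l)"
      using der[of "\<gamma> \<tau>"] \<gamma>[of \<tau>] \<gamma>s[of \<tau>] \<tau> by simp
    then have "l * cmod (deriv f (\<gamma> \<tau>)) \<le> l * (K / sqrt (s - \<tau> * l))"
      using l by (intro mult_left_mono) auto
    then show "norm ((z - a) * deriv f (\<gamma> \<tau>)) \<le> ?\<phi>' \<tau>"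
      by (simp add: norm_mult l_def dist_norm norm_minus_commute mult.commute)
  qed simp
  also have "\<dots> \<le> 2 * K * sqrt s" using K0 l by simp
  finally show ?thesis by (simp add: \<gamma>_def K_def)
qed

section \<open>Extraction of convergent subsequences by open sets alone\<close>

lemma compact_space_cluster_point:
  fixes x :: "nat \<Rightarrow> 'a"
  assumes Y: "compact_space Y" and x: "\<And>n. x n \<in> topspace Y"
  shows "\<exists>y\<in>topspace Y. \<forall>W. openin Y W \<and> y \<in> W \<longrightarrow> (\<exists>\<^sub>F n in sequentially. x n \<in> W)"
proof (rule ccontr)
  assume "\<not> ?thesis"
  then obtain W where W: "\<And>y. y \<in> topspace Y \<Longrightarrow> openin Y (W y) \<and> y \<in> W y \<and> (\<forall>\<^sub>F n in sequentially. x n \<notin> W y)"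
    by (metis not_frequently)
  have "compactin Y (topspace Y)" using Y by (simp add: compact_space_def)
  moreover have "\<forall>U\<in>W ` topspace Y. openin Y U" "topspace Y \<subseteq> \<Union>(W ` topspace Y)" using W by auto
  ultimately obtain \<F> where "finite \<F>" "\<F> \<subseteq> W ` topspace Y" "topspace Y \<subseteq> \<Union>\<F>"
    unfolding compactin_def by meson
  then obtain T where T: "finite T" "T \<subseteq> topspace Y" "topspace Y \<subseteq> (\<Union>y\<in>T. W y)"
    by (metis finite_subset_image)
  have "\<forall>\<^sub>F n in sequentially. \<forall>y\<in>T. x n \<notin> W y"
    using T W by (intro eventually_ball_finite) auto
  then obtain n where "\<forall>y\<in>T. x n \<notin> W y" using eventually_happens' trivial_limit_sequentially by blast
  then show False using T(3) x[of n] by blast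
qed

text \<open>A diagonal argument decides, for all pairs of basic open sets \<open>A\<close>, \<open>B\<close>, whether the maps
  eventually send \<open>A\<close> into \<open>B\<close>; the hypothesis is the even continuity of the sequence.\<close>

lemma continuously_convergent_subsequence:
  fixes hs :: "nat \<Rightarrow> 'a \<Rightarrow> 'b"
  assumes X: "second_countable X" and Y: "second_countable Y" "compact_space Y"
    and into: "\<And>n p. p \<in> topspace X \<Longrightarrow> hs n p \<in> topspace Y"
    and even: "\<And>p q V. p \<in> topspace X \<Longrightarrow> openin Y V \<Longrightarrow> q \<in> V \<Longrightarrow>
      \<exists>U W. openin X U \<and> p \<in> U \<and> openin Y W \<and> q \<in> W \<and> (\<forall>n. hs n p \<in> W \<longrightarrow> hs n ` U \<subseteq> V)"
  obtains r h where "strict_mono (r :: nat \<Rightarrow> nat)" "\<And>p. p \<in> topspace X \<Longrightarrow> h p \<in> topspace Y"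
    "\<And>p V. p \<in> topspace X \<Longrightarrow> openin Y V \<Longrightarrow> h p \<in> V \<Longrightarrow>
      \<exists>U. openin X U \<and> p \<in> U \<and> (\<forall>\<^sub>F n in sequentially. hs (r n) ` U \<subseteq> V)"
proof -
  obtain \<A> where A: "countable \<A>" "\<And>V. V \<in> \<A> \<Longrightarrow> openin X V"
    "\<And>U x. openin X U \<Longrightarrow> x \<in> U \<Longrightarrow> \<exists>V\<in>\<A>. x \<in> V \<and> V \<subseteq> U"
    using X unfolding second_countable_def by metis
  obtain \<B> where B: "countable \<B>" "\<And>V. V \<in> \<B> \<Longrightarrow> openin Y V"
    "\<And>U x. openin Y U \<Longrightarrow> x \<in> U \<Longrightarrow> \<exists>V\<in>\<B>. x \<in> V \<and> V \<subseteq> U"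
    using Y(1) unfolding second_countable_def by metis
  define E where "E = from_nat_into (insert ({}, {}) (\<A> \<times> \<B>))"
  define Q where "Q k n \<longleftrightarrow> hs n ` fst (E k) \<subseteq> snd (E k)" for k n
  define P where "P k s \<longleftrightarrow> (\<forall>\<^sub>F i in sequentially. Q k (s i)) \<or> (\<forall>\<^sub>F i in sequentially. \<not> Q k (s i))"
    for k and s :: "nat \<Rightarrow> nat"
  interpret subseqs P
  proof
    fix k and s :: "nat \<Rightarrow> nat" assume "strict_mono s"
    show "\<exists>r'. strict_mono r' \<and> P k (s \<circ> r')"
    \<comment> \<open>Either the relation fails eventually, or it holds infinitely often and the
      subsequence enumerating those indices makes it hold throughout.\<close>
    proof (cases "\<forall>\<^sub>F i in sequentially. \<not> Q k (s i)")
      case True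
      then show ?thesis by (intro exI[of _ id]) (simp add: P_def strict_mono_def)
    next
      case False
      then have "infinite {i. Q k (s i)}"
        by (metis (no_types, lifting) cofinite_eq_sequentially eventually_cofinite not_not Collect_cong)
      then have "strict_mono (enumerate {i. Q k (s i)})" "\<And>i. Q k (s (enumerate {i. Q k (s i)} i))"
        using enumerate_in_set by (auto simp: strict_mono_enumerate)
      then show ?thesis by (intro exI[of _ "enumerate {i. Q k (s i)}"]) (simp add: P_def)
    qed
  qed
  have decided: "P k diagseq" for k
  proof -
    \<comment> \<open>The diagonal sequence is guaranteed to refine the stage that decides relation
      \<open>k\<close> only after a shift by \<open>Suc k\<close>; being a statement about eventual
      behaviour, \<open>P k\<close> is insensitive to the shift.\<close>
    have "P k (diagseq \<circ> ((+) (Suc k)))"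
    proof (rule diagseq_holds)
      fix r s :: "nat \<Rightarrow> nat" and n assume "strict_mono r" "P n s"
      then show "P n (s \<circ> r)" unfolding P_def comp_def
        using eventually_subseq[of r "\<lambda>i. Q n (s i)"] eventually_subseq[of r "\<lambda>i. \<not> Q n (s i)"] by blast
    qed
    then have "P k (\<lambda>i. diagseq (i + Suc k))" by (simp add: comp_def add.commute)
    then show ?thesis
      unfolding P_def[of k diagseq] P_def[of k "\<lambda>i. diagseq (i + Suc k)"] comp_def
      using eventually_sequentially_seg[of "\<lambda>i. Q k (diagseq i)" "Suc k"]
        eventually_sequentially_seg[of "\<lambda>i. \<not> Q k (diagseq i)" "Suc k"]
      by simp
  qed
  let ?g = "\<lambda>n. hs (diagseq n)"
  have cluster: "\<exists>y\<in>topspace Y. \<forall>W. openin Y W \<and> y \<in> W \<longrightarrow> (\<exists>\<^sub>F n in sequentially. ?g n p \<in> W)"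
    if "p \<in> topspace X" for p
    by (rule compact_space_cluster_point[OF Y(2) into[OF that]])
  \<comment> \<open>A cluster point is chosen for each \<open>p\<close> separately; the decided
    relations turn it into a limit.\<close>
  define h where "h p = (SOME y. y \<in> topspace Y \<and> (\<forall>W. openin Y W \<and> y \<in> W \<longrightarrow> (\<exists>\<^sub>F n in sequentially. ?g n p \<in> W)))" for p
  have h: "h p \<in> topspace Y \<and> (\<forall>W. openin Y W \<and> h p \<in> W \<longrightarrow> (\<exists>\<^sub>F n in sequentially. ?g n p \<in> W))"
    if "p \<in> topspace X" for p
    unfolding h_def by (rule someI_ex[OF cluster[OF that, unfolded Bex_def]])
  show ?thesis
  proof (rule that[of diagseq h])
    show "strict_mono diagseq" by (rule subseq_diagseq)
    show "\<And>p. p \<in> topspace X \<Longrightarrow> h p \<in> topspace Y" using h by blast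
    fix p V assume p: "p \<in> topspace X" and V: "openin Y V" "h p \<in> V"
    obtain V' where V': "V' \<in> \<B>" "h p \<in> V'" "V' \<subseteq> V" using B(3)[OF V] by blast
    obtain U W where UW: "openin X U" "p \<in> U" "openin Y W" "h p \<in> W" "\<And>n. hs n p \<in> W \<Longrightarrow> hs n ` U \<subseteq> V'"
      using even[OF p B(2)[OF V'(1)] V'(2)] by metis
    obtain U' where U': "U' \<in> \<A>" "p \<in> U'" "U' \<subseteq> U" using A(3)[OF UW(1,2)] by blast
    have "countable (insert ({}, {}) (\<A> \<times> \<B>))" using A(1) B(1) by simp
    then have "\<exists>k. E k = (U', V')"
      using U'(1) V'(1) unfolding E_def by (metis SigmaI from_nat_into_surj insertI2)
    then obtain k where k: "E k = (U', V')" by blast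
    \<comment> \<open>Clustering puts the value at \<open>p\<close> into \<open>W\<close> for
      infinitely many indices, even continuity makes each of these maps send \<open>U'\<close> into
      \<open>V'\<close>, and a decided relation that holds infinitely often holds
      eventually.\<close>
    have "\<exists>\<^sub>F n in sequentially. ?g n p \<in> W" using h[OF p] UW by blast
    then have "\<exists>\<^sub>F n in sequentially. Q k (diagseq n)"
      by (rule frequently_elim1) (use UW(5) U'(3) k in \<open>auto simp: Q_def\<close>)
    then have "\<forall>\<^sub>F n in sequentially. Q k (diagseq n)"
      using decided[of k] by (auto simp: P_def frequently_def)
    then have "\<forall>\<^sub>F n in sequentially. ?g n ` U' \<subseteq> V"
      by eventually_elim (use V'(3) k in \<open>auto simp: Q_def\<close>)
    then show "\<exists>U. openin X U \<and> p \<in> U \<and> (\<forall>\<^sub>F n in sequentially. ?g n ` U \<subseteq> V)"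
      using U' A(2) by blast
  qed
qed

text \<open>By homogeneity it suffices to minimise over the product of \<open>K\<close> with the
  unit circle, which is compact.\<close>

lemma continuous_inner_products_lower_bound:
  fixes g :: "complex \<Rightarrow> complex \<Rightarrow> complex \<Rightarrow> real"
  assumes K: "compact K" and ip: "\<And>w. w \<in> K \<Longrightarrow> inner_product (g w)"
    and cont: "\<And>u v. continuous_on K (\<lambda>w. g w u v)"
  obtains B where "0 < B" "\<And>w v. w \<in> K \<Longrightarrow> B * (cmod v)\<^sup>2 \<le> g w v v"
proof -
  let ?S = "K \<times> sphere (0::complex) 1"
  \<comment> \<open>The expansion in the basis turns continuity for fixed vectors into joint
    continuity in the point and the vector.\<close>
  let ?f = "\<lambda>x. Re (snd x) * Re (snd x) * g (fst x) 1 1 + Re (snd x) * Im (snd x) * g (fst x) 1 \<i>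
    + Im (snd x) * Re (snd x) * g (fst x) \<i> 1 + Im (snd x) * Im (snd x) * g (fst x) \<i> \<i>"
  have f: "?f (w, v) = g w v v" if "w \<in> K" for w v
    using bilinear_complex_expand[of "g w" v v] ip[OF that] by (simp add: inner_product_def)
  have "continuous_on ?S (\<lambda>x. g (fst x) u v)" for u v
    by (rule continuous_on_compose2[OF cont]) (auto intro!: continuous_intros)
  then have fc: "continuous_on ?S ?f" by (intro continuous_intros)
  have "compact ?S" using K by (intro compact_Times) auto
  have "\<exists>B>0. \<forall>x\<in>?S. B \<le> ?f x"
  proof (cases "?S = {}")
    case False
    then obtain x where x: "x \<in> ?S" "\<And>y. y \<in> ?S \<Longrightarrow> ?f x \<le> ?f y"
      using continuous_attains_inf[OF \<open>compact ?S\<close> False fc] by blast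
    have "0 < ?f x"
    proof -
      obtain w v where wv: "x = (w, v)" "w \<in> K" "cmod v = 1" using x(1) by auto
      then have "v \<noteq> 0" by auto
      then have "0 < g w v v" using ip[OF wv(2)] by (auto simp: inner_product_def)
      then show ?thesis using f[OF wv(2), of v] by (simp only: wv(1))
    qed
    then show ?thesis using x by blast
  qed (auto intro: exI[of _ 1])
  then obtain B where B: "0 < B" "\<And>x. x \<in> ?S \<Longrightarrow> B \<le> ?f x" by blast
  show ?thesis
  proof (rule that[OF B(1)])
    fix w v :: complex assume w: "w \<in> K"
    show "B * (cmod v)\<^sup>2 \<le> g w v v"
    proof (cases "v = 0")
      case True
      then show ?thesis using ip[OF w] by (simp add: inner_product_def bilinear_lzero)
    next
      case False
      define u where "u = v /\<^sub>R cmod v"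
      have v: "v = cmod v *\<^sub>R u" using False by (simp add: u_def)
      have "(w, u) \<in> ?S" using w False by (simp add: u_def)
      from B(2)[OF this] have "B \<le> g w u u" by (simp only: f[OF w])
      moreover have "g w v v = (cmod v)\<^sup>2 * g w u u"
        using ip[OF w] by (subst (1 2) v) (simp add: inner_product_def bilinear_lmul bilinear_rmul power2_eq_square)
      ultimately show ?thesis
        using mult_right_mono[of B "g w u u" "(cmod v)\<^sup>2"] by (simp add: mult.commute)
    qed
  qed
qed

lemma (in surface_charts) compactin_chart_inv_image:
  assumes "c \<in> surf_atlas S" "compact K" "K \<subseteq> chart_im c"
  shows "compactin (surf_top S) (chart_inv c ` K)"
  using image_compactin[OF _ continuous_map_chart_inv[OF assms(1)]] assms(2,3)
  by (simp add: compactin_subtopology)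

section \<open>Even continuity of maps of bounded energy\<close>

context surface_pair
begin

text \<open>A vanishing energy may be the junk value of the integral of a density that is not integrable.\<close>

lemma energy_density_integral:
  assumes "deformation_energy M gM N gN h \<noteq> 0"
  shows "energy_density gM gN h \<in> borel_measurable (volume_measure M gM)"
    "(\<integral>\<^sup>+p. ennreal (energy_density gM gN h p) \<partial>volume_measure M gM)
      = ennreal (deformation_energy M gM N gN h)"
proof -
  have i: "integrable (volume_measure M gM) (energy_density gM gN h)"
    using assms not_integrable_integral_eq unfolding deformation_energy_eq by blast
  then show "energy_density gM gN h \<in> borel_measurable (volume_measure M gM)" by simp
  show "(\<integral>\<^sup>+p. ennreal (energy_density gM gN h p) \<partial>volume_measure M gM)
      = ennreal (deformation_energy M gM N gN h)"
    unfolding deformation_energy_eq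
    by (rule nn_integral_eq_integral[OF i]) (simp add: energy_density_nonneg)
qed

text \<open>With f the local representative, \<open>B * (cmod f')\<^sup>2\<close> is a lower bound
  for the pullback evaluated on the vector 1, and the square of that value is controlled by the
  energy density.\<close>

lemma deriv_le_energy_density:
  assumes h: "h \<in> HD M N" and gM: "continuous_metric M gM" and gN: "continuous_metric N gN"
    and cd: "c \<in> surf_atlas M" "d \<in> surf_atlas N" and p: "p \<in> chart_dom c" "h p \<in> chart_dom d"
    and A: "gM c (coord c p) 1 1 \<le> A"
    and B: "0 < B" "\<And>v. B * (cmod v)\<^sup>2 \<le> gN d (coord d (h p)) v v"
  shows "cmod (deriv (local_rep c d h) (coord c p)) ^ 4 \<le> (A / B)\<^sup>2 * (2 * energy_density gM gN h p + 4)"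
proof -
  let ?a = "cmod (deriv (local_rep c d h) (coord c p))"
  have g0: "0 \<le> gM c (coord c p) 1 1"
    using continuous_metric_inner_product[OF gM cd(1)] p by (auto simp: inner_product_def chart_im_def less_imp_le)
  have "(B * ?a\<^sup>2)\<^sup>2 \<le> (pullback M N h gN c (coord c p) 1 1)\<^sup>2"
    using B pullback_eq[OF HD_D(1)[OF h] gN cd p, of 1 1] by (intro power_mono) auto
  also have "\<dots> \<le> (2 * energy_density gM gN h p + 4) * (gM c (coord c p) 1 1)\<^sup>2"
    by (rule pullback_sq_le_energy_density[OF HD_D(1)[OF h] gM gN cd(1) p(1)])
  also have "\<dots> \<le> (2 * energy_density gM gN h p + 4) * A\<^sup>2"
    using A g0 energy_density_nonneg[of gM gN h p] by (intro mult_left_mono power_mono) auto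
  finally show ?thesis using B(1) by (simp add: field_simps power2_eq_square eval_nat_numeral)
qed

text \<open>The energy controls the integral of \<open>cmod f' ^ 4\<close> in charts, hence the oscillation of \<open>f\<close>
  on every disc that is mapped into one chart of \<open>N\<close>. At the first point where a growing disc
  would leave the chart disc of radius \<open>2 * \<rho>\<close> the oscillation bound is violated.\<close>

lemma even_continuity:
  assumes K: "compact_space (surf_top M)"
    and gM: "continuous_metric M gM" and gN: "continuous_metric N gN"
    and p: "p \<in> points M" and V: "openin (surf_top N) V" and q: "q \<in> V"
  obtains U W where "openin (surf_top M) U" "p \<in> U" "openin (surf_top N) W" "q \<in> W"
    "\<And>h. h \<in> HD M N \<Longrightarrow> deformation_energy M gM N gN h \<noteq> 0 \<Longrightarrow>
      deformation_energy M gM N gN h \<le> E \<Longrightarrow> h p \<in> W \<Longrightarrow> h ` U \<subseteq> V"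
proof -
  define c d where "c = chart_at M p" and "d = chart_at N q"
  have c: "c \<in> surf_atlas M" "p \<in> chart_dom c"
    using M.chart_at_atlas[OF p] M.in_chart_dom_chart_at[OF p] by (auto simp: c_def)
  have qN: "q \<in> points N" using V q openin_subset by blast
  have d: "d \<in> surf_atlas N" "q \<in> chart_dom d"
    using N.chart_at_atlas[OF qN] N.in_chart_dom_chart_at[OF qN] by (auto simp: d_def)
  define z0 w0 where "z0 = coord c p" and "w0 = coord d q"
  have "z0 \<in> chart_im c" using c by (simp add: z0_def chart_im_def)
  then obtain r where r: "0 < r" "cball z0 r \<subseteq> chart_im c"
    using M.open_chart_im[OF c(1)] open_contains_cball by blast
  have "open (coord d ` (chart_dom d \<inter> V))" "w0 \<in> coord d ` (chart_dom d \<inter> V)"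
    using N.open_coord_image[OF d(1) V] d q by (auto simp: w0_def)
  then obtain e where e: "0 < e" "cball w0 e \<subseteq> coord d ` (chart_dom d \<inter> V)"
    using open_contains_cball by blast
  \<comment> \<open>Values start within \<open>\<rho>\<close> of \<open>w0\<close> and will move by
    at most \<open>\<rho> / 2\<close>, so they stay well inside the disc of radius
    \<open>2 * \<rho>\<close>, which lies in the chart and corresponds to points of
    \<open>V\<close>.\<close>
  define \<rho> where "\<rho> = e / 2"
  have \<rho>: "0 < \<rho>" "cball w0 (2 * \<rho>) \<subseteq> coord d ` (chart_dom d \<inter> V)" using e by (auto simp: \<rho>_def)
  have sub: "cball w0 (2 * \<rho>) \<subseteq> chart_im d" using \<rho>(2) by (auto simp: chart_im_def)
  have inV: "y \<in> V" if yd: "y \<in> chart_dom d" and yw: "coord d y \<in> cball w0 (2 * \<rho>)" for y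
  proof -
    obtain y' where y': "y' \<in> chart_dom d" "y' \<in> V" "coord d y = coord d y'" using \<rho>(2) yw by auto
    then have "y = y'" using inj_onD[OF N.inj_on_coord[OF d(1)]] yd by metis
    then show ?thesis using y' by simp
  qed
  have gMc: "continuous_on (cball z0 r) (\<lambda>z. gM c z u v)" for u v
    using gM c(1) r(2) continuous_on_subset unfolding continuous_metric_def by blast
  have gNc: "continuous_on (cball w0 (2 * \<rho>)) (\<lambda>z. gN d z u v)" for u v
    using gN d(1) sub continuous_on_subset unfolding continuous_metric_def by blast
  have "compact ((\<lambda>z. gM c z 1 1) ` cball z0 r)" by (intro compact_continuous_image gMc) simp
  then obtain A where A: "\<And>z. z \<in> cball z0 r \<Longrightarrow> gM c z 1 1 \<le> A"
    using compact_imp_bounded bounded_imp_bdd_above[of "(\<lambda>z. gM c z 1 1) ` cball z0 r"]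
    unfolding bdd_above_def by blast
  have "continuous_on (cball z0 r) (\<lambda>z. sqrt (gram_det (gM c z)))"
    unfolding gram_det_def by (intro continuous_intros gMc)
  moreover have "cball z0 r \<noteq> {}" using r by simp
  ultimately obtain z1 where z1: "z1 \<in> cball z0 r"
    "\<And>z. z \<in> cball z0 r \<Longrightarrow> sqrt (gram_det (gM c z1)) \<le> sqrt (gram_det (gM c z))"
    using continuous_attains_inf[OF compact_cball, of z0 r "\<lambda>z. sqrt (gram_det (gM c z))"] by blast
  \<comment> \<open>A positive lower bound of the area density converts integrals over the surface
    into integrals in the coordinate plane.\<close>
  define \<delta> where "\<delta> = sqrt (gram_det (gM c z1))"
  have \<delta>: "0 < \<delta>" "\<And>z. z \<in> cball z0 r \<Longrightarrow> \<delta> \<le> sqrt (gram_det (gM c z))"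
    using gram_det_pos[OF continuous_metric_inner_product[OF gM c(1)]] z1 r(2) by (auto simp: \<delta>_def)
  obtain B where B: "0 < B" "\<And>w v. w \<in> cball w0 (2 * \<rho>) \<Longrightarrow> B * (cmod v)\<^sup>2 \<le> gN d w v v"
  proof (rule continuous_inner_products_lower_bound[OF compact_cball])
    show "inner_product (gN d w)" if "w \<in> cball w0 (2 * \<rho>)" for w
      using continuous_metric_inner_product[OF gN d(1)] sub that by blast
    show "continuous_on (cball w0 (2 * \<rho>)) (\<lambda>w. gN d w u v)" for u v by (rule gNc)
  qed blast
  \<comment> \<open>The bound of \<open>deriv_le_energy_density\<close> integrated over the disc of
    radius \<open>r\<close>: its summand 4 contributes the area of the disc, its energy term at most
    \<open>2 / \<delta> * max E 0\<close>. The \<open>max\<close> keeps the constant nonnegative for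
    every \<open>E\<close>.\<close>
  define C where "C = (A / B)\<^sup>2 * (4 * (pi * r\<^sup>2) + 2 / \<delta> * max E 0)"
  have C0: "0 \<le> C" using \<delta> by (simp add: C_def)
  define L where "L = 2 * sqrt (72 * (C + pi) / pi)"
  have L: "0 < L" using C0 by (simp add: L_def add_nonneg_pos)
  \<comment> \<open>Chosen so that the oscillation \<open>L * sqrt r0\<close> is at most
    \<open>\<rho> / 2\<close>.\<close>
  define r0 where "r0 = min r ((\<rho> / (2 * L))\<^sup>2)"
  have r0: "0 < r0" "r0 \<le> r" using r \<rho> L by (auto simp: r0_def)
  have "sqrt r0 \<le> sqrt ((\<rho> / (2 * L))\<^sup>2)"
    unfolding r0_def by (rule real_sqrt_le_mono) simp
  also have "\<dots> = \<rho> / (2 * L)" using \<rho> L by simp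
  finally have Lr0: "L * sqrt r0 \<le> \<rho> / 2" using L by (simp add: field_simps)
  let ?\<mu> = "volume_measure M gM"
  have vol: "is_volume M gM ?\<mu>" by (rule M.is_volume_volume_measure[OF K gM])
  define U W where "U = chart_inv c ` ball z0 r0" and "W = {y \<in> chart_dom d. coord d y \<in> ball w0 \<rho>}"
  have ballr: "ball z0 r0 \<subseteq> cball z0 r" using r0 by auto
  show ?thesis
  proof (rule that[of U W])
    show "openin (surf_top M) U" unfolding U_def using ballr r by (intro M.openin_chart_inv_image[OF c(1)]) auto
    show "p \<in> U" unfolding U_def z0_def using r0 c by (intro image_eqI[of _ _ "coord c p"]) auto
    show "openin (surf_top N) W" unfolding W_def by (intro N.openin_coord_vimage[OF d(1)]) auto
    show "q \<in> W" using d \<rho> by (simp add: W_def w0_def)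
    fix h assume h: "h \<in> HD M N" and hE: "deformation_energy M gM N gN h \<noteq> 0" "deformation_energy M gM N gN h \<le> E"
      and hp: "h p \<in> W"
    note hol = HD_D(1)[OF h] and cont = HD_D(2)[OF h] and inj = HD_D(3)[OF h]
    define f where "f = local_rep c d h"
    define D where "D = {y \<in> chart_dom d. coord d y \<in> ball w0 (2 * \<rho>)}"
    \<comment> \<open>\<open>X\<close> consists of the coordinates of points that \<open>h\<close>
      sends into the chart disc of radius \<open>2 * \<rho>\<close>. The oscillation bound
      \<open>osc\<close> is available only on discs already known to lie in \<open>X\<close>;
      \<open>ballX\<close> shows that the disc of radius \<open>r0\<close> is one of them.\<close>
    define X where "X = coord c ` (chart_dom c \<inter> h -` D)"
    have Dopen: "openin (surf_top N) D" unfolding D_def by (intro N.openin_coord_vimage[OF d(1)]) auto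
    have "openin (surf_top M) (chart_dom c \<inter> h -` D)" by (rule openin_vimage_chart_dom[OF cont c(1) Dopen])
    from M.open_coord_image[OF c(1) this] have Xopen: "open X" by (simp add: X_def)
    have Xrep: "X \<subseteq> rep_dom h c d" by (auto simp: X_def rep_dom_def D_def)
    have z0X: "z0 \<in> X" using c hp \<rho> by (auto simp: X_def z0_def D_def W_def)
    have fz0: "dist w0 (f z0) < \<rho>" using c hp by (simp add: f_def z0_def W_def)
    have osc: "dist w0 (f z) \<le> dist w0 (f z0) + \<rho> / 2"
      if s: "s \<le> r0" "ball z0 s \<subseteq> X" and z: "z \<in> ball z0 s" for s z
    proof -
      have srep: "ball z0 s \<subseteq> rep_dom h c d" using s Xrep by blast
      have fhol: "f holomorphic_on ball z0 s" unfolding f_def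
        by (rule holomorphic_on_subset[OF holomorphic_local_rep[OF hol c(1) d(1)] srep])
      have finj: "inj_on f (ball z0 s)" unfolding f_def
        by (rule inj_on_subset[OF inj_on_local_rep[OF inj c(1) d(1)] srep])
      let ?\<phi> = "\<lambda>p. ennreal (energy_density gM gN h p)"
      have \<phi>[measurable]: "?\<phi> \<in> borel_measurable (surface_borel M)"
        using energy_density_integral(1)[OF hE(1)] M.is_volume_sets[OF vol]
        by (simp cong: measurable_cong_sets)
      have \<phi>int: "(\<integral>\<^sup>+z. ?\<phi> (chart_inv c z) * chart_density gM c z \<partial>lborel) \<le> ennreal (max E 0)"
      proof -
        have "(\<integral>\<^sup>+z. ?\<phi> (chart_inv c z) * chart_density gM c z \<partial>lborel)
          = (\<integral>\<^sup>+p. ?\<phi> p * indicator (chart_dom c) p \<partial>?\<mu>)"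
          by (rule M.is_volume_nn_integral_chart[OF vol gM c(1) \<phi>, symmetric])
        also have "\<dots> \<le> (\<integral>\<^sup>+p. ?\<phi> p \<partial>?\<mu>)" by (intro nn_integral_mono) (auto simp: indicator_def)
        also have "\<dots> = ennreal (deformation_energy M gM N gN h)" by (rule energy_density_integral(2)[OF hE(1)])
        also have "\<dots> \<le> ennreal (max E 0)" using hE(2) by (intro ennreal_leI) simp
        finally show ?thesis .
      qed
      have meas: "(\<lambda>z. ?\<phi> (chart_inv c z) * chart_density gM c z) \<in> borel_measurable borel"
      proof -
        note [measurable] = M.total_chart_inv_measurable[OF c(1)] M.chart_density_measurable[OF gM c(1)]
        have "(\<lambda>z. ?\<phi> (M.total_chart_inv c z) * chart_density gM c z) \<in> borel_measurable borel" by measurable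
        moreover have "(\<lambda>z. ?\<phi> (M.total_chart_inv c z) * chart_density gM c z) = (\<lambda>z. ?\<phi> (chart_inv c z) * chart_density gM c z)"
          by (auto simp: fun_eq_iff M.total_chart_inv_def chart_density_def)
        ultimately show ?thesis by metis
      qed
      have pw: "ennreal (cmod (deriv f z) ^ 4) * indicator (ball z0 s) z
        \<le> ennreal ((A / B)\<^sup>2) * (4 * indicator (ball z0 r) z + ennreal (2 / \<delta>) * (?\<phi> (chart_inv c z) * chart_density gM c z))" for z
      proof (cases "z \<in> ball z0 s")
        case True
        then obtain p' where p': "p' \<in> chart_dom c" "h p' \<in> D" "z = coord c p'" using s(2) by (auto simp: X_def)
        have zr: "z \<in> cball z0 r" "z \<in> ball z0 r" using True s(1) r0 by auto
        let ?\<epsilon> = "energy_density gM gN h p'" and ?s = "sqrt (gram_det (gM c z))"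
        have "cmod (deriv f z) ^ 4 \<le> (A / B)\<^sup>2 * (2 * ?\<epsilon> + 4)"
          unfolding f_def p'(3)
          using p' A[OF zr(1)] B by (intro deriv_le_energy_density[OF h gM gN c(1) d(1)]) (auto simp: D_def)
        also have "\<dots> \<le> (A / B)\<^sup>2 * (4 + 2 / \<delta> * (?\<epsilon> * ?s))"
        proof (rule mult_left_mono)
          have "?\<epsilon> * \<delta> \<le> ?\<epsilon> * ?s" using \<delta>(2)[OF zr(1)] energy_density_nonneg by (intro mult_left_mono)
          then show "2 * ?\<epsilon> + 4 \<le> 4 + 2 / \<delta> * (?\<epsilon> * ?s)" using \<delta>(1) by (simp add: field_simps)
        qed simp
        finally have "ennreal (cmod (deriv f z) ^ 4) \<le> ennreal ((A / B)\<^sup>2 * (4 + 2 / \<delta> * (?\<epsilon> * ?s)))"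
          by (rule ennreal_leI)
        also have "\<dots> = ennreal ((A / B)\<^sup>2) * (4 + ennreal (2 / \<delta>) * (ennreal ?\<epsilon> * ennreal ?s))"
        proof -
          have s0: "0 \<le> ?s" using \<delta>(1) \<delta>(2)[OF zr(1)] by linarith
          have "ennreal (4 + 2 / \<delta> * (?\<epsilon> * ?s)) = 4 + ennreal (2 / \<delta>) * (ennreal ?\<epsilon> * ennreal ?s)"
          proof -
            have "ennreal (2 / \<delta> * (?\<epsilon> * ?s)) = ennreal (2 / \<delta>) * ennreal (?\<epsilon> * ?s)"
              using \<delta>(1) by (intro ennreal_mult') simp
            also have "ennreal (?\<epsilon> * ?s) = ennreal ?\<epsilon> * ennreal ?s"
              by (intro ennreal_mult' energy_density_nonneg)
            finally have "ennreal (2 / \<delta> * (?\<epsilon> * ?s)) = ennreal (2 / \<delta>) * (ennreal ?\<epsilon> * ennreal ?s)" .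
            moreover have "0 \<le> 2 / \<delta> * (?\<epsilon> * ?s)"
              using \<delta>(1) s0 energy_density_nonneg[of gM gN h p'] by (intro mult_nonneg_nonneg) auto
            ultimately show ?thesis by (simp only: ennreal_plus ennreal_numeral zero_le_numeral)
          qed
          then show ?thesis by (simp add: ennreal_mult')
        qed
        finally show ?thesis using True zr(2) p' c r(2) by (simp add: chart_density_def)
      qed simp
      have "(\<integral>\<^sup>+z. ennreal (cmod (deriv f z) ^ 4) * indicator (ball z0 s) z \<partial>lborel)
        \<le> (\<integral>\<^sup>+z. ennreal ((A / B)\<^sup>2) * (4 * indicator (ball z0 r) z + ennreal (2 / \<delta>) * (?\<phi> (chart_inv c z) * chart_density gM c z)) \<partial>lborel)"
        by (intro nn_integral_mono pw)
      also have "\<dots> = ennreal ((A / B)\<^sup>2) * (4 * emeasure lborel (ball z0 r)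
          + ennreal (2 / \<delta>) * (\<integral>\<^sup>+z. ?\<phi> (chart_inv c z) * chart_density gM c z \<partial>lborel))"
      proof -
        note [measurable] = meas
        have [measurable]: "ball z0 r \<in> sets lborel" by simp
        show ?thesis by (simp add: nn_integral_cmult nn_integral_add nn_integral_cmult_indicator)
      qed
      also have "\<dots> \<le> ennreal ((A / B)\<^sup>2) * (4 * ennreal (pi * r\<^sup>2) + ennreal (2 / \<delta>) * ennreal (max E 0))"
        using \<phi>int r(1) by (intro mult_left_mono add_mono) (auto simp: emeasure_ball unit_ball_vol_2)
      also have "\<dots> = ennreal C"
      proof -
        have "ennreal (4 * (pi * r\<^sup>2) + 2 / \<delta> * max E 0) = 4 * ennreal (pi * r\<^sup>2) + ennreal (2 / \<delta>) * ennreal (max E 0)"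
        proof -
          have "ennreal (4 * (pi * r\<^sup>2)) = 4 * ennreal (pi * r\<^sup>2)"
            using ennreal_mult'[of 4 "pi * r\<^sup>2"] by simp
          moreover have "ennreal (2 / \<delta> * max E 0) = ennreal (2 / \<delta>) * ennreal (max E 0)"
            using \<delta>(1) by (intro ennreal_mult') simp
          moreover have "0 \<le> 2 / \<delta> * max E 0" using \<delta>(1) by (intro mult_nonneg_nonneg) auto
          ultimately show ?thesis by (simp only: ennreal_plus pi_ge_zero zero_le_power2 mult_nonneg_nonneg zero_le_numeral)
        qed
        then show ?thesis by (simp add: C_def ennreal_mult')
      qed
      finally have "cmod (f z - f z0) \<le> L * sqrt s"
        unfolding L_def by (rule injective_holomorphic_oscillation[OF fhol finj C0 _ z])
      also have "\<dots> \<le> L * sqrt r0" using L s(1) by simp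
      also have "\<dots> \<le> \<rho> / 2" by (rule Lr0)
      finally show ?thesis using dist_triangle[of w0 "f z" "f z0"] by (simp add: dist_norm norm_minus_commute)
    qed
    have ballX: "ball z0 r0 \<subseteq> X"
    proof (rule ccontr)
      assume "\<not> ball z0 r0 \<subseteq> X"
      then have ne: "cball z0 r0 - X \<noteq> {}" using ball_subset_cball by blast
      have "compact (cball z0 r0 - X)" using Xopen by (intro compact_diff) auto
      \<comment> \<open>A point of the closed disc outside \<open>X\<close> nearest to the centre:
        the open disc reaching up to it lies in \<open>X\<close>, so \<open>osc\<close> applies
        there.\<close>
      then obtain b where b: "b \<in> cball z0 r0" "b \<notin> X" "\<And>y. y \<in> cball z0 r0 - X \<Longrightarrow> dist z0 b \<le> dist z0 y"
        using continuous_attains_inf[OF _ ne, of "dist z0"] continuous_on_dist[OF continuous_on_const continuous_on_id]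
        by blast
      define s where "s = dist z0 b"
      have s: "0 < s" "s \<le> r0" using b z0X by (auto simp: s_def)
      have bX: "ball z0 s \<subseteq> X"
      proof
        fix y assume "y \<in> ball z0 s"
        then show "y \<in> X" using b(3)[of y] s by (auto simp: s_def)
      qed
      \<comment> \<open>\<open>D1\<close> is compact, hence closed, and contained in
        \<open>D\<close> because \<open>\<rho> + \<rho> / 2 < 2 * \<rho>\<close>. By continuity
        \<open>b\<close> is sent into \<open>D1\<close>, so \<open>b\<close> would lie in
        \<open>X\<close> after all.\<close>
      define D1 where "D1 = chart_inv d ` cball w0 (dist w0 (f z0) + \<rho> / 2)"
      have s1: "cball w0 (dist w0 (f z0) + \<rho> / 2) \<subseteq> ball w0 (2 * \<rho>)" using fz0 \<rho> by auto
      have D1sub: "D1 \<subseteq> D"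
        unfolding D1_def D_def using s1 sub by (auto simp: subset_iff)
      have "compactin (surf_top N) D1" unfolding D1_def
        using s1 sub by (intro N.compactin_chart_inv_image[OF d(1)]) (auto simp: subset_iff)
      then have "closedin (surf_top N) D1" using N.Hausdorff by (rule compactin_imp_closedin[rotated])
      then have co: "openin (surf_top N) (points N - D1)" by blast
      have bim: "b \<in> chart_im c" using b(1) r0 r(2) by auto
      have "h (chart_inv c b) \<in> D1"
      proof (rule ccontr)
        assume n: "h (chart_inv c b) \<notin> D1"
        have o: "open (coord c ` (chart_dom c \<inter> (chart_dom c \<inter> h -` (points N - D1))))"
          by (rule M.open_coord_image[OF c(1) openin_vimage_chart_dom[OF cont c(1) co]])
        have "h (chart_inv c b) \<in> points N"
          using M.chart_inv_in_points[OF c(1) bim] HD_D(4)[OF h] by blast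
        then have "b \<in> coord c ` (chart_dom c \<inter> (chart_dom c \<inter> h -` (points N - D1)))"
          using n bim by (intro image_eqI[of _ _ "chart_inv c b"]) auto
        moreover have "b \<in> closure (ball z0 s)" using s by (simp add: s_def)
        ultimately obtain y where y: "y \<in> ball z0 s" "y \<in> coord c ` (chart_dom c \<inter> (chart_dom c \<inter> h -` (points N - D1)))"
          using o by (meson closure_iff_nhds_not_empty disjoint_iff order_refl)
        then obtain p' where p': "p' \<in> chart_dom c" "h p' \<in> points N - D1" "y = coord c p'" by auto
        have "h p' \<in> D"
          using bX y(1) p' inj_onD[OF M.inj_on_coord[OF c(1)], of p'] by (auto simp: X_def subset_iff)
        then have "h p' \<in> chart_dom d" by (simp add: D_def)
        moreover have "coord d (h p') \<in> cball w0 (dist w0 (f z0) + \<rho> / 2)"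
          using osc[OF s(2) bX y(1)] p' c by (simp add: f_def)
        ultimately have "h p' \<in> D1"
          unfolding D1_def using d by (intro image_eqI[of _ _ "coord d (h p')"]) auto
        then show False using p' by blast
      qed
      then have "b \<in> X" unfolding X_def using D1sub bim by (intro image_eqI[of _ _ "chart_inv c b"]) auto
      then show False using b by blast
    qed
    show "h ` U \<subseteq> V"
    proof
      fix y assume "y \<in> h ` U"
      then obtain z where z: "z \<in> ball z0 r0" "y = h (chart_inv c z)" by (auto simp: U_def)
      then have "z \<in> X" using ballX by blast
      then have "y \<in> D" using z c by (auto simp: X_def)
      then show "y \<in> V" using inV by (auto simp: D_def)
    qed
  qed
qed

end

section \<open>Existence of minimizers\<close>

context surface_pair
begin

text \<open>The identity theorem made global: the set of points with a neighbourhood on which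
  \<open>h\<close> is constantly \<open>y\<close> is open, and it is closed by analytic continuation
  in charts, so connectedness finishes.\<close>

lemma holomorphic_map_constant:
  assumes hol: "holomorphic_map M N h"
    and U: "openin (surf_top M) U" "U \<noteq> {}" "\<And>x. x \<in> U \<Longrightarrow> h x = y"
    and p: "p \<in> points M"
  shows "h p = y"
proof -
  have cont: "continuous_map (surf_top M) (surf_top N) h" using hol by (simp add: holomorphic_map_def)
  define Z where "Z = \<Union>{U. openin (surf_top M) U \<and> (\<forall>x\<in>U. h x = y)}"
  have Z: "openin (surf_top M) Z" unfolding Z_def by (rule openin_Union) auto
  have "openin (surf_top M) (points M - Z)"
  proof (subst openin_subopen, intro ballI)
    fix x assume x: "x \<in> points M - Z"
    define c d where "c = chart_at M x" and "d = chart_at N (h x)"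
    have hx: "h x \<in> points N" using x cont by (auto simp: continuous_map_def)
    have c: "c \<in> surf_atlas M" "x \<in> chart_dom c" and d: "d \<in> surf_atlas N" "h x \<in> chart_dom d"
      using M.chart_at_atlas M.in_chart_dom_chart_at N.chart_at_atlas[OF hx] N.in_chart_dom_chart_at[OF hx] x
      by (auto simp: c_def d_def)
    obtain r where r: "0 < r" "ball (coord c x) r \<subseteq> rep_dom h c d"
      using open_rep_dom[OF cont c(1) d(1)] coord_in_rep_dom[of x c h d, OF c(2) d(2)] open_contains_ball by blast
    let ?B = "ball (coord c x) r" and ?f = "local_rep c d h"
    have Bim: "?B \<subseteq> chart_im c" using r(2) by (auto simp: rep_dom_def chart_im_def)
    let ?O = "chart_inv c ` ?B"
    have O: "openin (surf_top M) ?O" by (rule M.openin_chart_inv_image[OF c(1) open_ball Bim])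
    have xO: "x \<in> ?O" using r(1) c by (intro image_eqI[of _ _ "coord c x"]) auto
    \<comment> \<open>If the coordinate disc around \<open>x\<close> met \<open>Z\<close>, the local
      representative would be constant on an open subset of the disc, hence on all of it, and
      \<open>x\<close> would belong to \<open>Z\<close>.\<close>
    have "?O \<inter> Z = {}"
    proof (rule ccontr)
      assume "?O \<inter> Z \<noteq> {}"
      then obtain x' V where x': "x' \<in> ?O" "x' \<in> V" and V: "openin (surf_top M) V" "\<And>x. x \<in> V \<Longrightarrow> h x = y"
        by (auto simp: Z_def)
      let ?T = "coord c ` (chart_dom c \<inter> V) \<inter> ?B"
      obtain z' where z': "z' \<in> ?B" "x' = chart_inv c z'" using x'(1) by blast
      have z'im: "z' \<in> chart_im c" using z' Bim by blast
      have "z' \<in> ?T" using z' z'im x'(2) by (auto intro!: image_eqI[of _ _ x'])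
      have f: "?f z = coord d y" if "z \<in> ?T" for z using that V(2) c(1) by auto
      have eq: "?f z = coord d y" if "z \<in> ?B" for z
      proof (rule analytic_continuation_open[of ?T ?B ?f "\<lambda>_. coord d y"])
        show "open ?T" using M.open_coord_image[OF c(1) V(1)] by auto
        show "?T \<noteq> {}" using \<open>z' \<in> ?T\<close> by blast
        show "?f holomorphic_on ?B"
          using holomorphic_on_subset[OF holomorphic_local_rep[OF hol c(1) d(1)] r(2)] .
      qed (use that f in auto)
      have hz: "h (chart_inv c z) \<in> chart_dom d \<and> coord d (h (chart_inv c z)) = coord d y" if "z \<in> ?B" for z
      proof -
        obtain q where q: "q \<in> chart_dom c" "h q \<in> chart_dom d" "z = coord c q"
          using r(2) \<open>z \<in> ?B\<close> by (meson rep_domE subsetD)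
        then show ?thesis using eq[OF that] c(1) by simp
      qed
      have yd: "y \<in> chart_dom d" using hz[OF z'(1)] V(2)[OF x'(2)] z'(2) by simp
      have "h x = y" if "x \<in> ?O" for x
        using that hz yd inj_onD[OF N.inj_on_coord[OF d(1)]] by blast
      then have "?O \<subseteq> Z" using O unfolding Z_def by blast
      then show False using xO x by blast
    qed
    then show "\<exists>T. openin (surf_top M) T \<and> x \<in> T \<and> T \<subseteq> points M - Z"
      using O xO openin_subset[OF O] by blast
  qed
  then have "closedin (surf_top M) Z" using openin_subset[OF Z] by (simp add: closedin_def)
  moreover have "Z \<noteq> {}" using U unfolding Z_def by blast
  ultimately have "Z = points M" using M.connected Z connected_space_clopen_in by blast
  then show ?thesis using p by (auto simp: Z_def)
qed

text \<open>Continuous convergence, phrased with open sets since no distance on the target is fixed.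
  Continuity of \<open>h\<close> is not part of it and is derived in
  \<open>continuous_limit\<close>.\<close>

definition continuously_convergent :: "(nat \<Rightarrow> 'a \<Rightarrow> 'b) \<Rightarrow> ('a \<Rightarrow> 'b) \<Rightarrow> bool" where
  "continuously_convergent hs h \<longleftrightarrow> (\<forall>p\<in>points M. h p \<in> points N) \<and>
     (\<forall>p\<in>points M. \<forall>V. openin (surf_top N) V \<and> h p \<in> V \<longrightarrow>
        (\<exists>U. openin (surf_top M) U \<and> p \<in> U \<and> (\<forall>\<^sub>F n in sequentially. hs n ` U \<subseteq> V)))"

lemma continuously_convergentE:
  assumes "continuously_convergent hs h" "p \<in> points M" "openin (surf_top N) V" "h p \<in> V"
  obtains U where "openin (surf_top M) U" "p \<in> U" "\<forall>\<^sub>F n in sequentially. hs n ` U \<subseteq> V"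
  using assms unfolding continuously_convergent_def by blast

text \<open>Regularity of the target separates \<open>h p\<close> from the complement of
  \<open>V\<close>. Near \<open>p\<close> the sequence eventually stays in the first open set, so no
  limit value there can lie in the second.\<close>

lemma continuous_limit:
  assumes cc: "continuously_convergent hs h" and K: "compact_space (surf_top N)"
  shows "continuous_map (surf_top M) (surf_top N) h"
  unfolding continuous_map_def
proof (intro conjI allI impI)
  show into: "h \<in> points M \<rightarrow> points N" using cc by (auto simp: continuously_convergent_def)
  fix V assume V: "openin (surf_top N) V"
  show "openin (surf_top M) {x \<in> points M. h x \<in> V}"
  proof (subst openin_subopen, intro ballI)
    fix p assume p: "p \<in> {x \<in> points M. h x \<in> V}"
    have "regular_space (surf_top N)" using K N.Hausdorff compact_Hausdorff_imp_regular_space by blast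
    moreover have "closedin (surf_top N) (points N - V)" using V by blast
    moreover have "h p \<in> points N - (points N - V)" using p into by auto
    ultimately obtain A B where AB: "openin (surf_top N) A" "openin (surf_top N) B" "h p \<in> A"
      "points N - V \<subseteq> B" "disjnt A B"
      unfolding regular_space_def by meson
    obtain U where U: "openin (surf_top M) U" "p \<in> U" "\<forall>\<^sub>F n in sequentially. hs n ` U \<subseteq> A"
      using continuously_convergentE[OF cc _ AB(1,3)] p by blast
    have "h x \<in> V" if x: "x \<in> U" for x
    proof (rule ccontr)
      assume "h x \<notin> V"
      have xM: "x \<in> points M" using x U(1) openin_subset by blast
      then have "h x \<in> B" using AB(4) into \<open>h x \<notin> V\<close> by auto
      then obtain U' where U': "x \<in> U'" "\<forall>\<^sub>F n in sequentially. hs n ` U' \<subseteq> B"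
        using continuously_convergentE[OF cc xM AB(2)] by metis
      have "\<forall>\<^sub>F n in sequentially. hs n x \<in> A \<and> hs n x \<in> B"
        using U(3) U'(2) by eventually_elim (use x U'(1) in blast)
      then obtain n where "hs n x \<in> A \<and> hs n x \<in> B"
        using eventually_happens' trivial_limit_sequentially by blast
      then show False using AB(5) by (auto simp: disjnt_iff)
    qed
    then show "\<exists>T. openin (surf_top M) T \<and> p \<in> T \<and> T \<subseteq> {x \<in> points M. h x \<in> V}"
      using U openin_subset by blast
  qed
qed

text \<open>Converts continuous convergence into uniform convergence on a closed coordinate disc, by
  local estimates and a finite subcover, so that theorems on sequences of holomorphic functions
  apply. The set \<open>O'\<close> keeps the disc close to \<open>p\<close>, which serves Hurwitz's
  theorem.\<close>

lemma uniform_limit_local_rep: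
  assumes cc: "continuously_convergent hs h" and cont: "continuous_map (surf_top M) (surf_top N) h"
    and cd: "c \<in> surf_atlas M" "d \<in> surf_atlas N" and p: "p \<in> chart_dom c" "h p \<in> chart_dom d"
    and O: "openin (surf_top M) O'" "p \<in> O'"
  obtains r where "0 < r" "cball (coord c p) r \<subseteq> rep_dom h c d"
    "chart_inv c ` cball (coord c p) r \<subseteq> O'"
    "\<forall>\<^sub>F n in sequentially. cball (coord c p) r \<subseteq> rep_dom (hs n) c d"
    "uniform_limit (cball (coord c p) r) (\<lambda>n. local_rep c d (hs n)) (local_rep c d h) sequentially"
proof -
  let ?z = "coord c p" and ?f = "local_rep c d h"
  have pM: "p \<in> points M" using p(1) M.chart_dom_subset[OF cd(1)] by blast
  obtain U where U: "openin (surf_top M) U" "p \<in> U" "\<forall>\<^sub>F n in sequentially. hs n ` U \<subseteq> chart_dom d"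
    using continuously_convergentE[OF cc pM N.openin_chart_dom[OF cd(2)] p(2)] by blast
  define Y where "Y = coord c ` (chart_dom c \<inter> (U \<inter> O')) \<inter> rep_dom h c d"
  have "open Y" unfolding Y_def
    using M.open_coord_image[OF cd(1) openin_Int[OF U(1) O(1)]] open_rep_dom[OF cont cd] by blast
  moreover have "?z \<in> Y" using p U(2) O(2) coord_in_rep_dom[of p c h d] by (auto simp: Y_def)
  ultimately obtain r where r: "0 < r" "cball ?z r \<subseteq> Y" using open_contains_cball by blast
  let ?K = "cball ?z r"
  have K1: "?K \<subseteq> rep_dom h c d" using r by (auto simp: Y_def)
  show ?thesis
  proof (rule that[OF r(1) K1])
    show "chart_inv c ` ?K \<subseteq> O'"
    proof
      fix x assume "x \<in> chart_inv c ` ?K"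
      then obtain z where z: "z \<in> ?K" "x = chart_inv c z" by blast
      then obtain x' where "x' \<in> chart_dom c" "x' \<in> O'" "z = coord c x'" using r(2) by (auto simp: Y_def)
      then show "x \<in> O'" using z cd by simp
    qed
    show ev: "\<forall>\<^sub>F n in sequentially. ?K \<subseteq> rep_dom (hs n) c d"
      using U(3)
    proof eventually_elim
      case (elim n)
      show ?case
      proof
        fix z assume "z \<in> ?K"
        then obtain x where "x \<in> chart_dom c" "x \<in> U" "z = coord c x" using r(2) by (auto simp: Y_def)
        then show "z \<in> rep_dom (hs n) c d" using elim coord_in_rep_dom[of x c "hs n" d] by auto
      qed
    qed
    show "uniform_limit ?K (\<lambda>n. local_rep c d (hs n)) ?f sequentially"
    proof (rule uniform_limitI)
      fix e :: real assume e: "0 < e"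
      have fc: "continuous_on (rep_dom h c d) ?f"
      proof -
        have "continuous_map (top_of_set (rep_dom h c d)) euclidean ?f"
        proof -
          have rs: "rep_dom h c d \<subseteq> chart_im c" by (auto simp: rep_dom_def chart_im_def)
          have 1: "continuous_map (top_of_set (rep_dom h c d)) (surf_top M) (chart_inv c)"
            using continuous_map_from_subtopology_mono[OF M.continuous_map_chart_inv[OF cd(1)] rs] .
          have 2: "continuous_map (top_of_set (rep_dom h c d)) (surf_top N) (h \<circ> chart_inv c)"
            by (rule continuous_map_compose[OF 1 cont])
          have "(h \<circ> chart_inv c) ` rep_dom h c d \<subseteq> chart_dom d"
            using cd by (auto elim!: rep_domE)
          then have 3: "continuous_map (top_of_set (rep_dom h c d)) (subtopology (surf_top N) (chart_dom d)) (h \<circ> chart_inv c)"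
            using 2 by (auto intro!: continuous_map_into_subtopology)
          have 4: "continuous_map (subtopology (surf_top N) (chart_dom d)) (top_of_set (chart_im d)) (coord d)"
            using N.homeomorphic_coord[OF cd(2)] homeomorphic_imp_continuous_map by blast
          have "continuous_map (top_of_set (rep_dom h c d)) (top_of_set (chart_im d)) (coord d \<circ> (h \<circ> chart_inv c))"
            by (rule continuous_map_compose[OF 3 4])
          then show ?thesis by (simp add: local_rep_def comp_assoc continuous_map_in_subtopology)
        qed
        then show ?thesis by simp
      qed
      have loc: "\<exists>T. open T \<and> z \<in> T \<and> (\<forall>\<^sub>F n in sequentially. \<forall>z'\<in>T. dist (local_rep c d (hs n) z') (?f z') < e)"
        if z: "z \<in> ?K" for z
      proof -
        obtain x where x: "x \<in> chart_dom c" "h x \<in> chart_dom d" "z = coord c x"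
          using K1 z by (meson rep_domE subsetD)
        \<comment> \<open>Half of \<open>e\<close> is for the distance of the sequence from the
          limit value at \<open>z\<close>, the other half for the variation of the limit near
          \<open>z\<close>.\<close>
        let ?V = "{y \<in> chart_dom d. coord d y \<in> ball (?f z) (e / 2)}"
        have oV: "openin (surf_top N) ?V" by (rule N.openin_coord_vimage[OF cd(2) open_ball])
        have hV: "h x \<in> ?V" using x e cd by simp
        have xM: "x \<in> points M" using x M.chart_dom_subset[OF cd(1)] by blast
        obtain U' where U': "openin (surf_top M) U'" "x \<in> U'" "\<forall>\<^sub>F n in sequentially. hs n ` U' \<subseteq> ?V"
          by (rule continuously_convergentE[OF cc xM oV hV])
        let ?T = "coord c ` (chart_dom c \<inter> U') \<inter> (rep_dom h c d \<inter> ?f -` ball (?f z) (e / 2))"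
        have "open ?T"
          using M.open_coord_image[OF cd(1) U'(1)] continuous_open_preimage[OF fc open_rep_dom[OF cont cd] open_ball]
          by blast
        moreover have "z \<in> ?T" using x U'(2) K1 z e by auto
        moreover have "\<forall>\<^sub>F n in sequentially. \<forall>z'\<in>?T. dist (local_rep c d (hs n) z') (?f z') < e"
          using U'(3)
        proof eventually_elim
          case (elim n)
          show ?case
          proof
            fix z' assume z': "z' \<in> ?T"
            then obtain x' where x': "x' \<in> chart_dom c" "x' \<in> U'" "z' = coord c x'" by blast
            then have "dist (?f z) (local_rep c d (hs n) z') < e / 2"
              using elim cd by auto
            moreover have "dist (?f z) (?f z') < e / 2" using z' by simp
            ultimately show "dist (local_rep c d (hs n) z') (?f z') < e"
              by (metis dist_triangle_half_r)
          qed
        qed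
        ultimately show ?thesis by blast
      qed
      define near where "near T \<longleftrightarrow> (\<forall>\<^sub>F n in sequentially. \<forall>z'\<in>T. dist (local_rep c d (hs n) z') (?f z') < e)" for T
      have "\<forall>z\<in>?K. \<exists>T. open T \<and> z \<in> T \<and> near T" unfolding near_def using loc by blast
      from bchoice[OF this] obtain T where T: "\<forall>z\<in>?K. open (T z) \<and> z \<in> T z \<and> near (T z)" by blast
      have TU: "?K \<subseteq> (\<Union>z\<in>?K. T z)" using T by blast
      have To: "open (T z)" if "z \<in> ?K" for z using T that by blast
      obtain F where F: "F \<subseteq> ?K" "finite F" "?K \<subseteq> (\<Union>z\<in>F. T z)"
        by (rule compactE_image[OF compact_cball To TU])
      have "\<forall>\<^sub>F n in sequentially. \<forall>z\<in>F. \<forall>z'\<in>T z. dist (local_rep c d (hs n) z') (?f z') < e"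
        using F T unfolding near_def by (intro eventually_ball_finite) auto
      then show "\<forall>\<^sub>F n in sequentially. \<forall>z\<in>?K. dist (local_rep c d (hs n) z) (?f z) < e"
        by eventually_elim (use F(3) in blast)
    qed
  qed
qed

text \<open>Weierstrass's theorem on uniform limits, applied to local representatives on small
  discs.\<close>

lemma holomorphic_limit:
  assumes cc: "continuously_convergent hs h" and cont: "continuous_map (surf_top M) (surf_top N) h"
    and hs: "\<And>n. holomorphic_map M N (hs n)"
  shows "holomorphic_map M N h"
  unfolding holomorphic_map_def
proof (intro conjI ballI cont)
  fix c d assume cd: "c \<in> surf_atlas M" "d \<in> surf_atlas N"
  have "local_rep c d h field_differentiable (at z)" if "z \<in> rep_dom h c d" for z
  proof -
    obtain p where p: "p \<in> chart_dom c" "h p \<in> chart_dom d" "z = coord c p" using \<open>z \<in> _\<close> by (rule rep_domE)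
    have pM: "p \<in> points M" using p(1) M.chart_dom_subset[OF cd(1)] by blast
    obtain r where r: "0 < r" "cball z r \<subseteq> rep_dom h c d"
      "\<forall>\<^sub>F n in sequentially. cball z r \<subseteq> rep_dom (hs n) c d"
      "uniform_limit (cball z r) (\<lambda>n. local_rep c d (hs n)) (local_rep c d h) sequentially"
      using uniform_limit_local_rep[OF cc cont cd p(1,2) openin_topspace pM] unfolding p(3) by metis
    have "\<forall>\<^sub>F n in sequentially. continuous_on (cball z r) (local_rep c d (hs n)) \<and>
        local_rep c d (hs n) holomorphic_on ball z r"
      using r(3)
    proof eventually_elim
      case (elim n)
      then have "local_rep c d (hs n) holomorphic_on cball z r"
        using holomorphic_on_subset[OF holomorphic_local_rep[OF hs cd]] by blast
      then show ?case
        using holomorphic_on_imp_continuous_on holomorphic_on_subset ball_subset_cball by blast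
    qed
    then have "local_rep c d h holomorphic_on ball z r"
      using holomorphic_uniform_limit[OF _ r(4) trivial_limit_sequentially] by blast
    then show ?thesis
      using r(1) by (intro holomorphic_on_imp_differentiable_at[of _ "ball z r"]) auto
  qed
  then show "local_rep c d h holomorphic_on coord c ` (chart_dom c \<inter> h -` chart_dom d)"
    by (auto simp: holomorphic_on_def rep_dom_def field_differentiable_at_within)
qed

text \<open>Uniform convergence of holomorphic functions passes to their derivatives, so the
  densities converge at every point; this feeds Fatou's lemma.\<close>

lemma tendsto_energy_density:
  assumes cc: "continuously_convergent hs h" and hol: "holomorphic_map M N h"
    and hs: "\<And>n. holomorphic_map M N (hs n)" and gN: "continuous_metric N gN" and p: "p \<in> points M"
  shows "(\<lambda>n. energy_density gM gN (hs n) p) \<longlonglongrightarrow> energy_density gM gN h p"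
proof -
  have cont: "continuous_map (surf_top M) (surf_top N) h" using hol by (simp add: holomorphic_map_def)
  have hp: "h p \<in> points N" using p cont by (auto simp: continuous_map_def)
  define c d where "c = chart_at M p" and "d = chart_at N (h p)"
  have c: "c \<in> surf_atlas M" "p \<in> chart_dom c" and d: "d \<in> surf_atlas N" "h p \<in> chart_dom d"
    using M.chart_at_atlas[OF p] M.in_chart_dom_chart_at[OF p] N.chart_at_atlas[OF hp] N.in_chart_dom_chart_at[OF hp]
    by (auto simp: c_def d_def)
  let ?z = "coord c p"
  obtain r where r: "0 < r" "cball ?z r \<subseteq> rep_dom h c d"
    "\<forall>\<^sub>F n in sequentially. cball ?z r \<subseteq> rep_dom (hs n) c d"
    "uniform_limit (cball ?z r) (\<lambda>n. local_rep c d (hs n)) (local_rep c d h) sequentially"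
    using uniform_limit_local_rep[OF cc cont c(1) d(1) c(2) d(2) openin_topspace p] by metis
  let ?a = "\<lambda>n. deriv (local_rep c d (hs n)) ?z" and ?b = "deriv (local_rep c d h) ?z"
  have "\<forall>\<^sub>F n in sequentially. local_rep c d (hs n) holomorphic_on ball ?z r"
    using r(3)
  proof eventually_elim
    case (elim n)
    then show ?case
      using holomorphic_on_subset[OF holomorphic_local_rep[OF hs c(1) d(1)]] ball_subset_cball by blast
  qed
  then have a: "?a \<longlonglongrightarrow> ?b"
    using r(1) by (intro deriv_complex_uniform_limit[where A = "ball ?z r"] uniform_limit_on_subset[OF r(4)]) auto
  have z: "?z \<in> cball ?z r" using r(1) by simp
  have w: "(\<lambda>n. coord d (hs n p)) \<longlonglongrightarrow> coord d (h p)"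
    using tendsto_uniform_limitI[OF r(4) z] c by simp
  have inim: "coord d (h p) \<in> chart_im d" using d by simp
  have g: "(\<lambda>n. gN d (coord d (hs n p)) u v) \<longlonglongrightarrow> gN d (coord d (h p)) u v" for u v
  proof -
    have "continuous_on (chart_im d) (\<lambda>w. gN d w u v)" using gN d by (auto simp: continuous_metric_def)
    then have "isCont (\<lambda>w. gN d w u v) (coord d (h p))"
      using N.open_chart_im[OF d(1)] inim continuous_on_eq_continuous_at by blast
    then show ?thesis using w by (rule isCont_tendsto_compose)
  qed
  have mem: "\<forall>\<^sub>F n in sequentially. hs n p \<in> chart_dom d"
    using r(3)
  proof eventually_elim
    case (elim n)
    then have "?z \<in> rep_dom (hs n) c d" using z by blast
    then obtain q where "q \<in> chart_dom c" "hs n q \<in> chart_dom d" "?z = coord c q" by (rule rep_domE)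
    then show ?case using inj_onD[OF M.inj_on_coord[OF c(1)], of p q] c by simp
  qed
  have pb: "(\<lambda>n. pullback M N (hs n) gN c ?z u v) \<longlonglongrightarrow> pullback M N h gN c ?z u v" for u v
  proof -
    \<comment> \<open>Base point and tangent vectors vary with \<open>n\<close> together; the
      expansion in the basis separates them, so continuity of the coefficients suffices.\<close>
    let ?E = "\<lambda>(g :: complex \<Rightarrow> complex \<Rightarrow> real) u v. Re u * Re v * g 1 1 + Re u * Im v * g 1 \<i>
      + Im u * Re v * g \<i> 1 + Im u * Im v * g \<i> \<i>"
    have ex: "gN d w u v = ?E (gN d w) u v" if "w \<in> chart_im d" for w u v
      using bilinear_complex_expand continuous_metric_inner_product[OF gN d(1) that]
      unfolding inner_product_def by blast
    have lim: "pullback M N h gN c ?z u v = ?E (gN d (coord d (h p))) (?b * u) (?b * v)"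
      unfolding pullback_eq[OF hol gN c(1) d(1) c(2) d(2)] by (rule ex[OF inim])
    have ev: "\<forall>\<^sub>F n in sequentially. pullback M N (hs n) gN c ?z u v = ?E (gN d (coord d (hs n p))) (?a n * u) (?a n * v)"
      using mem
    proof eventually_elim
      case (elim n)
      show ?case
        unfolding pullback_eq[OF hs gN c(1) d(1) c(2) elim] by (rule ex) (use elim in simp)
    qed
    have "(\<lambda>n. ?E (gN d (coord d (hs n p))) (?a n * u) (?a n * v)) \<longlonglongrightarrow> pullback M N h gN c ?z u v"
      unfolding lim by (intro tendsto_intros g a)
    then show ?thesis by (rule iffD2[OF tendsto_cong[OF ev]])
  qed
  show ?thesis
    unfolding energy_density_def Let_def c_def[symmetric]
    by (intro tendsto_tensor_norm_sq tendsto_diff pb tendsto_const)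
qed

text \<open>The preimages of \<open>y\<close> under the members of the sequence cluster at some
  \<open>p\<close> by compactness, and continuous convergence at \<open>p\<close> leaves only
  \<open>y\<close> as the value there.\<close>

lemma surjective_limit:
  assumes cc: "continuously_convergent hs h" and K: "compact_space (surf_top M)"
    and hs: "\<And>n. hs n ` points M = points N"
  shows "h ` points M = points N"
proof (rule equalityI; rule subsetI)
  fix y assume "y \<in> h ` points M"
  then show "y \<in> points N" using cc by (auto simp: continuously_convergent_def)
next
  fix y assume y: "y \<in> points N"
  have "\<exists>x. x \<in> points M \<and> hs n x = y" for n using y hs[of n] by (metis imageE)
  then obtain x where x: "\<And>n. x n \<in> points M" "\<And>n. hs n (x n) = y" by metis
  have "\<exists>p\<in>points M. \<forall>U. openin (surf_top M) U \<and> p \<in> U \<longrightarrow> (\<exists>\<^sub>F n in sequentially. x n \<in> U)"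
    by (rule compact_space_cluster_point[OF K x(1)])
  then obtain p where p: "p \<in> points M" "\<And>U. openin (surf_top M) U \<Longrightarrow> p \<in> U \<Longrightarrow> \<exists>\<^sub>F n in sequentially. x n \<in> U"
    by blast
  have hp: "h p \<in> points N" using cc p(1) by (auto simp: continuously_convergent_def)
  have "h p = y"
  proof (rule ccontr)
    assume "h p \<noteq> y"
    then obtain V V' where V: "openin (surf_top N) V" "openin (surf_top N) V'" "h p \<in> V" "y \<in> V'" "disjnt V V'"
      using N.Hausdorff hp y unfolding Hausdorff_space_def by metis
    obtain U where U: "openin (surf_top M) U" "p \<in> U" "\<forall>\<^sub>F n in sequentially. hs n ` U \<subseteq> V"
      using continuously_convergentE[OF cc p(1) V(1,3)] by blast
    have "\<exists>\<^sub>F n in sequentially. x n \<in> U \<and> hs n ` U \<subseteq> V"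
      using frequently_eventually_conj[OF p(2)[OF U(1,2)] U(3)] by (simp add: conj_commute)
    then obtain n where "x n \<in> U" "hs n ` U \<subseteq> V" using frequently_ex by blast
    then show False using x(2)[of n] V(4,5) by (auto simp: disjnt_iff)
  qed
  then show "y \<in> h ` points M" using p(1) by blast
qed

text \<open>Hurwitz's theorem: if the value \<open>h p\<close> were missed near \<open>p\<close>
  infinitely often, a subsequence of zero-free functions would converge locally uniformly to a
  function with a zero. A constant limit is excluded because \<open>h\<close> would then be globally
  constant, while the target has nonempty open chart images.\<close>

lemma eventually_attains_limit:
  assumes cc: "continuously_convergent hs h" and hol: "holomorphic_map M N h"
    and hs: "\<And>n. holomorphic_map M N (hs n)" and surj: "h ` points M = points N"
    and p: "p \<in> points M" and O: "openin (surf_top M) O'" "p \<in> O'"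
  shows "\<forall>\<^sub>F n in sequentially. \<exists>x\<in>O'. hs n x = h p"
proof (rule ccontr)
  assume not: "\<not> ?thesis"
  have cont: "continuous_map (surf_top M) (surf_top N) h" using hol by (simp add: holomorphic_map_def)
  have hp: "h p \<in> points N" using p cont by (auto simp: continuous_map_def)
  define c d where "c = chart_at M p" and "d = chart_at N (h p)"
  have c: "c \<in> surf_atlas M" "p \<in> chart_dom c" and d: "d \<in> surf_atlas N" "h p \<in> chart_dom d"
    using M.chart_at_atlas[OF p] M.in_chart_dom_chart_at[OF p] N.chart_at_atlas[OF hp] N.in_chart_dom_chart_at[OF hp]
    by (auto simp: c_def d_def)
  let ?z = "coord c p"
  obtain r where r: "0 < r" "cball ?z r \<subseteq> rep_dom h c d" "chart_inv c ` cball ?z r \<subseteq> O'"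
    "\<forall>\<^sub>F n in sequentially. cball ?z r \<subseteq> rep_dom (hs n) c d"
    "uniform_limit (cball ?z r) (\<lambda>n. local_rep c d (hs n)) (local_rep c d h) sequentially"
    using uniform_limit_local_rep[OF cc cont c(1) d(1) c(2) d(2) O] by metis
  let ?A = "{n. (\<forall>x\<in>O'. hs n x \<noteq> h p) \<and> cball ?z r \<subseteq> rep_dom (hs n) c d}"
  have "\<exists>\<^sub>F n in sequentially. \<forall>x\<in>O'. hs n x \<noteq> h p" using not by (simp add: not_eventually)
  then have "\<exists>\<^sub>F n in sequentially. n \<in> ?A"
    using frequently_eventually_conj[OF _ r(4)] by (simp add: conj_commute)
  then have inf: "infinite ?A"
    by (simp add: cofinite_eq_sequentially[symmetric] frequently_cofinite)
  define s where "s = enumerate ?A"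
  have s: "strict_mono s" "\<And>n. s n \<in> ?A"
    unfolding s_def using strict_mono_enumerate[OF inf] enumerate_in_set[OF inf] by auto
  let ?F = "\<lambda>n z. local_rep c d (hs (s n)) z - coord d (h p)" and ?g = "\<lambda>z. local_rep c d h z - coord d (h p)"
  have bsub: "ball ?z r \<subseteq> rep_dom h c d" using r(2) ball_subset_cball by blast
  have bim: "ball ?z r \<subseteq> chart_im c" using bsub by (auto simp: rep_dom_def chart_im_def)
  have "?g ?z \<noteq> 0"
  proof (rule Hurwitz_no_zeros[of "ball ?z r" ?F ?g])
    show "?F n holomorphic_on ball ?z r" for n
    proof -
      have "ball ?z r \<subseteq> rep_dom (hs (s n)) c d" using s(2)[of n] ball_subset_cball by blast
      then show ?thesis
        by (intro holomorphic_intros holomorphic_on_subset[OF holomorphic_local_rep[OF hs c(1) d(1)]])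
    qed
    show "?g holomorphic_on ball ?z r"
      by (intro holomorphic_intros holomorphic_on_subset[OF holomorphic_local_rep[OF hol c(1) d(1)] bsub])
    show "uniform_limit K ?F ?g sequentially" if "compact K" "K \<subseteq> ball ?z r" for K
    proof -
      have "uniform_limit K (\<lambda>n. local_rep c d (hs n)) (local_rep c d h) sequentially"
        using that(2) ball_subset_cball by (intro uniform_limit_on_subset[OF r(5)]) blast
      then have "uniform_limit K (\<lambda>n. local_rep c d (hs (s n))) (local_rep c d h) sequentially"
        unfolding uniform_limit_iff using eventually_subseq[OF s(1)] by fast
      then show ?thesis by (intro uniform_limit_intros)
    qed
    show "\<not> ?g constant_on ball ?z r"
    proof
      assume "?g constant_on ball ?z r"
      then obtain k where k: "\<And>z. z \<in> ball ?z r \<Longrightarrow> ?g z = k" by (auto simp: constant_on_def)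
      have k0: "k = 0" using k[of ?z] r(1) c by simp
      have const: "h x = h p" if x: "x \<in> chart_inv c ` ball ?z r" for x
      proof -
        obtain z where z: "z \<in> ball ?z r" "x = chart_inv c z" using x by blast
        obtain q where q: "q \<in> chart_dom c" "h q \<in> chart_dom d" "z = coord c q"
          using bsub z(1) by (meson rep_domE subsetD)
        then have "coord d (h q) = coord d (h p)" using k[OF z(1)] k0 c by simp
        then have "h q = h p" using inj_onD[OF N.inj_on_coord[OF d(1)]] q d by blast
        then show ?thesis using z q c by simp
      qed
      have U1: "openin (surf_top M) (chart_inv c ` ball ?z r)"
        by (rule M.openin_chart_inv_image[OF c(1) open_ball bim])
      have U2: "chart_inv c ` ball ?z r \<noteq> {}" using r(1) by auto
      have "h x = h p" if "x \<in> points M" for x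
        by (rule holomorphic_map_constant[OF hol U1 U2 const that])
      then have "points N \<subseteq> {h p}" using surj by auto
      then have "chart_im d \<subseteq> {coord d (h p)}" using N.chart_dom_subset[OF d(1)] by (auto simp: chart_im_def)
      then have "chart_im d = {coord d (h p)}" using d(2) by (auto simp: chart_im_def)
      then show False using N.open_chart_im[OF d(1)] not_open_singleton by metis
    qed
    show "?F n z \<noteq> 0" if z: "z \<in> ball ?z r" for n z
    proof
      assume "?F n z = 0"
      have "z \<in> rep_dom (hs (s n)) c d" using s(2)[of n] z ball_subset_cball by blast
      then obtain q where q: "q \<in> chart_dom c" "hs (s n) q \<in> chart_dom d" "z = coord c q" by (rule rep_domE)
      then have "coord d (hs (s n) q) = coord d (h p)" using \<open>?F n z = 0\<close> c by simp
      then have "hs (s n) q = h p" using inj_onD[OF N.inj_on_coord[OF d(1)]] q d by blast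
      moreover have "q \<in> O'"
      proof -
        have "q = chart_inv c z" using q c by simp
        moreover have "z \<in> cball ?z r" using z by simp
        ultimately show ?thesis using r(3) by blast
      qed
      ultimately show False using s(2)[of n] by blast
    qed
  qed (use r(1) in auto)
  then show False using c by simp
qed

text \<open>For injectivity: if two distinct points had the same value under \<open>h\<close>, the
  injective maps of the sequence would eventually take this value in each of two disjoint
  neighbourhoods.\<close>

lemma limit_in_HD:
  assumes cc: "continuously_convergent hs h" and hs: "\<And>n. hs n \<in> HD M N"
    and K: "compact_space (surf_top M)" "compact_space (surf_top N)"
  shows "h \<in> HD M N"
proof (rule compact_holomorphic_bij_imp_HD[OF K(1)])
  have hol: "holomorphic_map M N h"
    by (rule holomorphic_limit[OF cc continuous_limit[OF cc K(2)] HD_D(1)[OF hs]])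
  then show "holomorphic_map M N h" .
  have surj: "h ` points M = points N" by (rule surjective_limit[OF cc K(1) HD_D(4)[OF hs]])
  moreover have "inj_on h (points M)"
  proof (rule inj_onI, rule ccontr)
    fix p q assume pq: "p \<in> points M" "q \<in> points M" "h p = h q" "p \<noteq> q"
    then obtain U V where UV: "openin (surf_top M) U" "openin (surf_top M) V" "p \<in> U" "q \<in> V" "disjnt U V"
      using M.Hausdorff unfolding Hausdorff_space_def by metis
    note hits = eventually_attains_limit[OF cc hol HD_D(1)[OF hs] surj]
    have "\<forall>\<^sub>F n in sequentially. (\<exists>x\<in>U. hs n x = h p) \<and> (\<exists>x\<in>V. hs n x = h q)"
      using hits[OF pq(1) UV(1,3)] hits[OF pq(2) UV(2,4)] by (rule eventually_conj)
    then obtain n x y where "x \<in> U" "y \<in> V" "hs n x = h p" "hs n y = h q"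
      using eventually_happens' trivial_limit_sequentially by blast
    moreover from this have "x = y"
      using inj_onD[OF HD_D(3)[OF hs[of n]], of x y] pq(3) UV(1,2) openin_subset by (metis subsetD)
    ultimately show False using UV(5) by (auto simp: disjnt_iff)
  qed
  ultimately show "bij_betw h (points M) (points N)" by (simp add: bij_betw_def)
qed

lemma deformation_energy_limit_le:
  assumes cc: "continuously_convergent hs h" and hs: "\<And>n. hs n \<in> HD M N" and h: "h \<in> HD M N"
    and gM: "continuous_metric M gM" and gN: "continuous_metric N gN" and K: "compact_space (surf_top M)"
    and E: "\<And>n. deformation_energy M gM N gN (hs n) \<noteq> 0"
      "(\<lambda>n. deformation_energy M gM N gN (hs n)) \<longlonglongrightarrow> I"
  shows "deformation_energy M gM N gN h \<le> I"
proof -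
  let ?\<mu> = "volume_measure M gM" and ?\<phi> = "\<lambda>h p. ennreal (energy_density gM gN h p)"
  have sp: "space ?\<mu> = points M"
    using M.is_volume_volume_measure[OF K gM] by (simp add: is_volume_def)
  have I0: "0 \<le> I" by (rule LIMSEQ_le_const[OF E(2)]) (simp add: deformation_energy_nonneg)
  have "(\<integral>\<^sup>+p. ?\<phi> h p \<partial>?\<mu>) = (\<integral>\<^sup>+p. liminf (\<lambda>n. ?\<phi> (hs n) p) \<partial>?\<mu>)"
  proof (rule nn_integral_cong)
    fix p assume "p \<in> space ?\<mu>"
    then have "(\<lambda>n. ?\<phi> (hs n) p) \<longlonglongrightarrow> ?\<phi> h p"
      using tendsto_energy_density[OF cc HD_D(1)[OF h] HD_D(1)[OF hs] gN] sp by (intro tendsto_ennrealI) simp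
    then show "?\<phi> h p = liminf (\<lambda>n. ?\<phi> (hs n) p)"
      by (simp add: lim_imp_Liminf)
  qed
  also have "\<dots> \<le> liminf (\<lambda>n. \<integral>\<^sup>+p. ?\<phi> (hs n) p \<partial>?\<mu>)"
    using energy_density_integral(1)[OF E(1)] by (intro nn_integral_liminf) simp
  also have "\<dots> = liminf (\<lambda>n. ennreal (deformation_energy M gM N gN (hs n)))"
    by (simp add: energy_density_integral(2)[OF E(1)])
  also have "\<dots> = ennreal I"
    using E(2) by (intro lim_imp_Liminf tendsto_ennrealI) auto
  finally have le: "(\<integral>\<^sup>+p. ?\<phi> h p \<partial>?\<mu>) \<le> ennreal I" .
  show ?thesis
  \<comment> \<open>If the energy of \<open>h\<close> is 0 the claim reads \<open>0 \<le> I\<close>,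
    whether or not the density is integrable; otherwise the energy is the nonnegative integral just
    bounded.\<close>
  proof (cases "deformation_energy M gM N gN h = 0")
    case False
    then show ?thesis using le I0 by (simp add: energy_density_integral(2))
  qed (simp add: I0)
qed

text \<open>A map of energy 0 is a minimizer whatever the cause of the 0. If there is none, every
  energy along a minimizing sequence is a genuine integral and the compactness argument
  applies.\<close>

theorem energy_minimizer_exists:
  assumes K: "compact_space (surf_top M)" "compact_space (surf_top N)"
    and gM: "continuous_metric M gM" and gN: "continuous_metric N gN" and ne: "HD M N \<noteq> {}"
  shows "\<exists>h. energy_minimizer M gM N gN h"
proof (cases "\<exists>h\<in>HD M N. deformation_energy M gM N gN h = 0")
  case True
  then show ?thesis using deformation_energy_nonneg unfolding energy_minimizer_def by metis
next
  case False
  let ?\<Phi> = "deformation_energy M gM N gN"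
  define I where "I = Inf (?\<Phi> ` HD M N)"
  have bb: "bdd_below (?\<Phi> ` HD M N)" by (rule bdd_belowI2[of _ 0]) (rule deformation_energy_nonneg)
  have lower: "I \<le> ?\<Phi> h" if "h \<in> HD M N" for h unfolding I_def using bb that by (intro cInf_lower) auto
  have "\<exists>h\<in>HD M N. ?\<Phi> h < I + 1 / real (Suc n)" for n
    using cInf_lessD[of "?\<Phi> ` HD M N" "I + 1 / real (Suc n)"] ne unfolding I_def[symmetric] by auto
  then obtain hs where hs: "\<And>n. hs n \<in> HD M N" "\<And>n. ?\<Phi> (hs n) < I + 1 / real (Suc n)" by metis
  have nz: "?\<Phi> (hs n) \<noteq> 0" for n using False hs(1) by blast
  have bound: "?\<Phi> (hs n) \<le> I + 1" for n
  proof -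
    have "1 / real (Suc n) \<le> 1" by simp
    then show ?thesis using hs(2)[of n] by linarith
  qed
  have lim: "(\<lambda>n. ?\<Phi> (hs n)) \<longlonglongrightarrow> I"
  proof (rule tendsto_sandwich)
    show "\<forall>\<^sub>F n in sequentially. I \<le> ?\<Phi> (hs n)" using lower hs(1) by simp
    show "\<forall>\<^sub>F n in sequentially. ?\<Phi> (hs n) \<le> I + 1 / real (Suc n)" using hs(2) by (simp add: less_imp_le)
    show "(\<lambda>n. I + 1 / real (Suc n)) \<longlonglongrightarrow> I"
      using tendsto_add[OF tendsto_const LIMSEQ_inverse_real_of_nat, of I] by (simp add: inverse_eq_divide)
  qed simp
  obtain r h where r: "strict_mono (r :: nat \<Rightarrow> nat)" and h: "\<And>p. p \<in> points M \<Longrightarrow> h p \<in> points N"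
    "\<And>p V. p \<in> points M \<Longrightarrow> openin (surf_top N) V \<Longrightarrow> h p \<in> V \<Longrightarrow>
      \<exists>U. openin (surf_top M) U \<and> p \<in> U \<and> (\<forall>\<^sub>F n in sequentially. hs (r n) ` U \<subseteq> V)"
  proof (rule continuously_convergent_subsequence[OF M.second_countable N.second_countable K(2), of hs])
    show "hs n p \<in> points N" if "p \<in> points M" for n p using HD_D(4)[OF hs(1)[of n]] that by blast
    fix p q V assume p: "p \<in> points M" and V: "openin (surf_top N) V" "q \<in> V"
    show "\<exists>U W. openin (surf_top M) U \<and> p \<in> U \<and> openin (surf_top N) W \<and> q \<in> W \<and>
        (\<forall>n. hs n p \<in> W \<longrightarrow> hs n ` U \<subseteq> V)"
    proof (rule even_continuity[where E = "I + 1", OF K(1) gM gN p V])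
      fix U W assume UW: "openin (surf_top M) U" "p \<in> U" "openin (surf_top N) W" "q \<in> W"
        and into: "\<And>h. h \<in> HD M N \<Longrightarrow> ?\<Phi> h \<noteq> 0 \<Longrightarrow> ?\<Phi> h \<le> I + 1 \<Longrightarrow> h p \<in> W \<Longrightarrow> h ` U \<subseteq> V"
      have "\<forall>n. hs n p \<in> W \<longrightarrow> hs n ` U \<subseteq> V" using into[OF hs(1) nz bound] by blast
      then show ?thesis using UW by blast
    qed
  qed blast
  have cc: "continuously_convergent (\<lambda>n. hs (r n)) h"
    using h unfolding continuously_convergent_def by blast
  have hHD: "h \<in> HD M N" by (rule limit_in_HD[OF cc hs(1) K])
  have "?\<Phi> h \<le> I"
    using deformation_energy_limit_le[OF cc hs(1) hHD gM gN K(1) nz] LIMSEQ_subseq_LIMSEQ[OF lim r]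
    by (simp add: comp_def)
  then show ?thesis using hHD lower unfolding energy_minimizer_def by force
qed

end

section \<open>Round spheres\<close>

text \<open>The two charts of the sphere differ by a rotation that exchanges the poles, which is why the
  second coordinate \<open>1 / stereo y\<close> is again a stereographic projection.\<close>

definition pole_sign :: "bool \<Rightarrow> real" where
  "pole_sign b = (if b then 1 else - 1)"

text \<open>Inverse stereographic projection from the pole whose third coordinate is
  \<open>pole_sign b\<close>. Without the sign in the second component the two charts would differ
  by the conjugate of \<open>1 / z\<close>.\<close>

definition sphere_param :: "bool \<Rightarrow> complex \<Rightarrow> real^3" where
  "sphere_param b z = (2 * Re z / (1 + (Re z)\<^sup>2 + (Im z)\<^sup>2)) *\<^sub>R axis 1 1
     + (pole_sign b * (2 * Im z / (1 + (Re z)\<^sup>2 + (Im z)\<^sup>2))) *\<^sub>R axis 2 1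
     + (pole_sign b * (1 - 2 / (1 + (Re z)\<^sup>2 + (Im z)\<^sup>2))) *\<^sub>R axis 3 1"

definition sphere_coord :: "bool \<Rightarrow> real^3 \<Rightarrow> complex" where
  "sphere_coord b y = Complex (y $ 1) (pole_sign b * y $ 2) / of_real (1 - pole_sign b * y $ 3)"

definition sphere_chart :: "real \<Rightarrow> bool \<Rightarrow> (real^3) chart" where
  "sphere_chart R b = (if b
     then (radial R ` sphere 0 1 - {radial R (axis 3 1)}, \<lambda>y. stereo (y /\<^sub>R R))
     else (radial R ` sphere 0 1 - {radial R (- axis 3 1)},
       \<lambda>y. if y = radial R (axis 3 1) then 0 else 1 / stereo (y /\<^sub>R R)))"

lemma surf_atlas_round_sphere: "surf_atlas (round_sphere R) = range (sphere_chart R)"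
  and surf_top_round_sphere: "surf_top (round_sphere R) = top_of_set (radial R ` sphere 0 1)"
  by (auto simp: round_sphere_def Let_def sphere_chart_def UNIV_bool)

lemma points_round_sphere: "points (round_sphere R) = radial R ` sphere 0 1"
  by (simp add: surf_top_round_sphere)

lemma pole_sign_sq [simp]: "pole_sign b * pole_sign b = 1" "(pole_sign b)\<^sup>2 = 1"
  by (auto simp: pole_sign_def)

lemma pole_sign_mult_eq: "pole_sign b * x = y \<longleftrightarrow> x = pole_sign b * y"
  by (auto simp: pole_sign_def)

lemma unit_vec3_iff: "norm (y :: real^3) = 1 \<longleftrightarrow> (y $ 1)\<^sup>2 + (y $ 2)\<^sup>2 + (y $ 3)\<^sup>2 = 1"
  by (simp add: norm_eq_1 inner_vec_def sum_3 power2_eq_square)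

lemma sphere_param_nth [simp]:
  "sphere_param b z $ 1 = 2 * Re z / (1 + (Re z)\<^sup>2 + (Im z)\<^sup>2)"
  "sphere_param b z $ 2 = pole_sign b * (2 * Im z / (1 + (Re z)\<^sup>2 + (Im z)\<^sup>2))"
  "sphere_param b z $ 3 = pole_sign b * (1 - 2 / (1 + (Re z)\<^sup>2 + (Im z)\<^sup>2))"
  by (simp_all add: sphere_param_def axis_def)

lemma one_plus_sq_pos: "0 < 1 + (Re z)\<^sup>2 + (Im z)\<^sup>2"
  by (smt (verit) zero_le_power2)

lemma norm_sphere_param: "norm (sphere_param b z) = 1"
proof -
  define q where "q = 1 + (Re z)\<^sup>2 + (Im z)\<^sup>2"
  have q: "q \<noteq> 0" using one_plus_sq_pos[of z] by (simp add: q_def)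
  have "(2 * Re z / q)\<^sup>2 + (2 * Im z / q)\<^sup>2 + (1 - 2 / q)\<^sup>2 = 1 + 4 * ((Re z)\<^sup>2 + (Im z)\<^sup>2 + 1 - q) / q\<^sup>2"
    using q by (simp add: power_divide power2_diff add_divide_distrib diff_divide_distrib power2_eq_square)
      (simp add: field_simps)
  then have "(2 * Re z / q)\<^sup>2 + (2 * Im z / q)\<^sup>2 + (1 - 2 / q)\<^sup>2 = 1" by (simp add: q_def)
  then show ?thesis
    unfolding unit_vec3_iff sphere_param_nth q_def[symmetric] power_mult_distrib[of "pole_sign b"]
      pole_sign_sq mult_1_left .
qed

lemma sphere_coord_param: "sphere_coord b (sphere_param b z) = z"
proof -
  define q where "q = 1 + (Re z)\<^sup>2 + (Im z)\<^sup>2"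
  have q: "q \<noteq> 0" using one_plus_sq_pos[of z] by (simp add: q_def)
  have "sphere_coord b (sphere_param b z) = Complex (2 * Re z / q) (2 * Im z / q) / of_real (2 / q)"
    by (simp add: sphere_coord_def q_def[symmetric] mult.assoc[symmetric])
  also have "\<dots> = z" using q by (simp add: complex_eq_iff)
  finally show ?thesis .
qed

lemma sphere_param_nth3_neq: "pole_sign b * sphere_param b z $ 3 \<noteq> 1"
  using one_plus_sq_pos[of z] by (simp add: mult.assoc[symmetric])

lemma sphere_param_coord:
  fixes y :: "real^3"
  assumes y: "norm y = 1" "pole_sign b * y $ 3 \<noteq> 1"
  shows "sphere_param b (sphere_coord b y) = y"
proof -
  \<comment> \<open>On the unit sphere y1^2 + y2^2 = t (2 - t), hence 1 + |z|^2 = 2 / t, which is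
    the denominator in \<open>sphere_param\<close>.\<close>
  define t where "t = 1 - pole_sign b * y $ 3"
  have t: "t \<noteq> 0" using y by (simp add: t_def)
  have y3: "y $ 3 = pole_sign b * (1 - t)" by (simp add: t_def mult.assoc[symmetric])
  have "(y $ 1)\<^sup>2 + (y $ 2)\<^sup>2 + (1 - t)\<^sup>2 = 1" using y(1) by (simp add: unit_vec3_iff y3 power_mult_distrib)
  then have s: "(y $ 1)\<^sup>2 + (y $ 2)\<^sup>2 = 2 * t - t\<^sup>2" by (simp add: power2_diff)
  have re: "Re (sphere_coord b y) = y $ 1 / t" and im: "Im (sphere_coord b y) = pole_sign b * y $ 2 / t"
    by (simp_all add: sphere_coord_def t_def[symmetric])
  have "1 + (Re (sphere_coord b y))\<^sup>2 + (Im (sphere_coord b y))\<^sup>2 = (t\<^sup>2 + ((y $ 1)\<^sup>2 + (y $ 2)\<^sup>2)) / t\<^sup>2"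
    unfolding re im using t by (simp add: power_divide power_mult_distrib add_divide_distrib)
  also have "\<dots> = 2 / t" unfolding s using t by (simp add: power2_eq_square)
  finally have q: "1 + (Re (sphere_coord b y))\<^sup>2 + (Im (sphere_coord b y))\<^sup>2 = 2 / t" .
  have "sphere_param b (sphere_coord b y) $ 1 = y $ 1" "sphere_param b (sphere_coord b y) $ 2 = y $ 2"
    "sphere_param b (sphere_coord b y) $ 3 = y $ 3"
    unfolding sphere_param_nth q unfolding re im using t y3 by (simp_all add: mult.assoc[symmetric])
  then show ?thesis by (simp add: vec_eq_iff forall_3)
qed

lemma unit_vec3_nth3_eq:
  fixes y :: "real^3"
  assumes "norm y = 1"
  shows "pole_sign b * y $ 3 = 1 \<longleftrightarrow> y = pole_sign b *\<^sub>R axis 3 1"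
proof
  assume "pole_sign b * y $ 3 = 1"
  then have y3: "y $ 3 = pole_sign b" by (simp add: pole_sign_mult_eq)
  then have "(y $ 1)\<^sup>2 + (y $ 2)\<^sup>2 = 0" using assms by (simp add: unit_vec3_iff)
  then have "y $ 1 = 0" "y $ 2 = 0" by (simp_all add: sum_power2_eq_zero_iff)
  then show "y = pole_sign b *\<^sub>R axis 3 1" using y3 by (simp add: vec_eq_iff forall_3 axis_def)
qed (simp add: axis_def)

text \<open>The numerators are conjugate, with product y1^2 + y2^2 = 1 - y3^2, and this is the
  product of the denominators.\<close>

lemma sphere_coord_other:
  fixes y :: "real^3"
  assumes y: "norm y = 1" "y $ 3 \<noteq> 1" "y $ 3 \<noteq> - 1"
  shows "sphere_coord (\<not> b) y = 1 / sphere_coord b y" "sphere_coord b y \<noteq> 0"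
proof -
  let ?s = "pole_sign b"
  have ps: "pole_sign (\<not> b) = - ?s" by (auto simp: pole_sign_def)
  have t: "1 - ?s * y $ 3 \<noteq> 0" "1 + ?s * y $ 3 \<noteq> 0" using y by (auto simp: pole_sign_def)
  have "(y $ 1)\<^sup>2 + (y $ 2)\<^sup>2 = 1 - (y $ 3)\<^sup>2" using y(1) by (simp add: unit_vec3_iff)
  also have "\<dots> = (1 - ?s * y $ 3) * (1 + ?s * y $ 3)"
    by (auto simp: pole_sign_def power2_eq_square algebra_simps)
  finally have eq: "(y $ 1)\<^sup>2 + (y $ 2)\<^sup>2 = (1 - ?s * y $ 3) * (1 + ?s * y $ 3)" .
  have "Complex (y $ 1) (?s * y $ 2) * Complex (y $ 1) (- (?s * y $ 2)) = of_real ((y $ 1)\<^sup>2 + (y $ 2)\<^sup>2)"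
    by (auto simp: complex_eq_iff power2_eq_square pole_sign_def)
  then have p: "sphere_coord b y * sphere_coord (\<not> b) y = 1"
  proof -
    assume *: "Complex (y $ 1) (?s * y $ 2) * Complex (y $ 1) (- (?s * y $ 2)) = of_real ((y $ 1)\<^sup>2 + (y $ 2)\<^sup>2)"
    have "sphere_coord (\<not> b) y = Complex (y $ 1) (- (?s * y $ 2)) / of_real (1 + ?s * y $ 3)"
      by (simp add: sphere_coord_def ps)
    then have "sphere_coord b y * sphere_coord (\<not> b) y
      = of_real ((1 - ?s * y $ 3) * (1 + ?s * y $ 3)) / of_real ((1 - ?s * y $ 3) * (1 + ?s * y $ 3))"
      by (simp only: sphere_coord_def times_divide_times_eq * eq of_real_mult)
    also have "\<dots> = 1" using t by (intro divide_self) (simp only: of_real_eq_0_iff mult_eq_0_iff de_Morgan_disj simp_thms)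
    finally show ?thesis .
  qed
  then show "sphere_coord b y \<noteq> 0" by auto
  then show "sphere_coord (\<not> b) y = 1 / sphere_coord b y" using p by (simp add: field_simps)
qed

lemma stereo_eq: "stereo y = sphere_coord True y"
  by (simp add: stereo_def sphere_coord_def pole_sign_def)

context
  fixes R :: real
  assumes R: "0 < R"
begin

lemma eq_radial_iff: "y = radial R v \<longleftrightarrow> y /\<^sub>R R = v"
  using R by (auto simp: radial_def)

lemma radial_image_eq: "radial R ` sphere 0 1 = {y. norm (y /\<^sub>R R) = 1}"
proof (intro equalityI subsetI)
  fix y assume "y \<in> {y :: real^3. norm (y /\<^sub>R R) = 1}"
  then show "y \<in> radial R ` sphere 0 1"
    using R by (intro image_eqI[of _ _ "y /\<^sub>R R"]) (auto simp: radial_def)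
qed (use R in \<open>auto simp: radial_def\<close>)

lemma sphere_chart_dom:
  "chart_dom (sphere_chart R b) = {y. norm (y /\<^sub>R R) = 1 \<and> pole_sign b * (y /\<^sub>R R) $ 3 \<noteq> 1}"
proof -
  have "radial R ` sphere 0 1 - {radial R (pole_sign b *\<^sub>R axis 3 1)}
    = {y. norm (y /\<^sub>R R) = 1 \<and> pole_sign b * (y /\<^sub>R R) $ 3 \<noteq> 1}"
    unfolding radial_image_eq using unit_vec3_nth3_eq eq_radial_iff by blast
  then show ?thesis by (cases b) (simp_all add: sphere_chart_def pole_sign_def)
qed

text \<open>Removes the case distinction at the pole: \<open>sphere_coord False\<close> is a single
  formula that takes the value 0 there.\<close>

lemma sphere_chart_coord:
  assumes y: "y \<in> chart_dom (sphere_chart R b)"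
  shows "coord (sphere_chart R b) y = sphere_coord b (y /\<^sub>R R)"
proof (cases b)
  case True
  then show ?thesis by (simp add: sphere_chart_def stereo_eq)
next
  case False
  have n: "norm (y /\<^sub>R R) = 1" and y3: "(y /\<^sub>R R) $ 3 \<noteq> - 1"
    using y False by (auto simp: sphere_chart_dom pole_sign_def)
  show ?thesis
  proof (cases "y = radial R (axis 3 1)")
    case True
    then have "y /\<^sub>R R = axis 3 1" using R by (simp add: radial_def)
    then show ?thesis using True False by (simp add: sphere_chart_def sphere_coord_def pole_sign_def axis_def complex_eq_iff)
  next
    case nt: False
    then have "y /\<^sub>R R \<noteq> pole_sign True *\<^sub>R axis 3 1" using eq_radial_iff by (simp add: pole_sign_def)
    then have "(y /\<^sub>R R) $ 3 \<noteq> 1" using unit_vec3_nth3_eq[OF n, of True] by (simp add: pole_sign_def)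
    then show ?thesis using sphere_coord_other(1)[OF n _ y3, of True] nt False
      by (simp add: sphere_chart_def stereo_eq)
  qed
qed

lemma radial_param_in_dom: "R *\<^sub>R sphere_param b z \<in> chart_dom (sphere_chart R b)"
proof -
  have "(R *\<^sub>R sphere_param b z) /\<^sub>R R = sphere_param b z" using R by simp
  then show ?thesis
    unfolding sphere_chart_dom mem_Collect_eq
    using sphere_param_nth3_neq[of b z] norm_sphere_param[of b z] by (simp only:) simp
qed

lemma coord_radial_param: "coord (sphere_chart R b) (R *\<^sub>R sphere_param b z) = z"
  using R by (simp add: sphere_chart_coord[OF radial_param_in_dom] sphere_coord_param)

lemma radial_param_coord:
  assumes y: "y \<in> chart_dom (sphere_chart R b)"
  shows "R *\<^sub>R sphere_param b (coord (sphere_chart R b) y) = y"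
proof -
  have "sphere_param b (sphere_coord b (y /\<^sub>R R)) = y /\<^sub>R R"
    by (rule sphere_param_coord) (use y in \<open>auto simp: sphere_chart_dom\<close>)
  then show ?thesis using R by (simp add: sphere_chart_coord[OF y])
qed

lemma sphere_chart_im: "chart_im (sphere_chart R b) = UNIV"
  unfolding chart_im_def using coord_radial_param radial_param_in_dom by (metis UNIV_eq_I image_eqI)

lemma sphere_inj_on_coord: "inj_on (coord (sphere_chart R b)) (chart_dom (sphere_chart R b))"
  using radial_param_coord by (rule inj_on_inverseI)

lemma sphere_chart_inv: "chart_inv (sphere_chart R b) z = R *\<^sub>R sphere_param b z"
  unfolding chart_inv_def
  using inv_into_f_f[OF sphere_inj_on_coord radial_param_in_dom] coord_radial_param by metis

lemma continuous_on_sphere_coord: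
  "continuous_on {y. pole_sign b * y $ 3 \<noteq> 1} (sphere_coord b)"
  unfolding sphere_coord_def Complex_eq
  by (intro continuous_intros) (auto simp: complex_eq_iff)

lemma continuous_on_sphere_param: "continuous_on UNIV (sphere_param b)"
  unfolding sphere_param_def using one_plus_sq_pos by (intro continuous_intros) (metis less_irrefl)+

lemma sphere_homeomorphic_coord:
  "homeomorphic_map (subtopology (surf_top (round_sphere R)) (chart_dom (sphere_chart R b)))
     (top_of_set (chart_im (sphere_chart R b))) (coord (sphere_chart R b))"
proof -
  let ?D = "chart_dom (sphere_chart R b)"
  have sub: "?D \<subseteq> radial R ` sphere 0 1" unfolding radial_image_eq sphere_chart_dom by blast
  then have top: "subtopology (surf_top (round_sphere R)) ?D = top_of_set ?D"
    by (simp add: surf_top_round_sphere subtopology_subtopology inf_absorb2)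
  have "homeomorphic_maps (top_of_set ?D) (top_of_set UNIV) (coord (sphere_chart R b)) (\<lambda>z. R *\<^sub>R sphere_param b z)"
    unfolding homeomorphic_maps_def
  proof (intro conjI)
    have "continuous_on ?D (\<lambda>y. sphere_coord b (y /\<^sub>R R))"
      by (rule continuous_on_compose2[OF continuous_on_sphere_coord])
        (auto intro!: continuous_intros simp: sphere_chart_dom)
    then have "continuous_on ?D (coord (sphere_chart R b))"
      using sphere_chart_coord by (metis (no_types, lifting) continuous_on_cong)
    then show "continuous_map (top_of_set ?D) (top_of_set UNIV) (coord (sphere_chart R b))" by simp
    have "continuous_on UNIV (\<lambda>z. R *\<^sub>R sphere_param b z)"
      by (intro continuous_intros continuous_on_sphere_param)
    then show "continuous_map (top_of_set UNIV) (top_of_set ?D) (\<lambda>z. R *\<^sub>R sphere_param b z)"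
      using radial_param_in_dom by (auto simp: continuous_map_in_subtopology)
  qed (auto simp: coord_radial_param radial_param_coord)
  then show ?thesis unfolding top sphere_chart_im by (rule homeomorphic_maps_imp_map)
qed

lemma sphere_overlap:
  assumes "y \<in> chart_dom (sphere_chart R b)" "y \<in> chart_dom (sphere_chart R b')" "b \<noteq> b'"
  shows "coord (sphere_chart R b') y = 1 / coord (sphere_chart R b) y" "coord (sphere_chart R b) y \<noteq> 0"
proof -
  have b': "b' = (\<not> b)" using assms(3) by auto
  have n: "norm (y /\<^sub>R R) = 1" "(y /\<^sub>R R) $ 3 \<noteq> 1" "(y /\<^sub>R R) $ 3 \<noteq> - 1"
    using assms by (cases b; cases b'; auto simp: sphere_chart_dom pole_sign_def)+
  show "coord (sphere_chart R b') y = 1 / coord (sphere_chart R b) y"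
    unfolding sphere_chart_coord[OF assms(1)] sphere_chart_coord[OF assms(2)] unfolding b'
    by (rule sphere_coord_other(1)[OF n])
  show "coord (sphere_chart R b) y \<noteq> 0"
    unfolding sphere_chart_coord[OF assms(1)] by (rule sphere_coord_other(2)[OF n])
qed

lemma sphere_transition:
  assumes "z \<in> coord (sphere_chart R b) ` (chart_dom (sphere_chart R b) \<inter> chart_dom (sphere_chart R b'))"
  shows "(coord (sphere_chart R b') \<circ> chart_inv (sphere_chart R b)) z = (if b = b' then z else 1 / z)"
    "b \<noteq> b' \<Longrightarrow> z \<noteq> 0"
proof -
  obtain y where y: "y \<in> chart_dom (sphere_chart R b)" "y \<in> chart_dom (sphere_chart R b')"
    "z = coord (sphere_chart R b) y" using assms by blast
  have "chart_inv (sphere_chart R b) z = y" unfolding sphere_chart_inv y(3) by (rule radial_param_coord[OF y(1)])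
  then show "(coord (sphere_chart R b') \<circ> chart_inv (sphere_chart R b)) z = (if b = b' then z else 1 / z)"
    using sphere_overlap(1)[OF y(1,2)] y(3) by simp
  show "z \<noteq> 0" if "b \<noteq> b'" using sphere_overlap(2)[OF y(1,2) that] y(3) by simp
qed

lemma openin_sphere_chart_dom: "openin (surf_top (round_sphere R)) (chart_dom (sphere_chart R b))"
proof -
  have "open {y. pole_sign b * ((y :: real^3) /\<^sub>R R) $ 3 \<noteq> 1}"
    by (intro open_Collect_neq continuous_intros)
  then have "openin (top_of_set (radial R ` sphere 0 1))
      (radial R ` sphere 0 1 \<inter> {y. pole_sign b * (y /\<^sub>R R) $ 3 \<noteq> 1})"
    by (simp add: openin_open_Int)
  moreover have "radial R ` sphere 0 1 \<inter> {y. pole_sign b * (y /\<^sub>R R) $ 3 \<noteq> 1} = chart_dom (sphere_chart R b)"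
    unfolding radial_image_eq sphere_chart_dom by blast
  ultimately show ?thesis by (simp add: surf_top_round_sphere)
qed

lemma sphere_holomorphic_transition:
  "(coord (sphere_chart R b') \<circ> chart_inv (sphere_chart R b)) holomorphic_on
     coord (sphere_chart R b) ` (chart_dom (sphere_chart R b) \<inter> chart_dom (sphere_chart R b'))"
proof (rule holomorphic_transform)
  show "(\<lambda>z. if b = b' then z else 1 / z) holomorphic_on
      coord (sphere_chart R b) ` (chart_dom (sphere_chart R b) \<inter> chart_dom (sphere_chart R b'))"
    using sphere_transition(2) by (cases "b = b'") (auto intro!: holomorphic_intros)
qed (use sphere_transition(1) in auto)

lemma compact_riemann_surface_round_sphere: "compact_riemann_surface (round_sphere R)"
proof -
  have cont: "continuous_on (sphere 0 1) (radial R)" unfolding radial_def by (intro continuous_intros)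
  have "connected (sphere (0 :: real^3) 1)" by (rule connected_sphere) simp
  then have conn: "connected_space (surf_top (round_sphere R))"
    using connected_continuous_image[OF cont] unfolding surf_top_round_sphere
    by (simp add: connected_space_subtopology)
  have comp: "compact_space (surf_top (round_sphere R))"
    using compact_continuous_image[OF cont compact_sphere]
    by (simp add: surf_top_round_sphere compact_space_subtopology)
  have cover: "(\<Union>c\<in>surf_atlas (round_sphere R). chart_dom c) = points (round_sphere R)"
    unfolding surf_atlas_round_sphere points_round_sphere radial_image_eq
  proof (rule Set.set_eqI)
    fix y :: "real^3"
    have "(\<exists>b. pole_sign b * (y /\<^sub>R R) $ 3 \<noteq> 1)"
      by (cases "(y /\<^sub>R R) $ 3 = 1") (auto simp: pole_sign_def intro: exI[of _ False] exI[of _ True])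
    then show "y \<in> (\<Union>c\<in>range (sphere_chart R). chart_dom c) \<longleftrightarrow> y \<in> {y. norm (y /\<^sub>R R) = 1}"
      by (simp only: UN_iff bex_simps(7) sphere_chart_dom mem_Collect_eq) blast
  qed
  have sc: "second_countable (surf_top (round_sphere R))"
    unfolding surf_top_round_sphere
  proof (rule second_countable_subtopology)
    obtain B :: "(real^3) set set" where "countable B" "topological_basis B" using ex_countable_basis by blast
    then show "second_countable (euclidean :: (real^3) topology)"
      unfolding second_countable_def open_openin[symmetric]
      using topological_basis_open topological_basisE by metis
  qed
  have im: "open (chart_im c)" "openin (surf_top (round_sphere R)) (chart_dom c)"
    "homeomorphic_map (subtopology (surf_top (round_sphere R)) (chart_dom c)) (top_of_set (chart_im c)) (coord c)"
    if "c \<in> surf_atlas (round_sphere R)" for c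
    using that openin_sphere_chart_dom sphere_homeomorphic_coord sphere_chart_im
    unfolding surf_atlas_round_sphere by (metis rangeE open_UNIV)+
  have tr: "(coord d \<circ> chart_inv c) holomorphic_on (coord c ` (chart_dom c \<inter> chart_dom d))"
    if "c \<in> surf_atlas (round_sphere R)" "d \<in> surf_atlas (round_sphere R)" for c d
    using that sphere_holomorphic_transition unfolding surf_atlas_round_sphere by blast
  have "Hausdorff_space (surf_top (round_sphere R))"
    by (simp add: surf_top_round_sphere Hausdorff_space_subtopology)
  moreover have "points (round_sphere R) \<noteq> {}" by (simp add: points_round_sphere)
  ultimately show ?thesis
    unfolding compact_riemann_surface_def riemann_surface_def
    using conn comp cover sc im tr by blast
qed

end

text \<open>The conformal factor of the metric of the sphere of radius \<open>R\<close> in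
  stereographic coordinates; in dimension two it is also the area density.\<close>

definition sphere_density :: "real \<Rightarrow> complex \<Rightarrow> real" where
  "sphere_density R z = 4 * R\<^sup>2 / (1 + (cmod z)\<^sup>2)\<^sup>2"

lemma one_plus_cmod_sq_pos: "0 < 1 + (cmod z)\<^sup>2"
  by (simp add: add_pos_nonneg)

lemma sphere_density_pos: "0 < R \<Longrightarrow> 0 < sphere_density R z"
  unfolding sphere_density_def using one_plus_cmod_sq_pos[of z]
  by (intro divide_pos_pos mult_pos_pos zero_less_power) auto

lemma sphere_density_scaled: "sphere_density R z = R\<^sup>2 * sphere_density 1 z"
  by (simp add: sphere_density_def)

text \<open>Invariance of the spherical metric under the change of chart \<open>1 / z\<close>, whose
  derivative is \<open>- 1 / z\<^sup>2\<close>.\<close>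

lemma sphere_density_inverse:
  assumes "z \<noteq> 0"
  shows "sphere_density R z = (cmod (- 1 / z\<^sup>2))\<^sup>2 * sphere_density R (1 / z)"
proof -
  define n where "n = (cmod z)\<^sup>2"
  have n: "0 < n" using assms by (simp add: n_def)
  have 1: "(cmod (- 1 / z\<^sup>2))\<^sup>2 = 1 / n\<^sup>2" by (simp add: n_def norm_divide norm_power power_divide)
  have 2: "(cmod (1 / z))\<^sup>2 = 1 / n" by (simp add: n_def norm_divide power_divide)
  have "1 + 1 / n = (1 + n) / n" using n by (simp add: field_simps)
  then show ?thesis
    unfolding sphere_density_def 1 2 n_def[symmetric] using n by (simp add: power_divide)
qed

lemma continuous_on_sphere_density: "continuous_on A (sphere_density R)"
  unfolding sphere_density_def using one_plus_cmod_sq_pos by (intro continuous_intros) (metis less_irrefl power_eq_0_iff)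

lemma sphere_param_has_derivative:
  fixes z :: complex
  defines "q \<equiv> 1 + (Re z)\<^sup>2 + (Im z)\<^sup>2"
  defines "t \<equiv> \<lambda>u. Re z * Re u + Im z * Im u"
  shows "(sphere_param b has_derivative (\<lambda>u. (2 * Re u / q - 4 * Re z * t u / q\<^sup>2) *\<^sub>R axis 1 1
     + (pole_sign b * (2 * Im u / q - 4 * Im z * t u / q\<^sup>2)) *\<^sub>R axis 2 1
     + (pole_sign b * (4 * t u / q\<^sup>2)) *\<^sub>R axis 3 1)) (at z)"
proof -
  note [derivative_intros] = bounded_linear.has_derivative[OF bounded_linear_Re]
    bounded_linear.has_derivative[OF bounded_linear_Im]
  let ?q = "\<lambda>z. 1 + (Re z)\<^sup>2 + (Im z)\<^sup>2"
  have q: "?q z = q" "q \<noteq> 0" using one_plus_sq_pos[of z] by (simp_all add: q_def)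
  have dq: "(?q has_derivative (\<lambda>u. 2 * t u)) (at z)"
    by (auto intro!: derivative_eq_intros simp: t_def)
  have dRe: "((\<lambda>z. 2 * Re z) has_derivative (\<lambda>u. 2 * Re u)) (at z)"
    and dIm: "((\<lambda>z. 2 * Im z) has_derivative (\<lambda>u. 2 * Im u)) (at z)"
    by (auto intro!: derivative_eq_intros)
  have "?q z \<noteq> 0" using q by simp
  note div = has_derivative_divide'[OF _ dq this]
  have 1: "((\<lambda>z. 2 * Re z / ?q z) has_derivative (\<lambda>u. 2 * Re u / q - 4 * Re z * t u / q\<^sup>2)) (at z)"
    by (rule has_derivative_eq_rhs[OF div[OF dRe]])
      (simp only: q(1), use q(2) in \<open>simp add: fun_eq_iff diff_divide_distrib power2_eq_square[of q]\<close>)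
  have 2: "((\<lambda>z. 2 * Im z / ?q z) has_derivative (\<lambda>u. 2 * Im u / q - 4 * Im z * t u / q\<^sup>2)) (at z)"
    by (rule has_derivative_eq_rhs[OF div[OF dIm]])
      (simp only: q(1), use q(2) in \<open>simp add: fun_eq_iff diff_divide_distrib power2_eq_square[of q]\<close>)
  have 3: "((\<lambda>z. 1 - 2 / ?q z) has_derivative (\<lambda>u. 4 * t u / q\<^sup>2)) (at z)"
    by (rule has_derivative_eq_rhs[OF has_derivative_diff[OF has_derivative_const div[OF has_derivative_const]]])
      (simp only: q(1), use q(2) in \<open>simp add: fun_eq_iff power2_eq_square[of q]\<close>)
  show ?thesis
    unfolding sphere_param_def[abs_def]
    by (intro has_derivative_add has_derivative_scaleR_left has_derivative_mult_right 1 2 3)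
qed

lemma inner_complex_mult: "((a :: complex) * u) \<bullet> (a * v) = (cmod a)\<^sup>2 * (u \<bullet> v)"
  by (simp add: inner_complex_def cmod_power2) (simp add: power2_eq_square algebra_simps)

context
  fixes R :: real
  assumes R: "0 < R"
begin

lemma induced_metric_sphere:
  "induced_metric (sphere_chart R b) z u v = sphere_density R z * (u \<bullet> v)"
proof -
  define q where "q = 1 + (Re z)\<^sup>2 + (Im z)\<^sup>2"
  define t where "t = (\<lambda>u. Re z * Re u + Im z * Im u)"
  define D where "D u = (2 * Re u / q - 4 * Re z * t u / q\<^sup>2) *\<^sub>R axis 1 1
     + (pole_sign b * (2 * Im u / q - 4 * Im z * t u / q\<^sup>2)) *\<^sub>R axis 2 1
     + (pole_sign b * (4 * t u / q\<^sup>2)) *\<^sub>R (axis 3 1 :: real^3)" for u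
  have q: "0 < q" using one_plus_sq_pos[of z] by (simp add: q_def)
  have inv: "chart_inv (sphere_chart R b) = (\<lambda>z. R *\<^sub>R sphere_param b z)"
    by (rule ext) (rule sphere_chart_inv[OF R])
  have "((\<lambda>z. R *\<^sub>R sphere_param b z) has_derivative (\<lambda>u. R *\<^sub>R D u)) (at z)"
    unfolding D_def q_def t_def by (intro has_derivative_scaleR_right sphere_param_has_derivative)
  then have fd: "frechet_derivative (chart_inv (sphere_chart R b)) (at z) = (\<lambda>u. R *\<^sub>R D u)"
    unfolding inv by (rule frechet_derivative_at[symmetric])
  have Dn: "D u $ 1 = 2 * Re u / q - 4 * Re z * t u / q\<^sup>2"
    "D u $ 2 = pole_sign b * (2 * Im u / q - 4 * Im z * t u / q\<^sup>2)"
    "D u $ 3 = pole_sign b * (4 * t u / q\<^sup>2)" for u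
    by (simp_all add: D_def axis_def)
  have pp: "(pole_sign b * x) * (pole_sign b * y) = x * y" for x y
    by (auto simp: pole_sign_def)
  have "D u \<bullet> D v = D u $ 1 * D v $ 1 + D u $ 2 * D v $ 2 + D u $ 3 * D v $ 3"
    by (simp add: inner_vec_def sum_3)
  \<comment> \<open>The last bracket equals \<open>q\<close>, so the terms in
    \<open>t u * t v\<close> have coefficients -8 q, -8 q and 16 q and cancel. Only the Euclidean
    product remains, that is, the projection is conformal.\<close>
  also have "\<dots> = (4 * q\<^sup>2 * (Re u * Re v + Im u * Im v) - 8 * q * (t u * t v) - 8 * q * (t u * t v)
      + 16 * (t u * t v) * ((Re z)\<^sup>2 + (Im z)\<^sup>2 + 1)) / q ^ 4"
    unfolding Dn pp using q
    by (simp add: field_simps eval_nat_numeral) (simp add: t_def algebra_simps)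
  also have "\<dots> = (4 * q\<^sup>2 * (u \<bullet> v)) / q ^ 4"
  proof -
    have "(Re z)\<^sup>2 + (Im z)\<^sup>2 + 1 = q" by (simp add: q_def)
    then show ?thesis by (simp add: inner_complex_def)
  qed
  also have "\<dots> = 4 / q\<^sup>2 * (u \<bullet> v)" using q by (simp add: field_simps eval_nat_numeral)
  finally have "D u \<bullet> D v = 4 / q\<^sup>2 * (u \<bullet> v)" .
  moreover have "q = 1 + (cmod z)\<^sup>2" by (simp add: q_def cmod_power2)
  ultimately show ?thesis
    by (simp add: induced_metric_def fd sphere_density_def power2_eq_square)
qed

lemma deriv_sphere_transition:
  assumes z: "z \<in> coord (sphere_chart R b) ` (chart_dom (sphere_chart R b) \<inter> chart_dom (sphere_chart R b'))"
  shows "deriv (coord (sphere_chart R b') \<circ> chart_inv (sphere_chart R b)) z = (if b = b' then 1 else - 1 / z\<^sup>2)"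
proof -
  interpret surface_charts "round_sphere R"
    using compact_riemann_surface_round_sphere[OF R] by unfold_locales (simp add: compact_riemann_surface_def)
  let ?U = "coord (sphere_chart R b) ` (chart_dom (sphere_chart R b) \<inter> chart_dom (sphere_chart R b'))"
  have "open ?U" by (rule open_coord_overlap) (auto simp: surf_atlas_round_sphere)
  then have "\<forall>\<^sub>F w in nhds z. (coord (sphere_chart R b') \<circ> chart_inv (sphere_chart R b)) w = (if b = b' then w else 1 / w)"
    using eventually_nhds_in_open[OF _ z] sphere_transition(1)[OF R] by (simp add: eventually_mono)
  then have "deriv (coord (sphere_chart R b') \<circ> chart_inv (sphere_chart R b)) z = deriv (\<lambda>w. if b = b' then w else 1 / w) z"
    by (rule deriv_cong_ev) simp
  also have "\<dots> = (if b = b' then 1 else - 1 / z\<^sup>2)"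
  proof (cases "b = b'")
    case False
    then have "z \<noteq> 0" using sphere_transition(2)[OF R z] by blast
    then have "((\<lambda>w. 1 / w) has_field_derivative (- 1 / z\<^sup>2)) (at z)"
      by (auto intro!: derivative_eq_intros simp: power2_eq_square field_simps)
    then show ?thesis using False by (simp add: DERIV_imp_deriv)
  qed simp
  finally show ?thesis .
qed

lemma continuous_metric_round_sphere: "continuous_metric (round_sphere R) induced_metric"
  unfolding continuous_metric_def surf_atlas_round_sphere
proof (intro conjI ballI allI)
  fix c z assume "c \<in> range (sphere_chart R)"
  then obtain b where c: "c = sphere_chart R b" by blast
  have "bilinear (\<lambda>u v. sphere_density R z * (u \<bullet> v))"
    unfolding bilinear_def by (auto intro!: linearI simp: inner_add_left inner_add_right algebra_simps)
  then show "inner_product (induced_metric c z)"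
    unfolding inner_product_def c induced_metric_sphere[abs_def]
    using sphere_density_pos[OF R, of z] by (auto simp: inner_commute)
next
  fix c u v assume "c \<in> range (sphere_chart R)"
  then show "continuous_on (chart_im c) (\<lambda>z. induced_metric c z u v)"
    by (auto simp: induced_metric_sphere intro!: continuous_intros continuous_on_sphere_density)
next
  fix c d p u v assume "c \<in> range (sphere_chart R)" "d \<in> range (sphere_chart R)" and p: "p \<in> chart_dom c \<inter> chart_dom d"
  then obtain b b' where cd: "c = sphere_chart R b" "d = sphere_chart R b'" by blast
  have z: "coord c p \<in> coord (sphere_chart R b) ` (chart_dom (sphere_chart R b) \<inter> chart_dom (sphere_chart R b'))"
    using p cd by blast
  have der: "deriv (coord d \<circ> chart_inv c) (coord c p) = (if b = b' then 1 else - 1 / (coord c p)\<^sup>2)"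
    using deriv_sphere_transition[OF z] cd by simp
  have "sphere_density R (coord c p)
      = (cmod (deriv (coord d \<circ> chart_inv c) (coord c p)))\<^sup>2 * sphere_density R (coord d p)"
  proof (cases "b = b'")
    case False
    then have "coord d p = 1 / coord c p" "coord c p \<noteq> 0"
      using sphere_overlap[OF R, of p b b'] p cd by auto
    then show ?thesis unfolding der using False sphere_density_inverse[of "coord c p" R] by simp
  qed (simp add: der, simp add: cd)
  then show "induced_metric c (coord c p) u v = induced_metric d (coord d p)
      (deriv (coord d \<circ> chart_inv c) (coord c p) * u) (deriv (coord d \<circ> chart_inv c) (coord c p) * v)"
    unfolding cd induced_metric_sphere inner_complex_mult by (simp add: mult_ac)
qed

lemma chart_density_sphere: "chart_density induced_metric (sphere_chart R b) z = ennreal (sphere_density R z)"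
proof -
  have "gram_det (induced_metric (sphere_chart R b) z) = (sphere_density R z)\<^sup>2"
    by (simp add: gram_det_def induced_metric_sphere inner_complex_def power2_eq_square)
  then show ?thesis
    using sphere_density_pos[OF R, of z] by (simp add: chart_density_def sphere_chart_im[OF R])
qed

end

section \<open>Comparison of the spheres of radius 1 and R by the radial map\<close>

lemma chart_inv_scaled:
  assumes "0 < R"
  shows "chart_inv (sphere_chart R b) z = radial R (chart_inv (sphere_chart 1 b) z)"
  using sphere_chart_inv[OF assms] sphere_chart_inv[of 1] by (simp add: radial_def)

lemma chart_dom_scaled:
  assumes "0 < R"
  shows "radial R y \<in> chart_dom (sphere_chart R b) \<longleftrightarrow> y \<in> chart_dom (sphere_chart 1 b)"
proof -
  have "radial R y /\<^sub>R R = y" "y /\<^sub>R 1 = y" using assms by (simp_all add: radial_def)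
  then show ?thesis
    unfolding sphere_chart_dom[OF assms] sphere_chart_dom[OF zero_less_one] mem_Collect_eq by (simp only:)
qed

lemma coord_scaled:
  assumes "0 < R" "y \<in> chart_dom (sphere_chart 1 b)"
  shows "coord (sphere_chart R b) (radial R y) = coord (sphere_chart 1 b) y"
proof -
  have "radial R y \<in> chart_dom (sphere_chart R b)" using assms chart_dom_scaled by blast
  then show ?thesis
    using assms sphere_chart_coord[of R "radial R y" b] sphere_chart_coord[of 1 y b] by (simp add: radial_def)
qed

lemma points_scaled: "points (round_sphere R) = radial R ` points (round_sphere 1)"
  by (simp add: points_round_sphere radial_def)

lemma induced_metric_scaled:
  assumes "0 < R"
  shows "induced_metric (sphere_chart R b) z u v = R\<^sup>2 * induced_metric (sphere_chart 1 b) z u v"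
  using induced_metric_sphere[OF assms] induced_metric_sphere[of 1] sphere_density_scaled[of R z] by simp

text \<open>In the stereographic charts the radial map is the identity, so \<open>h\<close> and
  \<open>f\<close> have the same coordinate expressions on the same sets.\<close>

lemma local_rep_scaled:
  assumes R: "0 < R" and hf: "\<forall>p\<in>points (round_sphere 1). h p = f (radial R p)"
  shows "local_rep (sphere_chart 1 b) d h = local_rep (sphere_chart R b) d f"
    and "pullback (round_sphere 1) N h g (sphere_chart 1 b) z = pullback (round_sphere R) N f g (sphere_chart R b) z"
    and "coord (sphere_chart 1 b) ` (chart_dom (sphere_chart 1 b) \<inter> h -` V)
      = coord (sphere_chart R b) ` (chart_dom (sphere_chart R b) \<inter> f -` V)"
proof -
  interpret M: surface_charts "round_sphere 1"
    using compact_riemann_surface_round_sphere[of 1] by unfold_locales (simp add: compact_riemann_surface_def)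
  have atlas: "sphere_chart 1 b \<in> surf_atlas (round_sphere 1)" by (simp add: surf_atlas_round_sphere)
  have h: "h (chart_inv (sphere_chart 1 b) z) = f (chart_inv (sphere_chart R b) z)" for z
    using hf M.chart_inv_in_points[OF atlas] chart_inv_scaled[OF R] sphere_chart_im[of 1] by simp
  show rep: "local_rep (sphere_chart 1 b) d h = local_rep (sphere_chart R b) d f" for d
    by (simp add: local_rep_def fun_eq_iff h)
  show "pullback (round_sphere 1) N h g (sphere_chart 1 b) z = pullback (round_sphere R) N f g (sphere_chart R b) z"
    by (simp add: pullback_def fun_eq_iff h rep)
  show "coord (sphere_chart 1 b) ` (chart_dom (sphere_chart 1 b) \<inter> h -` V)
      = coord (sphere_chart R b) ` (chart_dom (sphere_chart R b) \<inter> f -` V)"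
  proof (intro equalityI subsetI)
    fix z assume "z \<in> coord (sphere_chart 1 b) ` (chart_dom (sphere_chart 1 b) \<inter> h -` V)"
    then obtain y where y: "y \<in> chart_dom (sphere_chart 1 b)" "h y \<in> V" "z = coord (sphere_chart 1 b) y" by blast
    have "h y = f (radial R y)" using hf M.chart_dom_subset[OF atlas] y(1) by blast
    then show "z \<in> coord (sphere_chart R b) ` (chart_dom (sphere_chart R b) \<inter> f -` V)"
      using y chart_dom_scaled[OF R] coord_scaled[OF R y(1)] by (intro image_eqI[of _ _ "radial R y"]) auto
  next
    fix z assume "z \<in> coord (sphere_chart R b) ` (chart_dom (sphere_chart R b) \<inter> f -` V)"
    then obtain x where x: "x \<in> chart_dom (sphere_chart R b)" "f x \<in> V" "z = coord (sphere_chart R b) x" by blast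
    define y where "y = x /\<^sub>R R"
    have xy: "x = radial R y" using R by (simp add: y_def radial_def)
    then have y: "y \<in> chart_dom (sphere_chart 1 b)" using x(1) chart_dom_scaled[OF R] by blast
    have "h y = f x" using hf M.chart_dom_subset[OF atlas] y xy by blast
    then show "z \<in> coord (sphere_chart 1 b) ` (chart_dom (sphere_chart 1 b) \<inter> h -` V)"
      using x y xy coord_scaled[OF R y] by (intro image_eqI[of _ _ y]) auto
  qed
qed

text \<open>Holomorphy and bijectivity pass between \<open>h\<close> and \<open>f\<close>, and
  \<open>compact_holomorphic_bij_imp_HD\<close> turns them into membership in
  \<open>HD\<close>.\<close>

lemma HD_scaled_iff:
  assumes R: "0 < R" and hf: "\<forall>p\<in>points (round_sphere 1). h p = f (radial R p)"
  shows "h \<in> HD (round_sphere 1) (round_sphere R) \<longleftrightarrow> f \<in> HD (round_sphere R) (round_sphere R)"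
proof -
  have cr: "compact_riemann_surface (round_sphere 1)" "compact_riemann_surface (round_sphere R)"
    using compact_riemann_surface_round_sphere R by auto
  interpret MN: surface_pair "round_sphere 1" "round_sphere R"
    using cr by unfold_locales (auto simp: compact_riemann_surface_def)
  interpret NN: surface_pair "round_sphere R" "round_sphere R"
    by unfold_locales
  let ?M = "round_sphere 1" and ?N = "round_sphere R"
  have K: "compact_space (surf_top ?M)" "compact_space (surf_top ?N)"
    using cr by (auto simp: compact_riemann_surface_def)
  have r1: "continuous_map (surf_top ?M) (surf_top ?N) (radial R)"
  proof -
    have "continuous_on A (radial R)" for A unfolding radial_def by (intro continuous_intros)
    then show ?thesis
      using points_scaled[of R] unfolding points_round_sphere surf_top_round_sphere
      by (auto simp: continuous_map_in_subtopology)
  qed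
  have r2: "continuous_map (surf_top ?N) (surf_top ?M) (\<lambda>y. y /\<^sub>R R)"
  proof -
    have "continuous_on A (\<lambda>y :: real^3. y /\<^sub>R R)" for A by (intro continuous_intros)
    moreover have "(\<lambda>y. y /\<^sub>R R) \<in> radial R ` sphere (0 :: real^3) 1 \<rightarrow> radial 1 ` sphere 0 1"
    proof
      fix y :: "real^3" assume "y \<in> radial R ` sphere 0 1"
      then have "y /\<^sub>R R \<in> sphere 0 1" using R by (auto simp: radial_def)
      then show "y /\<^sub>R R \<in> radial 1 ` sphere 0 1" by (simp add: radial_def)
    qed
    ultimately show ?thesis
      unfolding surf_top_round_sphere by (simp add: continuous_map_in_subtopology)
  qed
  have fh: "f y = h (y /\<^sub>R R)" if "y \<in> points ?N" for y
  proof -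
    from that[unfolded points_scaled[of R]]
    obtain p where p: "p \<in> points ?M" "y = radial R p" by blast
    have "y /\<^sub>R R = p" using R p(2) by (simp add: radial_def)
    then have "h (y /\<^sub>R R) = h p" by (simp only:)
    also have "\<dots> = f y" using hf p by blast
    finally show ?thesis ..
  qed
  have inj: "inj_on (radial R) (points ?M)" using R by (auto simp: inj_on_def radial_def)
  have bij: "bij_betw h (points ?M) (points ?N) \<longleftrightarrow> bij_betw f (points ?N) (points ?N)"
  proof -
    have "bij_betw f (points ?N) (points ?N) \<longleftrightarrow> bij_betw (f \<circ> radial R) (points ?M) (points ?N)"
      using bij_betw_comp_iff[of "radial R" "points ?M" "points ?N" f "points ?N"] inj points_scaled[of R]
      by (simp add: bij_betw_def)
    also have "\<dots> \<longleftrightarrow> bij_betw h (points ?M) (points ?N)"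
      using hf by (intro bij_betw_cong) simp
    finally show ?thesis ..
  qed
  have cont: "continuous_map (surf_top ?M) (surf_top ?N) h \<longleftrightarrow> continuous_map (surf_top ?N) (surf_top ?N) f"
  proof
    assume "continuous_map (surf_top ?M) (surf_top ?N) h"
    from continuous_map_compose[OF r2 this]
    show "continuous_map (surf_top ?N) (surf_top ?N) f"
      by (rule continuous_map_eq) (simp add: fh)
  next
    assume "continuous_map (surf_top ?N) (surf_top ?N) f"
    from continuous_map_compose[OF r1 this]
    show "continuous_map (surf_top ?M) (surf_top ?N) h"
      by (rule continuous_map_eq) (simp add: hf)
  qed
  have hol: "holomorphic_map ?M ?N h \<longleftrightarrow> holomorphic_map ?N ?N f"
  proof -
    have "local_rep (sphere_chart 1 b) d h holomorphic_on
          coord (sphere_chart 1 b) ` (chart_dom (sphere_chart 1 b) \<inter> h -` V) \<longleftrightarrow>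
        local_rep (sphere_chart R b) d f holomorphic_on
          coord (sphere_chart R b) ` (chart_dom (sphere_chart R b) \<inter> f -` V)" for b V
      and d :: "(real^3) chart"
      by (simp only: local_rep_scaled(1)[OF R hf] local_rep_scaled(3)[OF R hf])
    then show ?thesis
      unfolding holomorphic_map_def cont surf_atlas_round_sphere by (simp only: ball_simps)
  qed
  show ?thesis
  proof
    assume "h \<in> HD ?M ?N"
    then have "bij_betw f (points ?N) (points ?N)" "holomorphic_map ?N ?N f"
      using bij hol by (auto simp: HD_def diffeomorphism_def)
    then show "f \<in> HD ?N ?N" by (rule NN.compact_holomorphic_bij_imp_HD[OF K(2)])
  next
    assume "f \<in> HD ?N ?N"
    then have "bij_betw h (points ?M) (points ?N)" "holomorphic_map ?M ?N h"
      using bij hol by (auto simp: HD_def diffeomorphism_def)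
    then show "h \<in> HD ?M ?N" by (rule MN.compact_holomorphic_bij_imp_HD[OF K(1)])
  qed
qed

section \<open>The energy on round spheres\<close>

locale sphere_scaling =
  fixes R :: real
  assumes R: "0 < R"

sublocale sphere_scaling \<subseteq> surface_pair "round_sphere 1" "round_sphere R"
  using compact_riemann_surface_round_sphere[of 1] compact_riemann_surface_round_sphere[OF R]
  by unfold_locales (auto simp: compact_riemann_surface_def)

context sphere_scaling
begin

abbreviation (input) "M \<equiv> round_sphere 1"
abbreviation (input) "N \<equiv> round_sphere R"

lemma compact_M: "compact_space (surf_top M)" and compact_N: "compact_space (surf_top N)"
  using compact_riemann_surface_round_sphere[of 1] compact_riemann_surface_round_sphere[OF R]
  by (auto simp: compact_riemann_surface_def)

lemma metric_M: "continuous_metric M induced_metric" and metric_N: "continuous_metric N induced_metric"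
  using continuous_metric_round_sphere R by auto

text \<open>Evaluated on the single vector 1; by \<open>pullback_conformal\<close> the ratio for a
  holomorphic \<open>h\<close> is the same for all vectors and charts.\<close>

definition conformal_factor :: "(real^3 \<Rightarrow> real^3) \<Rightarrow> real^3 \<Rightarrow> real" where
  "conformal_factor h p = (let c = chart_at M p; z = coord c p
     in pullback M N h induced_metric c z 1 1 / induced_metric c z 1 1)"

lemma induced_metric_pos: "c \<in> surf_atlas M \<Longrightarrow> 0 < induced_metric c z 1 1"
  using sphere_density_pos[of 1] by (auto simp: surf_atlas_round_sphere induced_metric_sphere)

lemma pullback_sphere:
  assumes hol: "holomorphic_map M N h" and c: "c \<in> surf_atlas M" "d \<in> surf_atlas N"
    and p: "p \<in> chart_dom c" "h p \<in> chart_dom d"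
  shows "pullback M N h induced_metric c (coord c p) u v =
    sphere_density R (coord d (h p)) * (cmod (deriv (local_rep c d h) (coord c p)))\<^sup>2
      / sphere_density 1 (coord c p) * induced_metric c (coord c p) u v"
proof -
  obtain b b' where b: "c = sphere_chart 1 b" "d = sphere_chart R b'"
    using c by (auto simp: surf_atlas_round_sphere)
  have g1: "induced_metric c z u v = sphere_density 1 z * (u \<bullet> v)" for z u v
    by (simp add: b induced_metric_sphere)
  have gR: "induced_metric d z u v = sphere_density R z * (u \<bullet> v)" for z u v
    by (simp add: b induced_metric_sphere[OF R])
  show ?thesis
    unfolding pullback_eq[OF hol metric_N c p] g1 gR inner_complex_mult
    using sphere_density_pos[of 1 "coord c p"] by simp
qed

text \<open>A holomorphic differential is a complex multiplication and both metrics are multiples of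
  the Euclidean product, so the pullback is proportional to the metric. The ratio is independent of
  the chart since both tensors transform alike.\<close>

lemma pullback_conformal:
  assumes hol: "holomorphic_map M N h" and c: "c \<in> surf_atlas M" and p: "p \<in> chart_dom c"
  shows "pullback M N h induced_metric c (coord c p) u v = conformal_factor h p * induced_metric c (coord c p) u v"
proof -
  define c' d where "c' = chart_at M p" and "d = chart_at N (h p)"
  have cont: "continuous_map (surf_top M) (surf_top N) h" using hol by (simp add: holomorphic_map_def)
  have pM: "p \<in> points M" using p M.chart_dom_subset[OF c] by blast
  then have hp: "h p \<in> points N" using cont by (auto simp: continuous_map_def)
  have c': "c' \<in> surf_atlas M" "p \<in> chart_dom c'" and d: "d \<in> surf_atlas N" "h p \<in> chart_dom d"
    using M.chart_at_atlas[OF pM] M.in_chart_dom_chart_at[OF pM] N.chart_at_atlas[OF hp] N.in_chart_dom_chart_at[OF hp]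
    by (auto simp: c'_def d_def)
  define k where "k = sphere_density R (coord d (h p)) * (cmod (deriv (local_rep c' d h) (coord c' p)))\<^sup>2
      / sphere_density 1 (coord c' p)"
  have k: "pullback M N h induced_metric c' (coord c' p) u v = k * induced_metric c' (coord c' p) u v" for u v
    unfolding k_def by (rule pullback_sphere[OF hol c'(1) d(1) c'(2) d(2)])
  have "conformal_factor h p = k"
    using k[of 1 1] induced_metric_pos[OF c'(1), of "coord c' p"]
    by (simp add: conformal_factor_def Let_def c'_def[symmetric])
  moreover have pp: "p \<in> chart_dom c \<inter> chart_dom c'" using p c' by blast
  ultimately show ?thesis
    unfolding pullback_change_chart[OF hol metric_N c c'(1) pp] k
      continuous_metric_transition[OF metric_M c c'(1) pp] by simp
qed

lemma conformal_factor_eq: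
  assumes hol: "holomorphic_map M N h" and c: "c \<in> surf_atlas M" "d \<in> surf_atlas N"
    and p: "p \<in> chart_dom c" "h p \<in> chart_dom d"
  shows "conformal_factor h p = sphere_density R (coord d (h p))
    * (cmod (deriv (local_rep c d h) (coord c p)))\<^sup>2 / sphere_density 1 (coord c p)"
proof -
  have "conformal_factor h p * induced_metric c (coord c p) 1 1
    = sphere_density R (coord d (h p)) * (cmod (deriv (local_rep c d h) (coord c p)))\<^sup>2
      / sphere_density 1 (coord c p) * induced_metric c (coord c p) 1 1"
    using pullback_conformal[OF hol c(1) p(1)] pullback_sphere[OF hol c p] by metis
  then show ?thesis using induced_metric_pos[OF c(1), of "coord c p"] by (metis less_irrefl mult_right_cancel)
qed

lemma energy_density_conformal:
  assumes hol: "holomorphic_map M N h" and p: "p \<in> points M"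
  shows "energy_density induced_metric induced_metric h p = 2 * (conformal_factor h p - 1)\<^sup>2"
proof -
  let ?c = "chart_at M p"
  note c = M.chart_at_atlas[OF p] M.in_chart_dom_chart_at[OF p]
  let ?g = "induced_metric ?c (coord ?c p)"
  have "(\<lambda>u v. pullback M N h induced_metric ?c (coord ?c p) u v - ?g u v)
    = (\<lambda>u v. (conformal_factor h p - 1) * ?g u v)"
    by (simp add: pullback_conformal[OF hol c] algebra_simps)
  moreover have "inner_product ?g" using continuous_metric_inner_product[OF metric_M c(1)] c(2) by simp
  ultimately show ?thesis
    by (simp add: energy_density_def Let_def tensor_norm_sq_scaled)
qed

text \<open>Serves two conclusions: the factor is bounded on the compact sphere, which gives
  integrability, and an identity for it that holds almost everywhere holds everywhere.\<close>

lemma continuous_map_conformal_factor: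
  assumes hol: "holomorphic_map M N h"
  shows "continuous_map (surf_top M) euclideanreal (conformal_factor h)"
proof -
  have cont: "continuous_map (surf_top M) (surf_top N) h" using hol by (simp add: holomorphic_map_def)
  let ?T = "\<lambda>p. chart_dom (chart_at M p) \<inter> h -` chart_dom (chart_at N (h p))"
  have hp: "h p \<in> points N" if "p \<in> points M" for p using that cont by (auto simp: continuous_map_def)
  show ?thesis
  proof (rule pasting_lemma[where I = "points M" and T = ?T and f = "\<lambda>_. conformal_factor h"])
    fix p assume p: "p \<in> points M"
    define c d where "c = chart_at M p" and "d = chart_at N (h p)"
    have c: "c \<in> surf_atlas M" and d: "d \<in> surf_atlas N"
      using M.chart_at_atlas[OF p] N.chart_at_atlas[OF hp[OF p]] by (auto simp: c_def d_def)
    show o: "openin (surf_top M) (?T p)"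
      using openin_vimage_chart_dom[OF cont c N.openin_chart_dom[OF d]] by (simp add: c_def d_def)
    let ?X = "rep_dom h c d" and ?f = "local_rep c d h"
    have hf: "?f holomorphic_on ?X" by (rule holomorphic_local_rep[OF hol c d])
    have "continuous_on ?X (\<lambda>z. sphere_density R (?f z) * (cmod (deriv ?f z))\<^sup>2 / sphere_density 1 z)"
    proof -
      have "continuous_on ?X (\<lambda>z. sphere_density R (?f z))"
        by (rule continuous_on_compose2[OF continuous_on_sphere_density[of UNIV]])
          (use holomorphic_on_imp_continuous_on[OF hf] in auto)
      moreover have "continuous_on ?X (deriv ?f)"
        by (rule holomorphic_on_imp_continuous_on[OF holomorphic_deriv[OF hf open_rep_dom[OF cont c d]]])
      moreover have "sphere_density 1 z \<noteq> 0" for z using sphere_density_pos[of 1 z] by simp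
      ultimately show ?thesis by (intro continuous_intros continuous_on_sphere_density) auto
    qed
    then have 1: "continuous_map (top_of_set ?X) euclideanreal
        (\<lambda>z. sphere_density R (?f z) * (cmod (deriv ?f z))\<^sup>2 / sphere_density 1 z)" by simp
    have "continuous_map (subtopology (surf_top M) (chart_dom c)) euclidean (coord c)"
      using homeomorphic_imp_continuous_map[OF M.homeomorphic_coord[OF c]] by (simp add: continuous_map_in_subtopology)
    then have "continuous_map (subtopology (surf_top M) (chart_dom c \<inter> h -` chart_dom d)) euclidean (coord c)"
      by (rule continuous_map_from_subtopology_mono) auto
    then have 2: "continuous_map (subtopology (surf_top M) (chart_dom c \<inter> h -` chart_dom d)) (top_of_set ?X) (coord c)"
      by (auto simp: continuous_map_in_subtopology rep_dom_def)
    show "continuous_map (subtopology (surf_top M) (?T p)) euclideanreal (conformal_factor h)"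
      unfolding c_def[symmetric] d_def[symmetric]
    proof (rule continuous_map_eq[OF continuous_map_compose[OF 2 1]])
      fix x assume "x \<in> topspace (subtopology (surf_top M) (chart_dom c \<inter> h -` chart_dom d))"
      then have x: "x \<in> chart_dom c" "h x \<in> chart_dom d" by auto
      show "((\<lambda>z. sphere_density R (?f z) * (cmod (deriv ?f z))\<^sup>2 / sphere_density 1 z) \<circ> coord c) x = conformal_factor h x"
        using x c by (simp add: conformal_factor_eq[OF hol c d x])
    qed
  next
    fix p assume "p \<in> points M"
    then show "\<exists>j. j \<in> points M \<and> p \<in> ?T j \<and> conformal_factor h p = conformal_factor h p"
      using M.in_chart_dom_chart_at N.in_chart_dom_chart_at[OF hp] by blast
  qed auto
qed

abbreviation (input) "\<mu> \<equiv> volume_measure M induced_metric"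

lemma volume_M: "is_volume M induced_metric \<mu>"
  by (rule M.is_volume_volume_measure[OF compact_M metric_M])

lemma space_\<mu>: "space \<mu> = points M"
  using volume_M by (simp add: is_volume_def)

lemma sets_\<mu>: "sets \<mu> = sets (surface_borel M)"
  by (rule M.is_volume_sets[OF volume_M])

lemma chart_True: "sphere_chart r True \<in> surf_atlas (round_sphere r)"
  by (simp add: surf_atlas_round_sphere)

lemma north_pole: "points (round_sphere r) - chart_dom (sphere_chart r True) = {radial r (axis 3 1)}"
  by (auto simp: points_round_sphere sphere_chart_def)

text \<open>The chart omits only the north pole, which is a null set because it is a single point of
  the plane in the other chart.\<close>

lemma nn_integral_plane:
  assumes f: "f \<in> borel_measurable (surface_borel M)"
  shows "(\<integral>\<^sup>+p. f p \<partial>\<mu>)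
    = (\<integral>\<^sup>+z. f (chart_inv (sphere_chart 1 True) z) * ennreal (sphere_density 1 z) \<partial>lborel)"
proof -
  let ?c = "sphere_chart 1 True" and ?c' = "sphere_chart 1 False" and ?P = "radial 1 (axis 3 1) :: real^3"
  have c': "?c' \<in> surf_atlas M" by (simp add: surf_atlas_round_sphere)
  have P: "{?P} \<in> sets (surface_borel M)"
  proof -
    have "space (surface_borel M) - chart_dom ?c \<in> sets (surface_borel M)"
      using M.sets_surface_borelI[OF M.openin_chart_dom[OF chart_True]] by (rule sets.compl_sets)
    then show ?thesis by (simp only: space_surface_borel north_pole)
  qed
  have Pc': "{?P} \<subseteq> chart_dom ?c'"
    by (simp add: sphere_chart_dom radial_def pole_sign_def)
  have "emeasure \<mu> {?P} = (\<integral>\<^sup>+ z. chart_density induced_metric ?c' z * indicator {coord ?c' ?P} z \<partial>lborel)"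
    using M.is_volume_emeasure[OF volume_M c' P Pc'] by simp
  also have "\<dots> = 0"
    by (simp add: nn_integral_indicator_singleton)
  finally have null: "{?P} \<in> null_sets \<mu>" using P sets_\<mu> by (simp add: null_sets_def)
  have ae: "AE p in \<mu>. f p = f p * indicator (chart_dom ?c) p"
  proof (rule AE_I'[OF null])
    show "{p \<in> space \<mu>. f p \<noteq> f p * indicator (chart_dom ?c) p} \<subseteq> {?P}"
      using north_pole[of 1] unfolding space_\<mu> by (auto simp: indicator_def)
  qed
  have "(\<integral>\<^sup>+p. f p \<partial>\<mu>) = (\<integral>\<^sup>+p. f p * indicator (chart_dom ?c) p \<partial>\<mu>)"
    by (rule nn_integral_cong_AE[OF ae])
  also have "\<dots> = (\<integral>\<^sup>+z. f (chart_inv ?c z) * ennreal (sphere_density 1 z) \<partial>lborel)"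
    using M.is_volume_nn_integral_chart[OF volume_M metric_M chart_True f] chart_density_sphere[of 1 True] by simp
  finally show ?thesis .
qed

lemma emeasure_\<mu>_eq: "emeasure \<mu> (space \<mu>) = (\<integral>\<^sup>+z. ennreal (sphere_density 1 z) \<partial>lborel)"
  using nn_integral_plane[of "\<lambda>_. 1"] by simp

text \<open>Two closed hemispheres, the images of the closed unit disc under the two inverse charts,
  cover the sphere, and the density is at most 4.\<close>

lemma finite_measure_\<mu>: "finite_measure \<mu>"
proof
  let ?A = "\<lambda>b. chart_inv (sphere_chart 1 b) ` cball 0 1"
  have atlas: "sphere_chart 1 b \<in> surf_atlas M" for b by (simp add: surf_atlas_round_sphere)
  have Adom: "?A b \<subseteq> chart_dom (sphere_chart 1 b)" for b
    using M.chart_inv_in_dom sphere_chart_im[of 1 b] by auto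
  have A: "?A b \<in> sets (surface_borel M)" for b
  proof -
    have "closedin (surf_top M) (?A b)"
      using M.compactin_chart_inv_image[OF atlas, of "cball 0 1"] M.Hausdorff
      by (simp add: sphere_chart_im compactin_imp_closedin)
    then have "?A b = space (surface_borel M) - (points M - ?A b)" "openin (surf_top M) (points M - ?A b)"
      using closedin_subset by auto
    then show ?thesis using M.sets_surface_borelI sets.compl_sets by metis
  qed
  have fin: "emeasure \<mu> (?A b) < \<infinity>" for b
  proof -
    have "coord (sphere_chart 1 b) ` ?A b = cball 0 1"
      using M.coord_chart_inv sphere_chart_im[of 1 b] by (simp add: image_image)
    then have "emeasure \<mu> (?A b) = (\<integral>\<^sup>+ z. ennreal (sphere_density 1 z) * indicator (cball 0 1) z \<partial>lborel)"
      using M.is_volume_emeasure[OF volume_M atlas A Adom] chart_density_sphere[of 1 b] by simp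
    also have "\<dots> \<le> (\<integral>\<^sup>+ z. 4 * indicator (cball 0 1) (z :: complex) \<partial>lborel)"
    proof (intro nn_integral_mono mult_right_mono)
      fix z :: complex
      have "1 \<le> (1 + (cmod z)\<^sup>2)\<^sup>2" by (intro one_le_power) simp
      then have "sphere_density 1 z \<le> 4" by (simp add: sphere_density_def divide_le_eq)
      then show "ennreal (sphere_density 1 z) \<le> 4" using ennreal_leI by fastforce
    qed simp
    also have "\<dots> = 4 * emeasure lborel (cball (0 :: complex) 1)" by (simp add: nn_integral_cmult_indicator)
    also have "\<dots> < \<infinity>" using emeasure_lborel_cball_finite[of "0 :: complex" 1]
      by (simp add: ennreal_mult_less_top)
    finally show ?thesis .
  qed
  have "points M \<subseteq> ?A True \<union> ?A False"
  proof
    fix p assume p: "p \<in> points M"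
    show "p \<in> ?A True \<union> ?A False"
    proof (cases "p \<in> chart_dom (sphere_chart 1 True) \<and> cmod (coord (sphere_chart 1 True) p) \<le> 1")
      case True
      then have "p = chart_inv (sphere_chart 1 True) (coord (sphere_chart 1 True) p)"
        using M.chart_inv_coord[OF atlas] by metis
      then show ?thesis using True by (intro UnI1 image_eqI[of _ _ "coord (sphere_chart 1 True) p"]) auto
    next
      case False
      have pF: "p \<in> chart_dom (sphere_chart 1 False) \<and> cmod (coord (sphere_chart 1 False) p) \<le> 1"
      proof (cases "p \<in> chart_dom (sphere_chart 1 True)")
        case True
        then have big: "1 < cmod (coord (sphere_chart 1 True) p)" using False by simp
        have pF: "p \<in> chart_dom (sphere_chart 1 False)"
        proof (rule ccontr)
          assume "p \<notin> chart_dom (sphere_chart 1 False)"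
          then have "p = radial 1 (- axis 3 1)" using p by (auto simp: points_round_sphere sphere_chart_def)
          then have "coord (sphere_chart 1 True) p = 0"
            by (simp add: sphere_chart_def stereo_def radial_def axis_def complex_eq_iff)
          then show False using big by simp
        qed
        then show ?thesis using sphere_overlap(1)[of 1 p True False] True big by (simp add: norm_divide divide_le_eq)
      next
        case False
        then have "p = radial 1 (axis 3 1)" using p north_pole[of 1] by blast
        then show ?thesis by (simp add: sphere_chart_dom radial_def pole_sign_def) (simp add: sphere_chart_def radial_def)
      qed
      then have "p = chart_inv (sphere_chart 1 False) (coord (sphere_chart 1 False) p)"
        using M.chart_inv_coord[OF atlas] by metis
      then show ?thesis using pF by (intro UnI2 image_eqI[of _ _ "coord (sphere_chart 1 False) p"]) auto
    qed
  qed
  then have "emeasure \<mu> (space \<mu>) \<le> emeasure \<mu> (?A True \<union> ?A False)"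
    unfolding space_\<mu> using A sets_\<mu> by (intro emeasure_mono) auto
  also have "\<dots> \<le> emeasure \<mu> (?A True) + emeasure \<mu> (?A False)"
    using A sets_\<mu> by (intro emeasure_subadditive) auto
  also have "\<dots> < \<infinity>" using fin by (simp add: ennreal_add_less_top less_top)
  finally show "emeasure \<mu> (space \<mu>) \<noteq> \<infinity>" by simp
qed

end

section \<open>Mean and variance of the conformal factor\<close>

context sphere_scaling
begin

lemma conformal_factor_measurable:
  assumes "holomorphic_map M N h"
  shows "conformal_factor h \<in> borel_measurable (surface_borel M)"
proof (rule borel_measurableI)
  fix S :: "real set" assume "open S"
  then have "openin (surf_top M) {p \<in> points M. conformal_factor h p \<in> S}"
    using openin_continuous_map_preimage[OF continuous_map_conformal_factor[OF assms], of S] by simp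
  moreover have "{p \<in> points M. conformal_factor h p \<in> S} = conformal_factor h -` S \<inter> space (surface_borel M)"
    by auto
  ultimately show "conformal_factor h -` S \<inter> space (surface_borel M) \<in> sets (surface_borel M)"
    using M.sets_surface_borelI by metis
qed

lemma conformal_factor_bounded:
  assumes "holomorphic_map M N h"
  obtains B where "\<And>p. p \<in> points M \<Longrightarrow> \<bar>conformal_factor h p\<bar> \<le> B"
proof -
  have "compactin (surf_top M) (points M)" using compact_M by (simp add: compact_space_def)
  then have "compactin euclideanreal (conformal_factor h ` points M)"
    using image_compactin continuous_map_conformal_factor[OF assms] by blast
  then have "bounded (conformal_factor h ` points M)" by (simp add: compact_imp_bounded)
  then show ?thesis using that unfolding bounded_iff by auto
qed

lemma conformal_factor_nonneg:
  assumes "holomorphic_map M N h" "p \<in> points M"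
  shows "0 \<le> conformal_factor h p"
proof -
  have hp: "h p \<in> points N" using assms by (auto simp: holomorphic_map_def continuous_map_def)
  show ?thesis
    unfolding conformal_factor_eq[OF assms(1) M.chart_at_atlas[OF assms(2)] N.chart_at_atlas[OF hp]
        M.in_chart_dom_chart_at[OF assms(2)] N.in_chart_dom_chart_at[OF hp]]
    using sphere_density_pos[OF R] sphere_density_pos[of 1] by (simp add: less_imp_le)
qed

text \<open>The total area of the image does not depend on \<open>h\<close>. Removing the two points where \<open>h\<close> or the
  chart has its pole, this is the change of variables in the plane.\<close>

lemma nn_integral_conformal_factor:
  assumes h: "h \<in> HD M N"
  shows "(\<integral>\<^sup>+p. ennreal (conformal_factor h p) \<partial>\<mu>) = ennreal (R\<^sup>2) * emeasure \<mu> (space \<mu>)"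
proof -
  note hol = HD_D(1)[OF h] and cont = HD_D(2)[OF h] and inj = HD_D(3)[OF h] and surj = HD_D(4)[OF h]
  define c d where "c = sphere_chart 1 True" and "d = sphere_chart R True"
  have c: "c \<in> surf_atlas M" "chart_im c = UNIV" and d: "d \<in> surf_atlas N" "chart_im d = UNIV"
    using sphere_chart_im[of 1] sphere_chart_im[OF R] by (auto simp: c_def d_def surf_atlas_round_sphere)
  define P Q :: "real^3" where "P = radial 1 (axis 3 1)" and "Q = radial R (axis 3 1)"
  have P: "points M - chart_dom c = {P}" and Q: "points N - chart_dom d = {Q}"
    by (simp_all add: c_def d_def P_def Q_def north_pole)
  let ?f = "local_rep c d h" and ?U = "rep_dom h c d"
  have U: "open ?U" by (rule open_rep_dom[OF cont c(1) d(1)])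
  have fhol: "?f holomorphic_on ?U" by (rule holomorphic_local_rep[OF hol c(1) d(1)])
  have finj: "inj_on ?f ?U" by (rule inj_on_local_rep[OF inj c(1) d(1)])
  \<comment> \<open>\<open>?U\<close> lacks at most the coordinate of the point that
    \<open>h\<close> sends to the pole \<open>Q\<close>, and its image lacks at most the coordinate
    of \<open>h P\<close>; single points are null sets.\<close>
  have nU: "- ?U \<subseteq> {coord c (inv_into (points M) h Q)}"
  proof
    fix z assume z: "z \<in> - ?U"
    let ?p = "chart_inv c z"
    have p: "?p \<in> chart_dom c" "coord c ?p = z" "?p \<in> points M"
      using c M.chart_inv_in_dom M.coord_chart_inv M.chart_inv_in_points by auto
    have "h ?p \<notin> chart_dom d" using z p coord_in_rep_dom[of ?p c h d] by auto
    moreover have "h ?p \<in> points N" using surj p(3) by blast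
    ultimately have "h ?p = Q" using Q by blast
    then have "inv_into (points M) h Q = ?p" using inj p(3) by (metis inv_into_f_f)
    then show "z \<in> {coord c (inv_into (points M) h Q)}" using p by simp
  qed
  have nfU: "- (?f ` ?U) \<subseteq> {coord d (h P)}"
  proof
    fix w assume w: "w \<in> - (?f ` ?U)"
    let ?y = "chart_inv d w"
    have y: "?y \<in> chart_dom d" "coord d ?y = w" "?y \<in> points N"
      using d N.chart_inv_in_dom N.coord_chart_inv N.chart_inv_in_points by auto
    obtain p where p: "p \<in> points M" "h p = ?y" using y(3) surj by (metis imageE)
    have "p \<notin> chart_dom c"
    proof
      assume pc: "p \<in> chart_dom c"
      then have "coord c p \<in> ?U" "?f (coord c p) = w"
        using p y c coord_in_rep_dom[of p c h d] by auto
      then show False using w by blast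
    qed
    then have "p = P" using P p(1) by blast
    then show "w \<in> {coord d (h P)}" using p y by simp
  qed
  have ae: "AE z in lborel. z \<in> A" if "- A \<subseteq> {a}" for A and a :: complex
    by (rule AE_I'[of "{a}"]) (use that in auto)
  have meas: "(\<lambda>z. ennreal (sphere_density R z)) \<in> borel_measurable borel"
    using borel_measurable_continuous_onI[OF continuous_on_sphere_density] by measurable
  have "(\<integral>\<^sup>+p. ennreal (conformal_factor h p) \<partial>\<mu>)
    = (\<integral>\<^sup>+z. ennreal (conformal_factor h (chart_inv c z)) * ennreal (sphere_density 1 z) \<partial>lborel)"
    unfolding c_def using conformal_factor_measurable[OF hol] by (intro nn_integral_plane) measurable
  also have "\<dots> = (\<integral>\<^sup>+z. ennreal (sphere_density R (?f z)) * ennreal ((cmod (deriv ?f z))\<^sup>2) * indicator ?U z \<partial>lborel)"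
  proof (rule nn_integral_cong_AE)
    show "AE z in lborel. ennreal (conformal_factor h (chart_inv c z)) * ennreal (sphere_density 1 z)
      = ennreal (sphere_density R (?f z)) * ennreal ((cmod (deriv ?f z))\<^sup>2) * indicator ?U z"
      using ae[OF nU]
    proof eventually_elim
      case (elim z)
      then obtain p where p: "p \<in> chart_dom c" "h p \<in> chart_dom d" "z = coord c p" by (rule rep_domE)
      have "conformal_factor h (chart_inv c z) * sphere_density 1 z = sphere_density R (?f z) * (cmod (deriv ?f z))\<^sup>2"
        using p c conformal_factor_eq[OF hol c(1) d(1) p(1,2)] sphere_density_pos[of 1 z] by simp
      then show ?case
        using elim sphere_density_pos[of 1 z] sphere_density_pos[OF R, of "?f z"]
        by (simp add: ennreal_mult''[symmetric] less_imp_le)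
    qed
  qed
  also have "\<dots> = (\<integral>\<^sup>+w. ennreal (sphere_density R w) * indicator (?f ` ?U) w \<partial>lborel)"
    by (rule nn_integral_holomorphic_change_of_variables[OF U fhol finj meas, symmetric])
  also have "\<dots> = (\<integral>\<^sup>+w. ennreal (sphere_density R w) \<partial>lborel)"
  proof (rule nn_integral_cong_AE)
    show "AE w in lborel. ennreal (sphere_density R w) * indicator (?f ` ?U) w = ennreal (sphere_density R w)"
      using ae[OF nfU] by eventually_elim simp
  qed
  also have "\<dots> = (\<integral>\<^sup>+w. ennreal (R\<^sup>2) * ennreal (sphere_density 1 w) \<partial>lborel)"
    by (subst sphere_density_scaled) (simp add: ennreal_mult')
  also have "\<dots> = ennreal (R\<^sup>2) * emeasure \<mu> (space \<mu>)"
  proof -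
    have "(\<lambda>z. ennreal (sphere_density 1 z)) \<in> borel_measurable borel"
      using borel_measurable_continuous_onI[OF continuous_on_sphere_density] by measurable
    then show ?thesis unfolding emeasure_\<mu>_eq by (simp add: nn_integral_cmult)
  qed
  finally show ?thesis .
qed

lemma integrable_conformal_factor:
  assumes hol: "holomorphic_map M N h" and q: "q \<in> borel_measurable borel" "\<And>B. bounded (q ` {-B..B})"
  shows "integrable \<mu> (\<lambda>p. q (conformal_factor h p) :: real)"
proof -
  interpret finite_measure \<mu> by (rule finite_measure_\<mu>)
  obtain B where B: "\<And>p. p \<in> points M \<Longrightarrow> \<bar>conformal_factor h p\<bar> \<le> B"
    using conformal_factor_bounded[OF hol] by blast
  obtain K where K: "\<And>x. x \<in> {-B..B} \<Longrightarrow> norm (q x) \<le> K"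
    using q(2)[of B] unfolding bounded_iff by blast
  have "conformal_factor h \<in> borel_measurable \<mu>"
    using conformal_factor_measurable[OF hol] sets_\<mu> by (simp cong: measurable_cong_sets)
  then have "(\<lambda>p. q (conformal_factor h p)) \<in> borel_measurable \<mu>"
    using q(1) by measurable
  moreover have "AE p in \<mu>. norm (q (conformal_factor h p)) \<le> K"
  proof (rule AE_I2)
    fix p assume "p \<in> space \<mu>"
    then have "conformal_factor h p \<in> {-B..B}" using B[of p] by (simp add: space_\<mu> abs_le_iff)
    then show "norm (q (conformal_factor h p)) \<le> K" by (rule K)
  qed
  ultimately show ?thesis by (intro integrable_const_bound)
qed

lemma integrable_conformal_factor_continuous:
  assumes "holomorphic_map M N h" "continuous_on UNIV q"
  shows "integrable \<mu> (\<lambda>p. q (conformal_factor h p) :: real)"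
proof (rule integrable_conformal_factor[OF assms(1)])
  show "q \<in> borel_measurable borel" using assms(2) by (rule borel_measurable_continuous_onI)
  show "bounded (q ` {-B..B})" for B
    by (rule compact_imp_bounded[OF compact_continuous_image[OF continuous_on_subset[OF assms(2)]]]) auto
qed

text \<open>Since the mean of the conformal factor is \<open>R\<^sup>2\<close>, the energy splits into its variance and a
  constant.\<close>

lemma deformation_energy_sphere:
  assumes h: "h \<in> HD M N"
  shows "deformation_energy M induced_metric N induced_metric h
    = 2 * (\<integral>p. (conformal_factor h p - R\<^sup>2)\<^sup>2 \<partial>\<mu>) + 2 * (R\<^sup>2 - 1)\<^sup>2 * measure \<mu> (space \<mu>)"
proof -
  interpret finite_measure \<mu> by (rule finite_measure_\<mu>)
  note hol = HD_D(1)[OF h]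
  let ?l = "conformal_factor h"
  have i1: "integrable \<mu> ?l" and i2: "integrable \<mu> (\<lambda>p. (?l p - R\<^sup>2)\<^sup>2)"
    by (intro integrable_conformal_factor_continuous[OF hol] continuous_intros)+
  have "ennreal (\<integral>p. ?l p \<partial>\<mu>) = (\<integral>\<^sup>+p. ennreal (?l p) \<partial>\<mu>)"
    using i1 conformal_factor_nonneg[OF hol] by (intro nn_integral_eq_integral[symmetric]) (auto simp: space_\<mu>)
  also have "\<dots> = ennreal (R\<^sup>2 * measure \<mu> (space \<mu>))"
    unfolding nn_integral_conformal_factor[OF h] by (simp add: emeasure_eq_measure ennreal_mult')
  finally have mean: "(\<integral>p. ?l p \<partial>\<mu>) = R\<^sup>2 * measure \<mu> (space \<mu>)"
    using conformal_factor_nonneg[OF hol] by (subst (asm) ennreal_inj) (auto simp: space_\<mu> intro!: integral_nonneg_AE)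
  have "deformation_energy M induced_metric N induced_metric h = (\<integral>p. 2 * (?l p - 1)\<^sup>2 \<partial>\<mu>)"
    unfolding deformation_energy_eq
    by (intro Bochner_Integration.integral_cong) (auto simp: space_\<mu> energy_density_conformal[OF hol])
  \<comment> \<open>Expansion around the mean \<open>R\<^sup>2\<close>: the part linear in
    \<open>?l p\<close> integrates to a value that is the same for all \<open>h\<close>.\<close>
  also have "\<dots> = (\<integral>p. 2 * (?l p - R\<^sup>2)\<^sup>2 + (4 * (R\<^sup>2 - 1) * ?l p + (2 * (R\<^sup>2 - 1)\<^sup>2 - 4 * (R\<^sup>2 - 1) * R\<^sup>2)) \<partial>\<mu>)"
    by (intro Bochner_Integration.integral_cong) (auto simp: power2_eq_square algebra_simps)
  also have "\<dots> = 2 * (\<integral>p. (?l p - R\<^sup>2)\<^sup>2 \<partial>\<mu>) + (4 * (R\<^sup>2 - 1) * (\<integral>p. ?l p \<partial>\<mu>)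
      + (2 * (R\<^sup>2 - 1)\<^sup>2 - 4 * (R\<^sup>2 - 1) * R\<^sup>2) * measure \<mu> (space \<mu>))"
    using i1 i2 by (simp add: mult.commute)
  also have "\<dots> = 2 * (\<integral>p. (?l p - R\<^sup>2)\<^sup>2 \<partial>\<mu>) + 2 * (R\<^sup>2 - 1)\<^sup>2 * measure \<mu> (space \<mu>)"
    unfolding mean by (simp add: algebra_simps)
  finally show ?thesis .
qed

text \<open>In charts \<open>h\<close> pulls back as the isometry \<open>f\<close> does, which
  reproduces the metric of radius \<open>R\<close>; this is \<open>R\<^sup>2\<close> times the
  metric of the unit sphere.\<close>

lemma conformal_factor_isometry:
  assumes h: "h \<in> HD M N" and hf: "\<forall>p\<in>points M. h p = f (radial R p)"
    and iso: "\<And>c z. c \<in> surf_atlas N \<Longrightarrow> pullback N N f induced_metric c z = induced_metric c z"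
    and p: "p \<in> points M"
  shows "conformal_factor h p = R\<^sup>2"
proof -
  let ?c = "chart_at M p"
  obtain b where b: "?c = sphere_chart 1 b"
    using M.chart_at_atlas[OF p] by (auto simp: surf_atlas_round_sphere)
  have "sphere_chart R b \<in> surf_atlas N" by (simp add: surf_atlas_round_sphere)
  then have "pullback M N h induced_metric ?c (coord ?c p) 1 1 = R\<^sup>2 * induced_metric ?c (coord ?c p) 1 1"
    unfolding b local_rep_scaled(2)[OF R hf] using iso induced_metric_scaled[OF R] by simp
  then show ?thesis
    using induced_metric_pos[OF M.chart_at_atlas[OF p], of "coord ?c p"]
    by (simp add: conformal_factor_def Let_def)
qed

text \<open>The competitor of zero variance, obtained from \<open>conformal_factor_isometry\<close>
  with the identity as isometry.\<close>

lemma radial_HD: "radial R \<in> HD M N"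
  and conformal_factor_radial: "p \<in> points M \<Longrightarrow> conformal_factor (radial R) p = R\<^sup>2"
proof -
  interpret NN: surface_pair N N by unfold_locales
  have rep: "local_rep c d (\<lambda>x. x) = coord d \<circ> chart_inv c" for c d :: "(real^3) chart"
    by (simp add: local_rep_def fun_eq_iff)
  have hol: "holomorphic_map N N (\<lambda>x. x)"
    unfolding holomorphic_map_def rep using N.holomorphic_transition by simp
  have id: "(\<lambda>x. x) \<in> HD N N"
    by (rule NN.compact_holomorphic_bij_imp_HD[OF compact_N _ hol]) (simp add: bij_betw_def)
  have eq: "\<forall>p\<in>points M. radial R p = (\<lambda>x. x) (radial R p)" by simp
  show r: "radial R \<in> HD M N" using HD_scaled_iff[OF R eq] id by blast
  have iso: "pullback N N (\<lambda>x. x) induced_metric c z = induced_metric c z" if c: "c \<in> surf_atlas N" for c z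
  proof (intro ext)
    fix u v
    have "chart_im c = UNIV" using c sphere_chart_im[OF R] by (auto simp: surf_atlas_round_sphere)
    then have q: "chart_inv c z \<in> chart_dom c" "coord c (chart_inv c z) = z"
      using N.chart_inv_in_dom N.coord_chart_inv by auto
    have "pullback N N (\<lambda>x. x) induced_metric c (coord c (chart_inv c z)) u v = induced_metric c (coord c (chart_inv c z)) u v"
      unfolding NN.pullback_eq[OF hol metric_N c c q(1) q(1)] rep
      by (rule continuous_metric_transition[OF metric_N c c, symmetric]) (use q in blast)
    then show "pullback N N (\<lambda>x. x) induced_metric c z u v = induced_metric c z u v" unfolding q(2) .
  qed
  show "conformal_factor (radial R) p = R\<^sup>2" if "p \<in> points M"
    by (rule conformal_factor_isometry[OF r eq iso that])
qed

text \<open>By \<open>deformation_energy_sphere\<close> only the variance depends on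
  \<open>h\<close>, and the radial map attains variance 0; so a minimizer is a map of variance
  0.\<close>

lemma energy_minimizer_iff_conformal_factor:
  assumes h: "h \<in> HD M N"
  shows "energy_minimizer M induced_metric N induced_metric h \<longleftrightarrow> (\<forall>p\<in>points M. conformal_factor h p = R\<^sup>2)"
proof
  assume "\<forall>p\<in>points M. conformal_factor h p = R\<^sup>2"
  then have "(\<integral>p. (conformal_factor h p - R\<^sup>2)\<^sup>2 \<partial>\<mu>) = (\<integral>p. 0 \<partial>\<mu>)"
    by (intro Bochner_Integration.integral_cong) (auto simp: space_\<mu>)
  moreover have "0 \<le> (\<integral>p. (conformal_factor k p - R\<^sup>2)\<^sup>2 \<partial>\<mu>)" for k by simp
  ultimately show "energy_minimizer M induced_metric N induced_metric h"
    using h by (simp add: energy_minimizer_def deformation_energy_sphere)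
next
  assume min: "energy_minimizer M induced_metric N induced_metric h"
  note hol = HD_D(1)[OF h]
  let ?l = "conformal_factor h"
  have "(\<integral>p. (conformal_factor (radial R) p - R\<^sup>2)\<^sup>2 \<partial>\<mu>) = (\<integral>p. 0 \<partial>\<mu>)"
    by (intro Bochner_Integration.integral_cong) (auto simp: space_\<mu> conformal_factor_radial)
  then have "(\<integral>p. (?l p - R\<^sup>2)\<^sup>2 \<partial>\<mu>) \<le> 0"
    using min radial_HD h by (auto simp: energy_minimizer_def deformation_energy_sphere)
  moreover have "0 \<le> (\<integral>p. (?l p - R\<^sup>2)\<^sup>2 \<partial>\<mu>)" by simp
  ultimately have z: "(\<integral>p. (?l p - R\<^sup>2)\<^sup>2 \<partial>\<mu>) = 0" by linarith
  have i: "integrable \<mu> (\<lambda>p. (?l p - R\<^sup>2)\<^sup>2)"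
    by (intro integrable_conformal_factor_continuous[OF hol] continuous_intros)
  have ae: "AE p in \<mu>. ?l p = R\<^sup>2"
    using integral_nonneg_eq_0_iff_AE[OF i] z by simp
  \<comment> \<open>Passage from almost everywhere to everywhere: the exceptional set is open by
    continuity, and a nonempty open set has positive volume because the density is positive.\<close>
  let ?O = "{p \<in> points M. ?l p \<in> - {R\<^sup>2}}"
  have O: "openin (surf_top M) ?O"
    by (rule openin_continuous_map_preimage[OF continuous_map_conformal_factor[OF hol]]) auto
  show "\<forall>p\<in>points M. ?l p = R\<^sup>2"
  proof (rule ccontr)
    assume "\<not> ?thesis"
    then obtain p where p: "p \<in> points M" "?l p \<noteq> R\<^sup>2" by blast
    obtain b where b: "chart_at M p = sphere_chart 1 b"
      using M.chart_at_atlas[OF p(1)] by (auto simp: surf_atlas_round_sphere)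
    let ?c = "sphere_chart 1 b"
    have c: "?c \<in> surf_atlas M" "p \<in> chart_dom ?c"
      using M.chart_at_atlas[OF p(1)] M.in_chart_dom_chart_at[OF p(1)] b by auto
    let ?W = "coord ?c ` (chart_dom ?c \<inter> ?O)"
    have W: "open ?W" "?W \<noteq> {}" using M.open_coord_image[OF c(1) O] c(2) p by auto
    have Os: "chart_dom ?c \<inter> ?O \<in> sets (surface_borel M)"
      using M.sets_surface_borelI[OF O] M.sets_surface_borelI[OF M.openin_chart_dom[OF c(1)]] by blast
    have "emeasure \<mu> (chart_dom ?c \<inter> ?O) = 0"
    proof -
      have "AE p in \<mu>. p \<notin> chart_dom ?c \<inter> ?O" using ae by eventually_elim auto
      then have "emeasure \<mu> {p \<in> space \<mu>. p \<in> chart_dom ?c \<inter> ?O} = 0" by (rule emeasure_eq_0_AE)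
      moreover have "{p \<in> space \<mu>. p \<in> chart_dom ?c \<inter> ?O} = chart_dom ?c \<inter> ?O" unfolding space_\<mu> by blast
      ultimately show ?thesis by simp
    qed
    then have "(\<integral>\<^sup>+ z. ennreal (sphere_density 1 z) * indicator ?W z \<partial>lborel) = 0"
      using M.is_volume_emeasure[OF volume_M c(1) Os] chart_density_sphere[of 1 b] by simp
    moreover have "(\<lambda>z. ennreal (sphere_density 1 z) * indicator ?W z) \<in> borel_measurable lborel"
    proof -
      have "sphere_density 1 \<in> borel_measurable borel"
        using borel_measurable_continuous_onI[OF continuous_on_sphere_density] .
      moreover have "?W \<in> sets borel" using W by simp
      ultimately show ?thesis by measurable
    qed
    ultimately have "AE z in lborel. ennreal (sphere_density 1 z) * indicator ?W z = 0"
      by (simp add: nn_integral_0_iff_AE)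
    then have "AE z in lborel. z \<notin> ?W"
    proof eventually_elim
      case (elim z)
      then show ?case using sphere_density_pos[of 1 z] by (auto simp: indicator_def split: if_splits)
    qed
    then have "emeasure lborel {z \<in> space lborel. z \<in> ?W} = 0" by (rule emeasure_eq_0_AE)
    then have "emeasure lborel ?W = 0" by simp
    then have "negligible ?W"
      using W(1) by (simp add: negligible_iff_emeasure0)
    then show False using open_not_negligible[OF W] by blast
  qed
qed

lemma energy_minimizer_iff_isometry:
  assumes h: "h \<in> HD M N"
  shows "energy_minimizer M induced_metric N induced_metric h \<longleftrightarrow>
    (\<exists>f. riemannian_isometry N induced_metric N induced_metric f \<and> (\<forall>p\<in>points M. h p = f (radial R p)))"
  unfolding energy_minimizer_iff_conformal_factor[OF h]
proof
  assume "\<exists>f. riemannian_isometry N induced_metric N induced_metric f \<and> (\<forall>p\<in>points M. h p = f (radial R p))"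
  then obtain f where f: "riemannian_isometry N induced_metric N induced_metric f" "\<forall>p\<in>points M. h p = f (radial R p)"
    by blast
  have "pullback N N f induced_metric c z = induced_metric c z" if "c \<in> surf_atlas N" for c z
    using f(1) that sphere_chart_im[OF R] unfolding riemannian_isometry_def surf_atlas_round_sphere by (metis UNIV_I rangeE)
  then show "\<forall>p\<in>points M. conformal_factor h p = R\<^sup>2"
    using conformal_factor_isometry[OF h f(2)] by blast
next
  assume conf: "\<forall>p\<in>points M. conformal_factor h p = R\<^sup>2"
  \<comment> \<open>\<open>h\<close> preceded by the inverse of the radial map. The constant
    conformal factor \<open>R\<^sup>2\<close> of \<open>h\<close> compensates the scaling of the
    metric, which makes \<open>f\<close> an isometry.\<close>
  define f where "f y = h (y /\<^sub>R R)" for y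
  have hf: "\<forall>p\<in>points M. h p = f (radial R p)" using R by (simp add: f_def radial_def)
  have "f \<in> HD N N" using HD_scaled_iff[OF R hf] h by blast
  then have diff: "diffeomorphism N N f" by (simp add: HD_def)
  have "pullback N N f induced_metric c z = induced_metric c z" if c: "c \<in> surf_atlas N" for c z
  proof (intro ext)
    fix u v
    obtain b where b: "c = sphere_chart R b" using c by (auto simp: surf_atlas_round_sphere)
    let ?c = "sphere_chart 1 b" and ?p = "chart_inv (sphere_chart 1 b) z"
    have c1: "?c \<in> surf_atlas M" by (simp add: surf_atlas_round_sphere)
    have p: "?p \<in> chart_dom ?c" "coord ?c ?p = z" "?p \<in> points M"
      using M.chart_inv_in_dom M.coord_chart_inv M.chart_inv_in_points[OF c1] sphere_chart_im[of 1 b] by auto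
    have "pullback N N f induced_metric c z u v = pullback M N h induced_metric ?c (coord ?c ?p) u v"
      unfolding b p(2) local_rep_scaled(2)[OF R hf] ..
    also have "\<dots> = conformal_factor h ?p * induced_metric ?c (coord ?c ?p) u v"
      by (rule pullback_conformal[OF HD_D(1)[OF h] c1 p(1)])
    also have "\<dots> = R\<^sup>2 * induced_metric ?c z u v"
      using conf p(3) by (simp only: p(2))
    also have "\<dots> = induced_metric c z u v" unfolding b induced_metric_scaled[OF R, of b] ..
    finally show "pullback N N f induced_metric c z u v = induced_metric c z u v" .
  qed
  then show "\<exists>f. riemannian_isometry N induced_metric N induced_metric f \<and> (\<forall>p\<in>points M. h p = f (radial R p))"
    using diff hf unfolding riemannian_isometry_def by blast
qed

end

theorem theorem1p2:
  shows
    "(\<forall>R::real. 0 < R \<longrightarrow>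
        (let M = round_sphere 1; N = round_sphere R in
         \<forall>h\<in>HD M N.
           energy_minimizer M induced_metric N induced_metric h \<longleftrightarrow>
           (\<exists>f. riemannian_isometry N induced_metric N induced_metric f \<and>
                (\<forall>p\<in>points M. h p = f (radial R p))))) \<and>
     (\<forall>(M :: 'a surface) (gM :: 'a tensor_field) (N :: 'b surface) (gN :: 'b tensor_field).
        compact_riemann_surface M \<longrightarrow> riemannian_metric M gM \<longrightarrow>
        compact_riemann_surface N \<longrightarrow> riemannian_metric N gN \<longrightarrow>
        HD M N \<noteq> {} \<longrightarrow> 2 \<le> genus M \<longrightarrow>
        (\<exists>h. energy_minimizer M gM N gN h))"
proof (intro conjI allI impI)
  fix R :: real assume "0 < R"
  then interpret sphere_scaling R by unfold_locales
  show "let M = round_sphere 1; N = round_sphere R in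
         \<forall>h\<in>HD M N.
           energy_minimizer M induced_metric N induced_metric h \<longleftrightarrow>
           (\<exists>f. riemannian_isometry N induced_metric N induced_metric f \<and>
                (\<forall>p\<in>points M. h p = f (radial R p)))"
    unfolding Let_def using energy_minimizer_iff_isometry by blast
next
  fix M :: "'a surface" and gM :: "'a tensor_field" and N :: "'b surface" and gN :: "'b tensor_field"
  assume M: "compact_riemann_surface M" "riemannian_metric M gM"
    and N: "compact_riemann_surface N" "riemannian_metric N gN" and ne: "HD M N \<noteq> {}"
  interpret surface_pair M N
    using M(1) N(1) by unfold_locales (auto simp: compact_riemann_surface_def)
  show "\<exists>h. energy_minimizer M gM N gN h"
    using M(1) N(1) by (intro energy_minimizer_exists M.riemannian_metric_imp_continuous[OF M(2)]
      N.riemannian_metric_imp_continuous[OF N(2)] ne) (auto simp: compact_riemann_surface_def)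
qed

end
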